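(* Let $(A,b)\in\mathcal B$ (setting $\mathcal B$) and $F\in L^2_{\mathrm{per}}(Y;\mathbb{R}^n)$. Let $\gamma:=\frac{\mathrm{tr}(A)}{|A|^2+|b|^2}$, $\tilde A:=\gamma A$, $\tilde b:=\gamma b$, and let $B_2:H^1_{\mathrm{per},0}(Y;\mathbb{R}^n)\times H^1_{\mathrm{per},0}(Y;\mathbb{R}^n)\to\mathbb{R}$ be given by $$B_2(v,w):=\int_Y(\nabla\cdot v)(\tilde A:Dw+\tilde b\cdot w)+\frac12\int_Y(Dv-(Dv)^{\mathrm T}):(Dw-(Dw)^{\mathrm T}).$$ Let $\tilde\rho_0\in H^1_{\mathrm{per},0}(Y;\mathbb{R}^n)$ be the unique element with $B_2(\tilde\rho_0,w)=-\int_Y F\cdot w$ for all $w\in H^1_{\mathrm{per},0}(Y;\mathbb{R}^n)$, and let $\tilde u_0=-\nabla\cdot\tilde\rho_0$, which is the unique solution in $L^2_{\mathrm{per}}(Y)$ to $$-D^2:(\tilde A\tilde u_0)+\nabla\cdot(\tilde b\tilde u_0)=\nabla\cdot F\ \text{ in }Y,\qquad\tilde u_0\text{ is }Y\text{-periodic},\qquad\int_Y\tilde u_0=0.$$ Let $P_h$ be a closed linear subspace of $H^1_{\mathrm{per},0}(Y;\mathbb{R}^n)$. Then there exists a unique $\tilde\rho_h\in P_h$ such that $B_2(\tilde\rho_h,w_h)=-\int_Y F\cdot w_h$ for all $w_h\in P_h$, and setting $\tilde u_h:=-\nabla\cdot\tilde\rho_h\in L^2_{\mathrm{per}}(Y)$,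 there holds $$\|\tilde u_0-\tilde u_h\|_{L^2(Y)}\le C\inf_{w_h\in P_h}\|D(\tilde\rho_0-w_h)\|_{L^2(Y;\mathbb{R}^{n\times n})}$$ for some constant $C=C(\lambda,\Lambda,\delta,n)>0$.
   Context: $Y:=(0,1)^n\subset\mathbb{R}^n$. The subscript "per" denotes spaces of $Y$-periodic functions on $\mathbb{R}^n$ with the indicated (local) regularity; the additional subscript $0$ means that (each component of) the function has mean zero over $Y$. $|A|:=\sqrt{A:A}$ is the Frobenius norm, $|b|$ the Euclidean norm, $M:N=\sum_{ij}M_{ij}N_{ij}$, and $Dw$ is the Jacobian of $w$. Setting $\mathcal B$: $(A,b)\in\mathcal B$ means that $A\in L^\infty_{\mathrm{per}}(Y;\mathbb{R}^{n\times n}_{\mathrm{sym}})$, $b\in L^\infty_{\mathrm{per}}(Y;\mathbb{R}^n)$; $A$ is uniformly elliptic, i.e. there are $\lambda,\Lambda>0$ with $\lambda I_n\le A\le\Lambda I_n$ a.e. in $\mathbb{R}^n$; and the Cordes-type condition holds: there exists $\delta\in\left(\frac{n}{n+\pi^2},1\right]$ such that $\frac{|A|^2+|b|^2}{(\mathrm{tr}(A))^2}\le\frac{1}{n-1+\delta}$ a.e. in $\mathbb{R}^n$. The constants $\lambda,\Lambda,\delta$ in the claim are these. $D^2:(\tilde A u):=\sum_{i,j}\partial^2_{ij}(\tilde a_{ij}u)$. Solutions $\tilde u_0\in L^2_{\mathrm{per}}(Y)$ are understood in the very weak sense: $\int_Y\tilde u_0\,(\tilde A:D^2\varphi+\tilde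 b\cdot\nabla\varphi)=\int_Y F\cdot\nabla\varphi$ for all $\varphi\in H^2_{\mathrm{per}}(Y)$. *)

theory Defs
  imports "HOL-Analysis.Analysis"
begin

text \<open>
  Elements of Lebesgue and Sobolev spaces are represented by Lebesgue measurable functions
  on the whole of \<open>real ^ 'n\<close>; two representatives denote the same element iff they agree almost
  everywhere. All predicates below are invariant under changes on null sets, and uniqueness
  is always meant modulo null sets.
  The library norm and inner product on \<open>real ^ 'n ^ 'n\<close> are the Frobenius norm \<open>|M|\<close> and
  the Frobenius product \<open>M:N\<close>.
\<close>

definition Ycell :: "(real ^ 'n) set" where
  "Ycell = box 0 (\<chi> i. 1)"

definition Y_periodic :: "(real ^ 'n \<Rightarrow> 'b) \<Rightarrow> bool" where
  "Y_periodic f \<longleftrightarrow> (\<forall>i. AE x in lebesgue. f (x + axis i 1) = f x)"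

definition ex1_ae :: "((real ^ 'n \<Rightarrow> 'b) \<Rightarrow> bool) \<Rightarrow> bool" where
  "ex1_ae S \<longleftrightarrow> (\<exists>f. S f \<and> (\<forall>g. S g \<longrightarrow> (AE x in lebesgue. g x = f x)))"


subsection \<open>Weak derivatives\<close>

definition pderiv_at :: "'n \<Rightarrow> (real ^ 'n \<Rightarrow> real) \<Rightarrow> real ^ 'n \<Rightarrow> real" where
  "pderiv_at i f x = frechet_derivative f (at x) (axis i 1)"

primrec Ck :: "nat \<Rightarrow> (real ^ 'n \<Rightarrow> real) \<Rightarrow> bool" where
  "Ck 0 f \<longleftrightarrow> continuous_on UNIV f"
| "Ck (Suc k) f \<longleftrightarrow> f differentiable_on UNIV \<and> (\<forall>i. Ck k (pderiv_at i f))"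

definition test_functions :: "(real ^ 'n \<Rightarrow> real) set" where
  "test_functions = {\<phi>. (\<forall>k. Ck k \<phi>) \<and> compact (closure {x. \<phi> x \<noteq> 0})}"

definition L1_loc :: "(real ^ 'n \<Rightarrow> real) set" where
  "L1_loc = {f \<in> borel_measurable lebesgue. \<forall>K. compact K \<longrightarrow> set_integrable lebesgue K f}"

definition has_weak_pderiv :: "'n \<Rightarrow> (real ^ 'n \<Rightarrow> real) \<Rightarrow> (real ^ 'n \<Rightarrow> real) \<Rightarrow> bool" where
  "has_weak_pderiv i f g \<longleftrightarrow> f \<in> L1_loc \<and> g \<in> L1_loc \<and>
     (\<forall>\<phi>\<in>test_functions.
        (LINT x|lebesgue. f x * pderiv_at i \<phi> x) = - (LINT x|lebesgue. g x * \<phi> x))"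

text \<open>The weak derivative is determined up to null sets; if there is none, the value is
  unspecified. It is only used on functions in \<open>H1_per\<close>.\<close>

definition wpd :: "'n \<Rightarrow> (real ^ 'n \<Rightarrow> real) \<Rightarrow> real ^ 'n \<Rightarrow> real" where
  "wpd i f = (SOME g. has_weak_pderiv i f g)"

definition Grad :: "(real ^ 'n \<Rightarrow> real) \<Rightarrow> real ^ 'n \<Rightarrow> real ^ 'n" where
  "Grad \<phi> x = (\<chi> i. wpd i \<phi> x)"

definition Hess :: "(real ^ 'n \<Rightarrow> real) \<Rightarrow> real ^ 'n \<Rightarrow> real ^ 'n ^ 'n" where
  "Hess \<phi> x = (\<chi> i j. wpd i (wpd j \<phi>) x)"

definition Jac :: "(real ^ 'n \<Rightarrow> real ^ 'n) \<Rightarrow> real ^ 'n \<Rightarrow> real ^ 'n ^ 'n" where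
  "Jac v x = (\<chi> i j. wpd j (\<lambda>y. v y $ i) x)"

definition Div :: "(real ^ 'n \<Rightarrow> real ^ 'n) \<Rightarrow> real ^ 'n \<Rightarrow> real" where
  "Div v x = (\<Sum>i\<in>UNIV. wpd i (\<lambda>y. v y $ i) x)"


subsection \<open>Periodic Lebesgue and Sobolev spaces\<close>

definition L2_loc :: "(real ^ 'n \<Rightarrow> 'b::euclidean_space) set" where
  "L2_loc = {f \<in> borel_measurable lebesgue.
     \<forall>K. compact K \<longrightarrow> set_integrable lebesgue K (\<lambda>x. (norm (f x))\<^sup>2)}"

definition L2_per :: "(real ^ 'n \<Rightarrow> 'b::euclidean_space) set" where
  "L2_per = {f \<in> L2_loc. Y_periodic f}"

definition Linf_per :: "(real ^ 'n \<Rightarrow> 'b::euclidean_space) set" where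
  "Linf_per = {f \<in> borel_measurable lebesgue.
     (\<exists>M. AE x in lebesgue. norm (f x) \<le> M) \<and> Y_periodic f}"

definition H1_per :: "(real ^ 'n \<Rightarrow> real) set" where
  "H1_per = {f \<in> L2_per. \<forall>i. \<exists>g\<in>L2_loc. has_weak_pderiv i f g}"

definition H2_per :: "(real ^ 'n \<Rightarrow> real) set" where
  "H2_per = {f \<in> H1_per. \<forall>i. wpd i f \<in> H1_per}"

definition H1_per0_vec :: "(real ^ 'n \<Rightarrow> real ^ 'n) set" where
  "H1_per0_vec =
     {v. \<forall>i. (\<lambda>x. v x $ i) \<in> H1_per \<and> (LINT x:Ycell|lebesgue. v x $ i) = 0}"

definition L2norm :: "(real ^ 'n \<Rightarrow> 'b::euclidean_space) \<Rightarrow> real" where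
  "L2norm f = sqrt (LINT x:Ycell|lebesgue. (norm (f x))\<^sup>2)"

definition H1norm :: "(real ^ 'n \<Rightarrow> real ^ 'n) \<Rightarrow> real" where
  "H1norm v = sqrt ((L2norm v)\<^sup>2 + (L2norm (Jac v))\<^sup>2)"

text \<open>Sequential closedness with respect to the seminorm \<open>H1norm\<close> on representatives also makes
  \<open>P\<close> closed under changes on null sets (consider constant sequences), so such \<open>P\<close> correspond
  exactly to the closed linear subspaces of the space of equivalence classes.\<close>

definition closed_subspace_H1_per0 :: "(real ^ 'n \<Rightarrow> real ^ 'n) set \<Rightarrow> bool" where
  "closed_subspace_H1_per0 P \<longleftrightarrow>
     P \<subseteq> H1_per0_vec \<and>
     (\<lambda>x. 0) \<in> P \<and>
     (\<forall>v\<in>P. \<forall>w\<in>P. (\<lambda>x. v x + w x) \<in> P) \<and>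
     (\<forall>c. \<forall>v\<in>P. (\<lambda>x. c *\<^sub>R v x) \<in> P) \<and>
     (\<forall>f w. (\<forall>k::nat. f k \<in> P) \<and> w \<in> H1_per0_vec \<and>
        (\<lambda>k. H1norm (\<lambda>x. f k x - w x)) \<longlonglongrightarrow> 0 \<longrightarrow> w \<in> P)"


subsection \<open>The coefficients and the variational problem\<close>

definition settingB ::
  "real \<Rightarrow> real \<Rightarrow> real \<Rightarrow> (real ^ 'n \<Rightarrow> real ^ 'n ^ 'n) \<Rightarrow> (real ^ 'n \<Rightarrow> real ^ 'n) \<Rightarrow> bool"
where
  "settingB lam Lam \<delta> A b \<longleftrightarrow>
     A \<in> Linf_per \<and> b \<in> Linf_per \<and>
     (AE x in lebesgue. transpose (A x) = A x) \<and>
     0 < lam \<and> 0 < Lam \<and>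
     (AE x in lebesgue. \<forall>\<xi>. lam * (norm \<xi>)\<^sup>2 \<le> \<xi> \<bullet> (A x *v \<xi>) \<and>
                              \<xi> \<bullet> (A x *v \<xi>) \<le> Lam * (norm \<xi>)\<^sup>2) \<and>
     real CARD('n) / (real CARD('n) + pi\<^sup>2) < \<delta> \<and> \<delta> \<le> 1 \<and>
     (AE x in lebesgue. ((norm (A x))\<^sup>2 + (norm (b x))\<^sup>2) / (trace (A x))\<^sup>2
                          \<le> 1 / (real CARD('n) - 1 + \<delta>))"

definition renorm ::
  "(real ^ 'n \<Rightarrow> real ^ 'n ^ 'n) \<Rightarrow> (real ^ 'n \<Rightarrow> real ^ 'n) \<Rightarrow> real ^ 'n \<Rightarrow> real" where
  "renorm A b x = trace (A x) / ((norm (A x))\<^sup>2 + (norm (b x))\<^sup>2)"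

definition B2 ::
  "(real ^ 'n \<Rightarrow> real ^ 'n ^ 'n) \<Rightarrow> (real ^ 'n \<Rightarrow> real ^ 'n) \<Rightarrow>
   (real ^ 'n \<Rightarrow> real ^ 'n) \<Rightarrow> (real ^ 'n \<Rightarrow> real ^ 'n) \<Rightarrow> real"
where
  "B2 At bt v w =
     (LINT x:Ycell|lebesgue. Div v x * (At x \<bullet> Jac w x + bt x \<bullet> w x)) +
     1 / 2 * (LINT x:Ycell|lebesgue.
       (Jac v x - transpose (Jac v x)) \<bullet> (Jac w x - transpose (Jac w x)))"

definition solves_in ::
  "(real ^ 'n \<Rightarrow> real ^ 'n) set \<Rightarrow> (real ^ 'n \<Rightarrow> real ^ 'n ^ 'n) \<Rightarrow>
   (real ^ 'n \<Rightarrow> real ^ 'n) \<Rightarrow> (real ^ 'n \<Rightarrow> real ^ 'n) \<Rightarrow> (real ^ 'n \<Rightarrow> real ^ 'n) \<Rightarrow> bool"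
where
  "solves_in V At bt F \<rho> \<longleftrightarrow>
     \<rho> \<in> V \<and> (\<forall>w\<in>V. B2 At bt \<rho> w = - (LINT x:Ycell|lebesgue. F x \<bullet> w x))"

text \<open>Very weak, periodic, mean-zero solutions of
  \<open>- D\<^sup>2 : (At u) + div (bt u) = div F\<close>.\<close>

definition very_weak_solution ::
  "(real ^ 'n \<Rightarrow> real ^ 'n ^ 'n) \<Rightarrow> (real ^ 'n \<Rightarrow> real ^ 'n) \<Rightarrow>
   (real ^ 'n \<Rightarrow> real ^ 'n) \<Rightarrow> (real ^ 'n \<Rightarrow> real) \<Rightarrow> bool"
where
  "very_weak_solution At bt F u \<longleftrightarrow>
     u \<in> L2_per \<and> (LINT x:Ycell|lebesgue. u x) = 0 \<and>
     (\<forall>\<phi>\<in>H2_per. (LINT x:Ycell|lebesgue. u x * (At x \<bullet> Hess \<phi> x + bt x \<bullet> Grad \<phi> x)) =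
                  (LINT x:Ycell|lebesgue. F x \<bullet> Grad \<phi> x))"

end

theory Submission
  imports Defs
begin

text \<open>
  By periodicity \<open>\<integral> \<partial>\<^sub>j v\<^sub>i \<partial>\<^sub>i w\<^sub>j = \<integral> \<partial>\<^sub>i v\<^sub>i \<partial>\<^sub>j w\<^sub>j\<close> over the cell, so that for \<open>A = I\<close>, \<open>b = 0\<close> the form \<open>B\<^sub>2\<close>
  is the inner product \<open>\<integral> Dv : Dw\<close>. The Cordes condition says \<open>|\<gamma>A - I|\<^sup>2 + |\<gamma>b|\<^sup>2 \<le> 1 - \<delta>\<close>; with the
  Poincare inequality with constant \<open>K = 5n/64 < n / pi\<^sup>2\<close> this makes \<open>B\<^sub>2\<close> a perturbation of that inner
  product of relative size \<open>\<kappa> = sqrt ((1 - \<delta>) (1 + K)) < 1\<close>. A contraction argument gives the solutions,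
  and Galerkin orthogonality the error bound with \<open>C = (1 + \<kappa>) / (1 - \<kappa>)\<close>. Testing with \<open>w = \<nabla>\<phi>\<close>
  yields the very weak equation. For its uniqueness, the difference \<open>d\<close> of two solutions is written as
  \<open>d = \<Delta>\<psi>\<close> with \<open>\<psi> \<in> H\<^sup>2\<close>; then \<open>0 = \<integral> d (\<gamma>A : D\<^sup>2\<psi> + \<gamma>b \<cdot> \<nabla>\<psi>) \<ge> (1 - \<kappa>) \<parallel>d\<parallel>\<^sup>2\<close>.

  Everything needed about periodic Sobolev functions comes from one fact: difference quotients converge
  in \<open>L\<^sup>2\<close> to the weak derivative. It replaces mollification.
\<close>

section \<open>Semi-inner product spaces of functions\<close>

text \<open>The threshold for \<delta> is the value at which (1 - \<delta>) (1 + n / pi^2) equals 1,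
  and n / pi^2 is the Poincare constant that the diameter of the cell gives. The sharp constant on
  the torus is 1 / (4 pi^2), so a cruder inequality, obtained from translations, still fits. There
  is no such room in passing from Dv to div v: the pointwise bound loses a factor sqrt n, whereas
  the div-curl identity gives the factor 1 after integration.

  The other constraint is that functions are representatives and \<open>wpd\<close> is a choice.
  Rules for weak derivatives hold only almost everywhere, the inner products are only semidefinite,
  and Riesz representatives are unique only up to norm zero. The Hilbert space part is therefore
  stated for sets of functions with a seminorm, and serves L2, H1, vector fields and the subspace P
  alike. Regularity of the Poisson equation enters through the uniqueness of very weak solutions,
  where a test function with prescribed Laplacian in L2 is required.\<close>

lemma quadratic_nonneg_imp:
  fixes a b c :: real
  assumes "\<And>t. 0 \<le> a + 2 * t * b + t\<^sup>2 * c" "0 \<le> c"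
  shows "b\<^sup>2 \<le> a * c"
proof (cases "c = 0")
  case True
  have "b = 0"
  proof (rule ccontr)
    assume "b \<noteq> 0"
    \<comment> \<open>This t gives the affine function the value -1. The degenerate case does occur:
      c is a squared seminorm and can vanish at a nonzero vector.\<close>
    then show False using assms(1)[of "-(a + 1) / (2 * b)"] True by (simp add: field_simps)
  qed
  then show ?thesis using True by simp
next
  case False
  then have "0 < c" using assms(2) by simp
  with assms(1)[of "- b / c"] have "0 \<le> a - b\<^sup>2 / c"
    by (simp add: field_simps power2_eq_square)
  then show ?thesis using \<open>0 < c\<close> by (simp add: field_simps)
qed

text \<open>The carrier consists of representatives, so the product is only positive semidefinite and
  every conclusion is up to vectors of norm zero.\<close>

locale semi_inner =
  fixes V :: "('x \<Rightarrow> 'b::real_vector) set"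
    and ip :: "('x \<Rightarrow> 'b) \<Rightarrow> ('x \<Rightarrow> 'b) \<Rightarrow> real"
  assumes zero_mem: "(\<lambda>t. 0) \<in> V"
    and add_mem: "x \<in> V \<Longrightarrow> y \<in> V \<Longrightarrow> (\<lambda>t. x t + y t) \<in> V"
    and scale_mem: "x \<in> V \<Longrightarrow> (\<lambda>t. c *\<^sub>R x t) \<in> V"
    and ip_sym: "x \<in> V \<Longrightarrow> y \<in> V \<Longrightarrow> ip x y = ip y x"
    and ip_add: "x \<in> V \<Longrightarrow> y \<in> V \<Longrightarrow> z \<in> V \<Longrightarrow> ip (\<lambda>t. x t + y t) z = ip x z + ip y z"
    and ip_scale: "x \<in> V \<Longrightarrow> z \<in> V \<Longrightarrow> ip (\<lambda>t. c *\<^sub>R x t) z = c * ip x z"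
    and ip_nonneg: "x \<in> V \<Longrightarrow> 0 \<le> ip x x"
begin

definition nrm :: "('x \<Rightarrow> 'b) \<Rightarrow> real" where "nrm x = sqrt (ip x x)"

lemma nrm_nonneg [simp]: "x \<in> V \<Longrightarrow> 0 \<le> nrm x"
  by (simp add: nrm_def ip_nonneg)

lemma nrm_sq: "x \<in> V \<Longrightarrow> (nrm x)\<^sup>2 = ip x x"
  by (simp add: nrm_def ip_nonneg)

lemma diff_mem: assumes "x \<in> V" "y \<in> V" shows "(\<lambda>t. x t - y t) \<in> V"
  using add_mem[OF assms(1) scale_mem[OF assms(2), of "-1"]] by simp

lemma ip_diff:
  assumes "x \<in> V" "y \<in> V" "z \<in> V"
  shows "ip (\<lambda>t. x t - y t) z = ip x z - ip y z"
  using ip_add[OF assms(1) scale_mem[OF assms(2), of "-1"] assms(3)] ip_scale[OF assms(2,3), of "-1"]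
  by simp

lemma ip_add_right:
  assumes "x \<in> V" "y \<in> V" "z \<in> V"
  shows "ip z (\<lambda>t. x t + y t) = ip z x + ip z y"
  using assms by (simp add: ip_sym[of z] add_mem ip_add)

lemma ip_scale_right:
  assumes "x \<in> V" "z \<in> V"
  shows "ip z (\<lambda>t. c *\<^sub>R x t) = c * ip z x"
  using assms by (simp add: ip_sym[of z] scale_mem ip_scale)

lemma ip_diff_right:
  assumes "x \<in> V" "y \<in> V" "z \<in> V"
  shows "ip z (\<lambda>t. x t - y t) = ip z x - ip z y"
  using assms by (simp add: ip_sym[of z] diff_mem ip_diff)

lemma ip_quadratic:
  assumes "x \<in> V" "y \<in> V"
  shows "ip (\<lambda>t. x t + c *\<^sub>R y t) (\<lambda>t. x t + c *\<^sub>R y t) = ip x x + 2 * c * ip x y + c\<^sup>2 * ip y y"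
  using assms
  by (simp add: ip_add ip_add_right ip_scale ip_scale_right scale_mem add_mem ip_sym[of y x] ring_distribs
      power2_eq_square)

lemma cauchy_schwarz:
  assumes "x \<in> V" "y \<in> V" shows "\<bar>ip x y\<bar> \<le> nrm x * nrm y"
proof -
  have "(ip x y)\<^sup>2 \<le> ip x x * ip y y"
  proof (rule quadratic_nonneg_imp)
    show "0 \<le> ip x x + 2 * t * ip x y + t\<^sup>2 * ip y y" for t
      using ip_nonneg[OF add_mem[OF assms(1) scale_mem[OF assms(2)]]]
      by (simp add: ip_quadratic[OF assms])
  qed (rule ip_nonneg[OF assms(2)])
  then have "sqrt ((ip x y)\<^sup>2) \<le> sqrt (ip x x * ip y y)" by (rule real_sqrt_le_mono)
  then show ?thesis by (simp add: nrm_def real_sqrt_mult)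
qed

lemma nrm_triangle:
  assumes "x \<in> V" "y \<in> V" shows "nrm (\<lambda>t. x t + y t) \<le> nrm x + nrm y"
proof (rule power2_le_imp_le)
  have "(nrm (\<lambda>t. x t + y t))\<^sup>2 = ip x x + 2 * ip x y + ip y y"
    using ip_quadratic[OF assms, of 1] by (simp add: nrm_sq add_mem assms)
  also have "\<dots> \<le> (nrm x + nrm y)\<^sup>2"
    using cauchy_schwarz[OF assms] assms by (simp add: power2_sum nrm_sq)
  finally show "(nrm (\<lambda>t. x t + y t))\<^sup>2 \<le> (nrm x + nrm y)\<^sup>2" .
qed (use assms in simp)

lemma nrm_scale: "x \<in> V \<Longrightarrow> nrm (\<lambda>t. c *\<^sub>R x t) = \<bar>c\<bar> * nrm x"
  using real_sqrt_mult[of "c * c" "ip x x"]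
  by (simp add: nrm_def ip_scale ip_scale_right scale_mem mult.assoc)

lemma nrm_zero [simp]: "nrm (\<lambda>t. 0) = 0"
  using nrm_scale[OF zero_mem, of 0] by simp

lemma nrm_minus: "x \<in> V \<Longrightarrow> y \<in> V \<Longrightarrow> nrm (\<lambda>t. x t - y t) = nrm (\<lambda>t. y t - x t)"
  using nrm_scale[OF diff_mem[of y x], of "-1"] by simp

lemma nrm_triangle_diff:
  assumes "x \<in> V" "y \<in> V" shows "nrm (\<lambda>t. x t - y t) \<le> nrm x + nrm y"
  using nrm_triangle[OF assms(1) scale_mem[OF assms(2), of "-1"]] nrm_scale[OF assms(2), of "-1"]
  by simp

lemma nrm_triangle3:
  assumes "x \<in> V" "y \<in> V" "z \<in> V"
  shows "nrm (\<lambda>t. x t - z t) \<le> nrm (\<lambda>t. x t - y t) + nrm (\<lambda>t. y t - z t)"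
  using nrm_triangle[OF diff_mem[of x y] diff_mem[of y z]] assms by simp

lemma tendsto_ip:
  assumes "\<And>k. f k \<in> V" "l \<in> V" "w \<in> V" "(\<lambda>k. nrm (\<lambda>t. f k t - l t)) \<longlonglongrightarrow> 0"
  shows "(\<lambda>k. ip (f k) w) \<longlonglongrightarrow> ip l w"
proof -
  have "(\<lambda>k. ip (f k) w - ip l w) \<longlonglongrightarrow> 0"
  proof (rule Lim_null_comparison)
    show "(\<lambda>k. nrm (\<lambda>t. f k t - l t) * nrm w) \<longlonglongrightarrow> 0"
      using tendsto_mult_right[OF assms(4), of "nrm w"] by simp
    show "\<forall>\<^sub>F k in sequentially. norm (ip (f k) w - ip l w) \<le> nrm (\<lambda>t. f k t - l t) * nrm w"
      using cauchy_schwarz[OF diff_mem[OF assms(1,2)] assms(3)] assms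
      by (simp add: ip_diff)
  qed
  then show ?thesis by (simp add: LIM_zero_iff)
qed

definition nrm_Cauchy :: "(nat \<Rightarrow> 'x \<Rightarrow> 'b) \<Rightarrow> bool" where
  "nrm_Cauchy f \<longleftrightarrow> (\<forall>e>0. \<exists>N. \<forall>m\<ge>N. \<forall>n\<ge>N. nrm (\<lambda>t. f m t - f n t) < e)"

text \<open>Minimising sequences, fixed-point iterates and difference quotients are all controlled
  by a sum of one null sequence taken at both indices.\<close>

lemma nrm_CauchyI:
  assumes "\<And>m n. nrm (\<lambda>t. f m t - f n t) \<le> d m + d n" "d \<longlonglongrightarrow> (0::real)"
  shows "nrm_Cauchy f"
  unfolding nrm_Cauchy_def
proof (intro allI impI)
  fix e :: real assume "0 < e"
  then have "\<forall>\<^sub>F n in sequentially. d n < e / 2"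
    using order_tendstoD(2)[OF assms(2), of "e / 2"] by simp
  then obtain N where "\<And>n. n \<ge> N \<Longrightarrow> d n < e / 2" by (auto simp: eventually_sequentially)
  then have "nrm (\<lambda>t. f m t - f n t) < e" if "m \<ge> N" "n \<ge> N" for m n
    using assms(1)[of m n] that by (smt (verit) field_sum_of_halves)
  then show "\<exists>N. \<forall>m\<ge>N. \<forall>n\<ge>N. nrm (\<lambda>t. f m t - f n t) < e" by blast
qed

end

locale semi_hilbert = semi_inner +
  assumes complete: "(\<And>k. f k \<in> V) \<Longrightarrow> nrm_Cauchy f \<Longrightarrow>
    \<exists>l\<in>V. (\<lambda>k. nrm (\<lambda>t. f k t - l t)) \<longlonglongrightarrow> 0"
begin

text \<open>The energy \<open>ip s s - 2 * L s\<close> is minimised over the subspace \<open>S\<close>, which need not be closed;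
  minimising sequences are Cauchy by the parallelogram law.\<close>

lemma riesz_on_subspace:
  assumes S: "semi_inner S ip" "S \<subseteq> V"
    and Ladd: "\<And>s t. s \<in> S \<Longrightarrow> t \<in> S \<Longrightarrow> L (\<lambda>x. s x + t x) = L s + L t"
    and Lscale: "\<And>s c. s \<in> S \<Longrightarrow> L (\<lambda>x. c *\<^sub>R s x) = c * L s"
    and Lbdd: "\<And>s. s \<in> S \<Longrightarrow> \<bar>L s\<bar> \<le> C * nrm s"
  obtains f p where "\<And>k::nat. f k \<in> S" "p \<in> V" "(\<lambda>k. nrm (\<lambda>t. f k t - p t)) \<longlonglongrightarrow> 0"
    "\<And>s. s \<in> S \<Longrightarrow> ip p s = L s"
proof -
  interpret S: semi_inner S ip by fact
  have SV: "s \<in> V" if "s \<in> S" for s using that S(2) by blast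
  define J where "J s = ip s s - 2 * L s" for s
  have J_add: "J (\<lambda>x. s x + c *\<^sub>R t x) = J s + 2 * c * (ip s t - L t) + c\<^sup>2 * ip t t"
    if "s \<in> S" "t \<in> S" for s t c
    using that by (simp add: J_def S.ip_quadratic Ladd Lscale S.scale_mem algebra_simps)
  have J_lb: "- C\<^sup>2 \<le> J s" if "s \<in> S" for s
  proof -
    have "L s \<le> C * nrm s" using Lbdd[OF that] by simp
    moreover have "0 \<le> (nrm s - C)\<^sup>2" by simp
    ultimately show ?thesis using nrm_sq[OF SV[OF that]]
      by (simp add: J_def power2_diff algebra_simps)
  qed
  define m where "m = (INF s\<in>S. J s)"
  have bdd: "bdd_below (J ` S)" using J_lb by (auto intro!: bdd_belowI)
  have m_le: "m \<le> J s" if "s \<in> S" for s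
    unfolding m_def by (rule cINF_lower[OF bdd that])
  have "\<exists>s\<in>S. J s < m + 1 / real (Suc k)" for k
  proof -
    have "(INF s\<in>S. J s) < m + 1 / real (Suc k)" by (simp add: m_def)
    then show ?thesis using cINF_less_iff[OF _ bdd] S.zero_mem by blast
  qed
  then obtain f where f: "f k \<in> S" and Jf: "J (f k) < m + 1 / real (Suc k)" for k by metis
  \<comment> \<open>The midpoint of \<open>f k\<close> and \<open>f l\<close> lies in
    \<open>S\<close>, so its energy is at least \<open>m\<close>. The energy is quadratic along the
    segment, and its values at the two ends and at the midpoint determine the leading coefficient
    \<open>ip ?d ?d\<close>.\<close>
  have par: "(nrm (\<lambda>x. f k x - f l x))\<^sup>2 \<le> 2 / real (Suc k) + 2 / real (Suc l)" for k l
  proof -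
    let ?d = "\<lambda>x. f k x - f l x"
    have d: "?d \<in> S" by (rule S.diff_mem[OF f f])
    have "J (\<lambda>x. f l x + (1/2) *\<^sub>R ?d x) = J (f l) + (ip (f l) ?d - L ?d) + (1/4) * ip ?d ?d"
      using J_add[OF f d, of l "1/2"] by (simp add: power2_eq_square)
    moreover have "J (f k) = J (f l) + 2 * (ip (f l) ?d - L ?d) + ip ?d ?d"
      using J_add[OF f d, of l 1] by simp
    moreover have "m \<le> J (\<lambda>x. f l x + (1/2) *\<^sub>R ?d x)"
      by (rule m_le[OF S.add_mem[OF f S.scale_mem[OF d]]])
    ultimately have "ip ?d ?d \<le> 2 * (J (f k) - m) + 2 * (J (f l) - m)" by argo
    then show ?thesis using Jf[of k] Jf[of l] nrm_sq[OF SV[OF d]] by simp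
  qed
  define d where "d k = sqrt (2 / real (Suc k))" for k
  have "nrm_Cauchy f"
  proof (rule nrm_CauchyI[where d = d])
    show "nrm (\<lambda>t. f k t - f l t) \<le> d k + d l" for k l
    proof -
      have "nrm (\<lambda>t. f k t - f l t) \<le> sqrt (2 / real (Suc k) + 2 / real (Suc l))"
        by (rule real_le_rsqrt) (rule par)
      also have "\<dots> \<le> d k + d l" unfolding d_def by (rule sqrt_add_le_add_sqrt) auto
      finally show ?thesis .
    qed
    have "(\<lambda>k. sqrt (2 / real (Suc k))) \<longlonglongrightarrow> sqrt 0"
      by (intro tendsto_real_sqrt LIMSEQ_Suc[OF lim_const_over_n])
    then show "d \<longlonglongrightarrow> 0" by (simp add: d_def[abs_def])
  qed
  then obtain p where p: "p \<in> V" and lim: "(\<lambda>k. nrm (\<lambda>t. f k t - p t)) \<longlonglongrightarrow> 0"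
    using complete[of f] f SV by blast
  \<comment> \<open>The limit \<open>p\<close> may lie outside \<open>S\<close>, where nothing is
    known about \<open>L\<close>. The first-order condition is therefore kept as an inequality for
    \<open>f n\<close>, which is minimal up to 1 / (n + 1), and only its coefficients pass to the
    limit. A nonnegative quadratic with constant term 0 has no linear term.\<close>
  have "ip p s = L s" if s: "s \<in> S" for s
  proof -
    have "0 \<le> 0 + 2 * c * (ip p s - L s) + c\<^sup>2 * ip s s" for c
    proof (rule LIMSEQ_le)
      show "(\<lambda>k. - (1 / real (Suc k))) \<longlonglongrightarrow> 0"
        using tendsto_minus[OF LIMSEQ_Suc[OF lim_const_over_n[of 1]]] by simp
      show "(\<lambda>k. 0 + 2 * c * (ip (f k) s - L s) + c\<^sup>2 * ip s s) \<longlonglongrightarrow> 0 + 2 * c * (ip p s - L s) + c\<^sup>2 * ip s s"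
        by (intro tendsto_intros tendsto_ip f SV p s lim)
      show "\<exists>N. \<forall>n\<ge>N. - (1 / real (Suc n)) \<le> 0 + 2 * c * (ip (f n) s - L s) + c\<^sup>2 * ip s s"
      proof (intro exI allI impI)
        fix n
        have "m \<le> J (\<lambda>x. f n x + c *\<^sub>R s x)" by (rule m_le[OF S.add_mem[OF f S.scale_mem[OF s]]])
        then show "- (1 / real (Suc n)) \<le> 0 + 2 * c * (ip (f n) s - L s) + c\<^sup>2 * ip s s"
          using J_add[OF f s, of n c] Jf[of n] by simp
      qed
    qed
    then have "(ip p s - L s)\<^sup>2 \<le> 0 * ip s s"
      by (rule quadratic_nonneg_imp) (rule S.ip_nonneg[OF s])
    then show ?thesis by simp
  qed
  with f p lim that show ?thesis by blast
qed

lemma riesz: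
  assumes "\<And>s t. s \<in> V \<Longrightarrow> t \<in> V \<Longrightarrow> L (\<lambda>x. s x + t x) = L s + L t"
    and "\<And>s c. s \<in> V \<Longrightarrow> L (\<lambda>x. c *\<^sub>R s x) = c * L s"
    and "\<And>s. s \<in> V \<Longrightarrow> \<bar>L s\<bar> \<le> C * nrm s"
  shows "\<exists>p\<in>V. \<forall>s\<in>V. ip p s = L s"
proof (rule riesz_on_subspace[OF semi_inner_axioms order_refl assms])
  fix p assume "p \<in> V" "\<And>s. s \<in> V \<Longrightarrow> ip p s = L s"
  then show ?thesis by blast
qed

text \<open>Picard iteration: \<open>T v\<close> represents the functional \<open>L - q v\<close>,
  and since \<open>ip (T v - T w) s = - q (v - w) s\<close> the map \<open>T\<close> contracts the
  seminorm by \<kappa>. As representatives are not unique, \<open>T\<close> is obtained by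
  choice.\<close>

lemma perturbed_riesz:
  assumes Ladd: "\<And>s t. s \<in> V \<Longrightarrow> t \<in> V \<Longrightarrow> L (\<lambda>x. s x + t x) = L s + L t"
    and Lscale: "\<And>s c. s \<in> V \<Longrightarrow> L (\<lambda>x. c *\<^sub>R s x) = c * L s"
    and Lbdd: "\<And>s. s \<in> V \<Longrightarrow> \<bar>L s\<bar> \<le> C * nrm s"
    and qadd: "\<And>v s t. v \<in> V \<Longrightarrow> s \<in> V \<Longrightarrow> t \<in> V \<Longrightarrow> q v (\<lambda>x. s x + t x) = q v s + q v t"
    and qscale: "\<And>v s c. v \<in> V \<Longrightarrow> s \<in> V \<Longrightarrow> q v (\<lambda>x. c *\<^sub>R s x) = c * q v s"
    and qdiff: "\<And>v w s. v \<in> V \<Longrightarrow> w \<in> V \<Longrightarrow> s \<in> V \<Longrightarrow> q (\<lambda>x. v x - w x) s = q v s - q w s"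
    and qbdd: "\<And>v s. v \<in> V \<Longrightarrow> s \<in> V \<Longrightarrow> \<bar>q v s\<bar> \<le> \<kappa> * nrm v * nrm s"
    and \<kappa>: "0 \<le> \<kappa>" "\<kappa> < 1"
  shows "\<exists>v\<in>V. \<forall>s\<in>V. ip v s + q v s = L s"
proof -
  have "\<exists>u\<in>V. \<forall>s\<in>V. ip u s = L s - q v s" if v: "v \<in> V" for v
  proof (rule riesz)
    fix s assume s: "s \<in> V"
    have "\<bar>L s - q v s\<bar> \<le> C * nrm s + \<kappa> * nrm v * nrm s"
      using Lbdd[OF s] qbdd[OF v s] by linarith
    then show "\<bar>L s - q v s\<bar> \<le> (C + \<kappa> * nrm v) * nrm s" by (simp add: algebra_simps)
  qed (simp_all add: Ladd Lscale qadd qscale v right_diff_distrib)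
  then have "\<forall>v\<in>V. \<exists>u. u \<in> V \<and> (\<forall>s\<in>V. ip u s = L s - q v s)" by blast
  from bchoice[OF this] obtain T
    where "\<forall>v\<in>V. T v \<in> V \<and> (\<forall>s\<in>V. ip (T v) s = L s - q v s)" by blast
  then have TV: "\<And>v. v \<in> V \<Longrightarrow> T v \<in> V"
    and T: "\<And>v s. v \<in> V \<Longrightarrow> s \<in> V \<Longrightarrow> ip (T v) s = L s - q v s" by blast+
  have contr: "nrm (\<lambda>t. T v t - T w t) \<le> \<kappa> * nrm (\<lambda>t. v t - w t)" if "v \<in> V" "w \<in> V" for v w
  proof -
    let ?d = "\<lambda>t. T v t - T w t" let ?e = "\<lambda>t. v t - w t"
    have d: "?d \<in> V" "?e \<in> V" using that TV diff_mem by auto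
    have "(nrm ?d)\<^sup>2 = ip (T v) ?d - ip (T w) ?d" using ip_diff[of "T v" "T w" ?d] d TV that by (simp add: nrm_sq)
    also have "\<dots> = - q ?e ?d" using T that d qdiff[OF that d(1)] by simp
    also have "\<dots> \<le> \<kappa> * nrm ?e * nrm ?d" using qbdd[OF d(2,1)] by linarith
    finally have "nrm ?d * nrm ?d \<le> (\<kappa> * nrm ?e) * nrm ?d" by (simp add: power2_eq_square)
    then show ?thesis
    proof (cases "nrm ?d = 0")
      case False
      then have "0 < nrm ?d" using nrm_nonneg[OF d(1)] by linarith
      then show ?thesis using \<open>nrm ?d * nrm ?d \<le> (\<kappa> * nrm ?e) * nrm ?d\<close> by (simp only: mult_le_cancel_right_pos)
    next
      case True then show ?thesis using \<kappa> d by simp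
    qed
  qed
  define f where "f k = (T ^^ k) (\<lambda>t. 0)" for k
  have f0: "f 0 = (\<lambda>t. 0)" and fS: "f (Suc k) = T (f k)" for k by (simp_all add: f_def)
  have fV: "f k \<in> V" for k by (induction k) (auto simp: f0 fS zero_mem TV)
  define D where "D = nrm (f 1)"
  have D: "0 \<le> D" by (simp add: D_def fV)
  have step: "nrm (\<lambda>t. f (k + j) t - f k t) \<le> \<kappa> ^ k * nrm (f j)" for k j
  proof (induction k)
    case 0 then show ?case by (simp add: f0)
  next
    case (Suc k)
    have "nrm (\<lambda>t. f (Suc k + j) t - f (Suc k) t) \<le> \<kappa> * nrm (\<lambda>t. f (k + j) t - f k t)"
      using contr[OF fV fV, of "k + j" k] by (simp add: fS)
    also have "\<dots> \<le> \<kappa> * (\<kappa> ^ k * nrm (f j))" using Suc \<kappa> by (intro mult_left_mono)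
    finally show ?case by simp
  qed
  \<comment> \<open>The number D / (1 - \<kappa>) is the fixed point of x -> \<kappa> x + D, so the
    bound reproduces itself; it stands for the sum of the geometric series.\<close>
  have bound: "nrm (f j) \<le> D / (1 - \<kappa>)" for j
  proof (induction j)
    case 0 then show ?case using D \<kappa> by (simp add: f0)
  next
    case (Suc j)
    have "nrm (f (Suc j)) \<le> nrm (\<lambda>t. f (Suc j) t - f 1 t) + nrm (f 1)"
      using nrm_triangle[OF diff_mem[OF fV fV] fV, of "Suc j" 1 1] by simp
    also have "\<dots> \<le> \<kappa> * nrm (f j) + D" using step[of 1 j] by (simp add: D_def)
    also have "\<dots> \<le> \<kappa> * (D / (1 - \<kappa>)) + D" using Suc \<kappa> by (intro add_right_mono mult_left_mono)
    also have "\<dots> = D / (1 - \<kappa>)" using \<kappa> by (simp add: field_simps)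
    finally show ?case .
  qed
  have step': "nrm (\<lambda>t. f m t - f n t) \<le> \<kappa> ^ n * (D / (1 - \<kappa>))" if "n \<le> m" for m n
    using order_trans[OF step[of n "m - n"] mult_left_mono[OF bound, of "\<kappa> ^ n"]] that \<kappa> by simp
  have "nrm_Cauchy f"
  proof (rule nrm_CauchyI)
    fix m n
    have pos: "0 \<le> \<kappa> ^ k * (D / (1 - \<kappa>))" for k using \<kappa> D by simp
    show "nrm (\<lambda>t. f m t - f n t) \<le> \<kappa> ^ m * (D / (1 - \<kappa>)) + \<kappa> ^ n * (D / (1 - \<kappa>))"
      using step'[of n m] step'[of m n] nrm_minus[OF fV fV, of m n] pos[of m] pos[of n]
      by (cases "n \<le> m") auto
    show "(\<lambda>k. \<kappa> ^ k * (D / (1 - \<kappa>))) \<longlonglongrightarrow> 0"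
      using tendsto_mult_right[OF LIMSEQ_realpow_zero[OF \<kappa>], of "D / (1 - \<kappa>)"] by simp
  qed
  then obtain v where v: "v \<in> V" and lim: "(\<lambda>k. nrm (\<lambda>t. f k t - v t)) \<longlonglongrightarrow> 0"
    using complete[of f] fV by blast
  \<comment> \<open>The relation that defines \<open>T (f k)\<close> is passed to the limit on both
    sides; it is not claimed that \<open>v\<close> is a fixed point of \<open>T\<close> as a
    function.\<close>
  have "ip v s + q v s = L s" if s: "s \<in> V" for s
  proof -
    have 1: "(\<lambda>k. ip (f (Suc k)) s) \<longlonglongrightarrow> ip v s"
      by (rule LIMSEQ_Suc[OF tendsto_ip[OF fV v s lim]])
    have "(\<lambda>k. q (f k) s - q v s) \<longlonglongrightarrow> 0"
    proof (rule Lim_null_comparison)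
      show "\<forall>\<^sub>F k in sequentially. norm (q (f k) s - q v s) \<le> \<kappa> * nrm (\<lambda>t. f k t - v t) * nrm s"
        using qbdd[OF diff_mem[OF fV v] s] qdiff[OF fV v s] by simp
      show "(\<lambda>k. \<kappa> * nrm (\<lambda>t. f k t - v t) * nrm s) \<longlonglongrightarrow> 0"
        using tendsto_mult_right[OF tendsto_mult_left[OF lim, of \<kappa>], of "nrm s"] by simp
    qed
    then have 2: "(\<lambda>k. L s - q (f k) s) \<longlonglongrightarrow> L s - q v s"
      by (intro tendsto_diff tendsto_const) (simp add: LIM_zero_iff)
    have "ip v s = L s - q v s"
    proof (rule LIMSEQ_unique[OF 1])
      show "(\<lambda>k. ip (f (Suc k)) s) \<longlonglongrightarrow> L s - q v s"
        using 2 by (simp only: fS T[OF fV s])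
    qed
    then show ?thesis by simp
  qed
  then show ?thesis using v by blast
qed

end

section \<open>Square integrable functions\<close>

text \<open>Kept apart from \<open>L2_per\<close> because test functions supported in the cell are
  not periodic, yet have to be paired with periodic functions over the cell.\<close>

definition sqint :: "'a measure \<Rightarrow> ('a \<Rightarrow> real) set" where
  "sqint M = {f. f \<in> borel_measurable M \<and> integrable M (\<lambda>x. (f x)\<^sup>2)}"

lemma sqint_meas [measurable_dest]: "f \<in> sqint M \<Longrightarrow> f \<in> borel_measurable M"
  by (simp add: sqint_def)

lemma sqint_sq: "f \<in> sqint M \<Longrightarrow> integrable M (\<lambda>x. (f x)\<^sup>2)"
  by (simp add: sqint_def)

lemma abs_mult_le_half_squares: "\<bar>a * b\<bar> \<le> (a\<^sup>2 + b\<^sup>2) / 2" for a b :: real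
proof -
  have "0 \<le> (\<bar>a\<bar> - \<bar>b\<bar>)\<^sup>2" by simp
  then show ?thesis by (simp add: power2_diff abs_mult)
qed

lemma sqint_mult:
  assumes "f \<in> sqint M" "g \<in> sqint M" shows "integrable M (\<lambda>x. f x * g x)"
proof (rule Bochner_Integration.integrable_bound)
  show "integrable M (\<lambda>x. ((f x)\<^sup>2 + (g x)\<^sup>2) / 2)"
    using assms by (simp add: sqint_sq)
  show "(\<lambda>x. f x * g x) \<in> borel_measurable M" using assms by measurable
  show "AE x in M. norm (f x * g x) \<le> norm (((f x)\<^sup>2 + (g x)\<^sup>2) / 2)"
    by (rule AE_I2) (smt (verit) abs_mult_le_half_squares abs_of_nonneg real_norm_def)
qed

lemma sqint_add:
  assumes "f \<in> sqint M" "g \<in> sqint M" shows "(\<lambda>x. f x + g x) \<in> sqint M"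
proof -
  have "integrable M (\<lambda>x. (f x)\<^sup>2 + (g x)\<^sup>2 + 2 * (f x * g x))"
    using assms by (intro Bochner_Integration.integrable_add integrable_mult_right sqint_mult sqint_sq)
  then show ?thesis using assms by (auto simp: sqint_def power2_sum mult.assoc intro: borel_measurable_add)
qed

lemma sqint_cmult: "f \<in> sqint M \<Longrightarrow> (\<lambda>x. c * f x) \<in> sqint M"
  by (auto simp: sqint_def power_mult_distrib intro: borel_measurable_times)

lemma sqint_zero [simp]: "(\<lambda>x. 0) \<in> sqint M"
  by (simp add: sqint_def)

lemma semi_inner_sqint: "semi_inner (sqint M) (\<lambda>f g. \<integral>x. f x * g x \<partial>M)"
proof
  fix f g h :: "'a \<Rightarrow> real" and c :: real
  assume f: "f \<in> sqint M"
  show "(\<lambda>t. c *\<^sub>R f t) \<in> sqint M" using f by (simp add: sqint_cmult)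
  show "0 \<le> (\<integral>x. f x * f x \<partial>M)" by simp
  assume g: "g \<in> sqint M"
  show "(\<lambda>t. f t + g t) \<in> sqint M" using f g by (rule sqint_add)
  show "(\<integral>x. f x * g x \<partial>M) = (\<integral>x. g x * f x \<partial>M)" by (simp add: mult.commute)
  show "(\<integral>x. c *\<^sub>R f x * g x \<partial>M) = c * (\<integral>x. f x * g x \<partial>M)" by (simp add: mult.assoc)
  assume h: "h \<in> sqint M"
  show "(\<integral>x. (f x + g x) * h x \<partial>M) = (\<integral>x. f x * h x \<partial>M) + (\<integral>x. g x * h x \<partial>M)"
    using f g h by (simp add: ring_distribs sqint_mult)
qed simp

interpretation L2: semi_inner "sqint M" "\<lambda>f g. \<integral>x. f x * g x \<partial>M" for M
  by (rule semi_inner_sqint)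

abbreviation L2nrm :: "'a measure \<Rightarrow> ('a \<Rightarrow> real) \<Rightarrow> real" where "L2nrm \<equiv> L2.nrm"

lemma L2nrm_eq: "L2nrm M f = sqrt (\<integral>x. (f x)\<^sup>2 \<partial>M)"
  by (simp add: L2.nrm_def power2_eq_square)

lemma L2nrm_cong_AE:
  assumes "f \<in> borel_measurable M" "g \<in> borel_measurable M" "AE x in M. f x = g x"
  shows "L2nrm M f = L2nrm M g"
  using assms unfolding L2nrm_eq by (auto intro!: arg_cong[where f=sqrt] integral_cong_AE)

lemma L2nrm_eq_0_iff: "f \<in> sqint M \<Longrightarrow> L2nrm M f = 0 \<longleftrightarrow> (AE x in M. f x = 0)"
  by (simp add: L2nrm_eq integral_nonneg_eq_0_iff_AE sqint_sq)

lemma sqint_cong_AE: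
  assumes "f \<in> sqint M" "g \<in> borel_measurable M" "AE x in M. f x = g x"
  shows "g \<in> sqint M"
proof -
  have "integrable M (\<lambda>x. (g x)\<^sup>2)"
    by (rule integrable_cong_AE_imp[OF sqint_sq[OF assms(1)]]) (use assms in \<open>auto\<close>)
  then show ?thesis using assms(2) by (simp add: sqint_def)
qed

section \<open>Completeness of L2 over a finite measure\<close>

context finite_measure begin

lemma sqint_const: "(\<lambda>x. c) \<in> sqint M"
  by (simp add: sqint_def)

lemma sqint_integrable: "f \<in> sqint M \<Longrightarrow> integrable M f"
  using sqint_mult[OF _ sqint_const[of 1]] by simp

lemma L1_le_L2nrm:
  assumes "f \<in> sqint M" shows "(\<integral>x. \<bar>f x\<bar> \<partial>M) \<le> sqrt (measure M (space M)) * L2nrm M f"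
proof -
  have "(\<lambda>x. \<bar>f x\<bar>) \<in> sqint M" using assms by (auto simp: sqint_def intro: borel_measurable_abs)
  from L2.cauchy_schwarz[OF sqint_const[of 1] this]
  show ?thesis by (simp add: L2nrm_eq)
qed

text \<open>Riesz-Fischer, with the limit left open: every measurable almost everywhere limit of the
  subsequence is the L2 limit. The caller can thus pick a limit with further properties, such as
  periodicity on the whole space.\<close>

lemma sqint_Cauchy_subseq:
  assumes f: "\<And>k. f k \<in> sqint M" and C: "L2.nrm_Cauchy M f"
  obtains r where "strict_mono r" "AE x in M. convergent (\<lambda>k. f (r k) x)"
    "\<And>l. l \<in> borel_measurable M \<Longrightarrow> (AE x in M. (\<lambda>k. f (r k) x) \<longlonglongrightarrow> l x) \<Longrightarrow>
       l \<in> sqint M \<and> (\<lambda>k. L2nrm M (\<lambda>x. f k x - l x)) \<longlonglongrightarrow> 0"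
proof -
  let ?s = "sqrt (measure M (space M))"
  have d: "(\<lambda>x. f i x - f j x) \<in> sqint M" for i j by (rule L2.diff_mem[OF f f])
  \<comment> \<open>On a finite measure space L2-Cauchy implies L1-Cauchy, for which a subsequence
    converging almost everywhere is available. Dividing by \<open>?s + 1\<close> covers measure
    zero.\<close>
  have "\<exists>N. \<forall>i\<ge>N. \<forall>j\<ge>N. (\<integral>x. norm (f i x - f j x) \<partial>M) < e" if "e > 0" for e
  proof -
    have "0 < e / (?s + 1)" using that by (intro divide_pos_pos add_nonneg_pos) auto
    then obtain N where N: "\<And>i j. i \<ge> N \<Longrightarrow> j \<ge> N \<Longrightarrow> L2nrm M (\<lambda>x. f i x - f j x) < e / (?s + 1)"
      using C unfolding L2.nrm_Cauchy_def by meson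
    have "(\<integral>x. norm (f i x - f j x) \<partial>M) < e" if "i \<ge> N" "j \<ge> N" for i j
    proof -
      have "(\<integral>x. norm (f i x - f j x) \<partial>M) \<le> ?s * L2nrm M (\<lambda>x. f i x - f j x)"
        using L1_le_L2nrm[OF d] by simp
      also have "\<dots> \<le> ?s * (e / (?s + 1))" using N[OF that] by (intro mult_left_mono) auto
      also have "\<dots> < e"
      proof -
        have "?s * e < e * (?s + 1)" using \<open>0 < e\<close> by (simp add: algebra_simps)
        moreover have "0 < ?s + 1" by (intro add_nonneg_pos) auto
        ultimately show ?thesis by (simp add: pos_divide_less_eq)
      qed
      finally show ?thesis .
    qed
    then show ?thesis by blast
  qed
  from cauchy_L1_AE_cauchy_subseq[OF sqint_integrable[OF f] this]
  obtain r where r: "strict_mono r" and AEr: "AE x in M. Cauchy (\<lambda>i. f (r i) x)" by blast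
  have "l \<in> sqint M \<and> (\<lambda>k. L2nrm M (\<lambda>x. f k x - l x)) \<longlonglongrightarrow> 0"
    if l: "l \<in> borel_measurable M" and lim: "AE x in M. (\<lambda>k. f (r k) x) \<longlonglongrightarrow> l x" for l
  proof -
    have meas: "f k \<in> borel_measurable M" for k using f by (rule sqint_meas)
    note [measurable] = l meas
    \<comment> \<open>Fatou's lemma along the subsequence, using \<open>r i \<ge> i\<close> to stay
      beyond \<open>N\<close>. It gives membership of the difference in L2 and its bound at
      once.\<close>
    have key: "(\<lambda>x. f k x - l x) \<in> sqint M \<and> L2nrm M (\<lambda>x. f k x - l x) \<le> e"
      if e: "e > 0" and N: "\<And>i. i \<ge> N \<Longrightarrow> L2nrm M (\<lambda>x. f k x - f i x) < e" for k e N
    proof -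
      have "(\<integral>\<^sup>+x. ennreal ((f k x - l x)\<^sup>2) \<partial>M)
          = (\<integral>\<^sup>+x. liminf (\<lambda>i. ennreal ((f k x - f (r i) x)\<^sup>2)) \<partial>M)"
      proof (rule nn_integral_cong_AE, use lim in eventually_elim)
        fix x assume "(\<lambda>k. f (r k) x) \<longlonglongrightarrow> l x"
        then have "(\<lambda>i. ennreal ((f k x - f (r i) x)\<^sup>2)) \<longlonglongrightarrow> ennreal ((f k x - l x)\<^sup>2)"
          by (intro tendsto_intros)
        then show "ennreal ((f k x - l x)\<^sup>2) = liminf (\<lambda>i. ennreal ((f k x - f (r i) x)\<^sup>2))"
          by (intro lim_imp_Liminf[symmetric]) auto
      qed
      also have "\<dots> \<le> liminf (\<lambda>i. \<integral>\<^sup>+x. ennreal ((f k x - f (r i) x)\<^sup>2) \<partial>M)"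
        by (rule nn_integral_liminf) measurable
      also have "\<dots> \<le> liminf (\<lambda>i. ennreal (e\<^sup>2))"
      proof (rule Liminf_mono)
        show "\<forall>\<^sub>F i in sequentially. (\<integral>\<^sup>+x. ennreal ((f k x - f (r i) x)\<^sup>2) \<partial>M) \<le> ennreal (e\<^sup>2)"
          unfolding eventually_sequentially
        proof (intro exI allI impI)
          fix i assume "N \<le> i"
          then have "N \<le> r i" using seq_suble[OF r, of i] by linarith
          then have "(L2nrm M (\<lambda>x. f k x - f (r i) x))\<^sup>2 \<le> e\<^sup>2"
            using N[of "r i"] L2.nrm_nonneg[OF d] by (intro power_mono) auto
          then have "(\<integral>x. (f k x - f (r i) x)\<^sup>2 \<partial>M) \<le> e\<^sup>2" by (simp add: L2nrm_eq)
          then show "(\<integral>\<^sup>+x. ennreal ((f k x - f (r i) x)\<^sup>2) \<partial>M) \<le> ennreal (e\<^sup>2)"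
            by (subst nn_integral_eq_integral[OF sqint_sq[OF d]]) (auto intro: ennreal_leI)
        qed
      qed
      also have "\<dots> = ennreal (e\<^sup>2)" by (simp add: Liminf_const)
      finally have le: "(\<integral>\<^sup>+x. ennreal ((f k x - l x)\<^sup>2) \<partial>M) \<le> ennreal (e\<^sup>2)" .
      have int: "integrable M (\<lambda>x. (f k x - l x)\<^sup>2)"
        by (rule integrableI_bounded) (use le in \<open>auto simp: le_less_trans\<close>)
      then have mem: "(\<lambda>x. f k x - l x) \<in> sqint M" by (simp add: sqint_def)
      have "(\<integral>x. (f k x - l x)\<^sup>2 \<partial>M) \<le> e\<^sup>2"
        using le by (subst (asm) nn_integral_eq_integral[OF int]) auto
      then have "L2nrm M (\<lambda>x. f k x - l x) \<le> e"
        using e by (simp add: L2nrm_eq real_le_lsqrt)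
      with mem show ?thesis by simp
    qed
    have ev: "\<exists>N. \<forall>k\<ge>N. (\<lambda>x. f k x - l x) \<in> sqint M \<and> L2nrm M (\<lambda>x. f k x - l x) \<le> e" if e: "e > 0" for e
      using C e key unfolding L2.nrm_Cauchy_def by meson
    have "l \<in> sqint M"
    proof -
      obtain k where "(\<lambda>x. f k x - l x) \<in> sqint M" using ev[of 1] by auto
      from L2.diff_mem[OF f[of k] this] show ?thesis by simp
    qed
    moreover have "(\<lambda>k. L2nrm M (\<lambda>x. f k x - l x)) \<longlonglongrightarrow> 0"
    proof (rule LIMSEQ_I)
      fix e :: real assume "0 < e"
      then obtain N where N: "\<And>k. k \<ge> N \<Longrightarrow> L2nrm M (\<lambda>x. f k x - l x) \<le> e / 2"
        using ev[of "e / 2"] by auto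
      have "norm (L2nrm M (\<lambda>x. f k x - l x) - 0) < e" if "k \<ge> N" for k
        using N[OF that] L2.nrm_nonneg[OF L2.diff_mem[OF f[of k] \<open>l \<in> sqint M\<close>]] \<open>0 < e\<close> by simp
      then show "\<exists>no. \<forall>k\<ge>no. norm (L2nrm M (\<lambda>x. f k x - l x) - 0) < e" by blast
    qed
    ultimately show ?thesis ..
  qed
  then show ?thesis
  proof (rule that[OF r, rotated])
    show "AE x in M. convergent (\<lambda>k. f (r k) x)"
      using AEr by eventually_elim (rule Cauchy_convergent)
  qed
qed

lemma semi_hilbert_sqint: "semi_hilbert (sqint M) (\<lambda>f g. \<integral>x. f x * g x \<partial>M)"
proof
  fix f assume f: "\<And>k. f k \<in> sqint M" and C: "L2.nrm_Cauchy M f"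
  show "\<exists>l\<in>sqint M. (\<lambda>k. L2nrm M (\<lambda>t. f k t - l t)) \<longlonglongrightarrow> 0"
  proof (rule sqint_Cauchy_subseq[OF f C])
    fix r :: "nat \<Rightarrow> nat"
    assume AEr: "AE x in M. convergent (\<lambda>k. f (r k) x)"
      and lim: "\<And>l. l \<in> borel_measurable M \<Longrightarrow> (AE x in M. (\<lambda>k. f (r k) x) \<longlonglongrightarrow> l x) \<Longrightarrow>
         l \<in> sqint M \<and> (\<lambda>k. L2nrm M (\<lambda>x. f k x - l x)) \<longlonglongrightarrow> 0"
    have [measurable]: "\<And>k. f k \<in> borel_measurable M" using f by (rule sqint_meas)
    have "(\<lambda>x. lim (\<lambda>k. f (r k) x)) \<in> borel_measurable M" by measurable
    moreover have "AE x in M. (\<lambda>k. f (r k) x) \<longlonglongrightarrow> lim (\<lambda>k. f (r k) x)"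
      using AEr by eventually_elim (simp add: convergent_LIMSEQ_iff)
    ultimately show ?thesis using lim[of "\<lambda>x. Topological_Spaces.lim (\<lambda>k. f (r k) x)"] by (intro bexI) auto
  qed
qed

end

section \<open>Periodic functions\<close>

abbreviation cell :: "(real ^ 'n) measure" where "cell \<equiv> lebesgue_on Ycell"

lemma Ycell_sets [measurable, simp]: "Ycell \<in> sets lebesgue"
  by (simp add: Ycell_def)

lemma Ycell_iff: "x \<in> Ycell \<longleftrightarrow> (\<forall>i. 0 < x $ i \<and> x $ i < 1)"
  by (simp add: Ycell_def mem_box_cart)

lemma emeasure_Ycell: "emeasure lebesgue (Ycell :: (real ^ 'n) set) = 1"
proof -
  have "emeasure lborel (box 0 (\<chi> i. 1) :: (real ^ 'n) set) = (\<Prod>b\<in>Basis. ((\<chi> i. 1) - 0) \<bullet> (b :: real ^ 'n))"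
    by (rule emeasure_lborel_box) (auto simp: Basis_vec_def inner_axis)
  also have "\<dots> = 1"
    by (simp, intro prod.neutral) (auto simp: Basis_vec_def inner_axis)
  finally show ?thesis by (simp add: Ycell_def)
qed

lemma space_cell: "space cell = Ycell"
  by (simp add: space_restrict_space)

lemma measure_cell [simp]: "measure (cell :: (real ^ 'n) measure) Ycell = 1"
  by (simp add: measure_def emeasure_restrict_space emeasure_Ycell)

interpretation cell: finite_measure cell
  by standard (simp add: space_cell emeasure_restrict_space emeasure_Ycell)

lemma set_integral_cell:
  fixes f :: "real ^ 'n \<Rightarrow> real"
  shows "(LINT x:Ycell|lebesgue. f x) = integral\<^sup>L cell f"
  by (subst integral_restrict_space) (simp_all add: set_lebesgue_integral_def)

lemma cell_measurable: "f \<in> borel_measurable lebesgue \<Longrightarrow> f \<in> borel_measurable cell"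
  by (rule measurable_restrict_space1)

lemma AE_cell: "(AE x in cell. P x) \<longleftrightarrow> (AE x in lebesgue. x \<in> Ycell \<longrightarrow> P x)"
  by (simp add: AE_restrict_space_iff)

lemma AE_cellI: "(AE x in lebesgue. P x) \<Longrightarrow> (AE x in cell. P x)"
  unfolding AE_cell by (auto elim: eventually_mono)

lemma L2norm_eq:
  fixes f :: "real ^ 'n \<Rightarrow> real" shows "L2norm f = L2nrm cell f"
  by (simp add: L2norm_def L2nrm_eq set_integral_cell)


subsection \<open>Translations\<close>

lemma
  fixes a :: "'a::euclidean_space"
  shows distr_lebesgue_plus: "distr lebesgue lebesgue (\<lambda>x. x + a) = lebesgue"
    and measurable_lebesgue_plus [measurable]: "(\<lambda>x. x + a) \<in> lebesgue \<rightarrow>\<^sub>M lebesgue"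
proof -
  have eq: "(\<lambda>x. a + (\<Sum>j\<in>Basis. (1 * (x \<bullet> j)) *\<^sub>R j)) = (\<lambda>x. x + a)"
    by (simp add: euclidean_representation add.commute)
  show "(\<lambda>x. x + a) \<in> lebesgue \<rightarrow>\<^sub>M lebesgue"
    using lebesgue_affine_measurable[of "\<lambda>_. 1" a] unfolding eq by simp
  show "distr lebesgue lebesgue (\<lambda>x. x + a) = lebesgue"
    using lebesgue_affine_euclidean[of "\<lambda>_. 1" a] unfolding eq by (simp add: density_1)
qed

lemma meas_plus: "f \<in> borel_measurable lebesgue \<Longrightarrow> (\<lambda>x. f (x + a)) \<in> borel_measurable lebesgue"
  for a :: "'a::euclidean_space"
  by (rule measurable_compose[OF measurable_lebesgue_plus])

lemma nn_integral_plus: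
  fixes a :: "'a::euclidean_space"
  assumes "g \<in> borel_measurable lebesgue"
  shows "(\<integral>\<^sup>+x. g (x + a) \<partial>lebesgue) = (\<integral>\<^sup>+x. g x \<partial>lebesgue)"
  using nn_integral_distr[OF measurable_lebesgue_plus[of a] , of g] assms by (simp add: distr_lebesgue_plus)

lemma integral_lebesgue_plus:
  fixes a :: "'a::euclidean_space" and f :: "'a \<Rightarrow> real"
  assumes "f \<in> borel_measurable lebesgue"
  shows "(\<integral>x. f (x + a) \<partial>lebesgue) = (\<integral>x. f x \<partial>lebesgue)"
  using integral_distr[OF measurable_lebesgue_plus[of a] , of f] assms by (simp add: distr_lebesgue_plus)

lemma integrable_lebesgue_plus:
  fixes a :: "'a::euclidean_space" and f :: "'a \<Rightarrow> real"
  assumes "integrable lebesgue f"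
  shows "integrable lebesgue (\<lambda>x. f (x + a))"
  by (rule integrable_distr[OF measurable_lebesgue_plus]) (simp add: distr_lebesgue_plus assms)

lemma AE_plus:
  fixes a :: "'a::euclidean_space"
  assumes "AE x in lebesgue. P x" shows "AE x in lebesgue. P (x + a)"
  using AE_distrD[OF measurable_lebesgue_plus[of a], of P] assms unfolding distr_lebesgue_plus by blast

lemma Y_periodic_plus: "Y_periodic f \<Longrightarrow> Y_periodic (\<lambda>x. f (x + a))"
  unfolding Y_periodic_def
proof
  fix i assume "\<forall>i. AE x in lebesgue. f (x + axis i 1) = f x"
  then have "AE x in lebesgue. f (x + axis i 1) = f x" ..
  from AE_plus[OF this, of a] have "AE x in lebesgue. f (x + a + axis i 1) = f (x + a)" .
  then show "AE x in lebesgue. f (x + axis i 1 + a) = f (x + a)"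
    by (simp add: add.assoc add.commute[of a])
qed

lemma Y_periodic_comp2:
  "Y_periodic f \<Longrightarrow> Y_periodic g \<Longrightarrow> Y_periodic (\<lambda>x. h (f x) (g x))"
  unfolding Y_periodic_def
proof
  fix i assume "\<forall>i. AE x in lebesgue. f (x + axis i 1) = f x"
    "\<forall>i. AE x in lebesgue. g (x + axis i 1) = g x"
  then have "AE x in lebesgue. f (x + axis i 1) = f x" "AE x in lebesgue. g (x + axis i 1) = g x"
    by auto
  then show "AE x in lebesgue. h (f (x + axis i 1)) (g (x + axis i 1)) = h (f x) (g x)"
    by eventually_elim simp
qed

lemma Y_periodic_comp: "Y_periodic f \<Longrightarrow> Y_periodic (\<lambda>x. h (f x))"
  using Y_periodic_comp2[of f f "\<lambda>a _. h a"] by simp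

lemma Y_periodic_const [simp]: "Y_periodic (\<lambda>x. c)"
  by (simp add: Y_periodic_def)

section \<open>Integer translations, tilings of cubes and integrals over shifted cells\<close>

lemma axis_add: "axis i (a + b) = axis i a + (axis i b :: real ^ 'n)"
  by (simp add: vec_eq_iff axis_def)

lemma sum_axis: "(\<Sum>i\<in>UNIV. axis i (a $ i)) = (a :: real ^ 'n)"
  by (simp add: vec_eq_iff axis_def if_distrib[of "\<lambda>f. f _"] cong: if_cong)

lemma Y_periodic_nat:
  assumes "Y_periodic f" shows "AE x in lebesgue. f (x + axis i (real k)) = f x"
proof (induction k)
  case 0 then show ?case by (simp add: axis_def zero_vec_def[symmetric])
next
  case (Suc k)
  have "AE x in lebesgue. f (x + axis i 1 + axis i (real k)) = f (x + axis i 1)"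
    by (rule AE_plus[OF Suc])
  moreover have "AE x in lebesgue. f (x + axis i 1) = f x"
    using assms by (simp add: Y_periodic_def)
  ultimately show ?case
    by eventually_elim (simp add: axis_add algebra_simps)
qed

lemma Y_periodic_int:
  fixes f :: "real ^ 'n \<Rightarrow> 'b"
  assumes "Y_periodic f" shows "AE x in lebesgue. f (x + axis i (of_int k)) = f x"
proof (cases "0 \<le> k")
  case True
  then show ?thesis using Y_periodic_nat[OF assms, of i "nat k"] by simp
next
  case False
  have "AE x in lebesgue. f (x + axis i (of_int k) + axis i (real (nat (- k)))) = f (x + axis i (of_int k))"
    by (rule AE_plus[OF Y_periodic_nat[OF assms]])
  then show ?thesis
  proof eventually_elim
    case (elim x)
    have "axis i (of_int k) + axis i (real (nat (- k))) = (0 :: real ^ 'n)"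
      using False by (simp add: axis_add[symmetric])
    then show ?case using elim by (simp add: add.assoc)
  qed
qed

text \<open>A half-open box with sides [-N, N) in the directions of \<open>J\<close> and [0, 1) in
  the others. It interpolates between the unit cell (\<open>J\<close> empty) and a large cube
  (\<open>J = UNIV\<close>), so that the cube can be unfolded one direction at a time.\<close>

definition pbox :: "nat \<Rightarrow> 'n set \<Rightarrow> (real ^ 'n) set" where
  "pbox N J = {x. \<forall>i. (if i \<in> J then - real N \<le> x $ i \<and> x $ i < real N else 0 \<le> x $ i \<and> x $ i < 1)}"

lemma pbox_borel [measurable]: "pbox N J \<in> sets borel"
  unfolding pbox_def by measurable

lemma pbox_sets [measurable]: "pbox N J \<in> sets lebesgue"
  using pbox_borel by (simp add: sets_completionI_sets)

text \<open>Half-open sides make the slabs a partition: the only k whose slab contains x is the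
  floor of \<open>x $ i\<close>.\<close>

lemma indicator_pbox_insert:
  assumes "i \<notin> J"
  shows "(indicator (pbox N (insert i J)) x :: ennreal) =
    (\<Sum>k\<in>{- int N..<int N}. indicator (pbox N J) (x + axis i (of_int (- k))))"
proof -
  have iff: "x + axis i (of_int (- k)) \<in> pbox N J \<longleftrightarrow>
      (\<forall>j\<in>-{i}. if j \<in> J then - real N \<le> x $ j \<and> x $ j < real N else 0 \<le> x $ j \<and> x $ j < 1)
      \<and> k = \<lfloor>x $ i\<rfloor>" for k
  proof -
    have "k = \<lfloor>x $ i\<rfloor> \<longleftrightarrow> 0 \<le> x $ i - real_of_int k \<and> x $ i - real_of_int k < 1"
      by (auto simp: floor_eq_iff eq_commute[of k])
    then show ?thesis using assms unfolding pbox_def by (auto simp: axis_def)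
  qed
  show ?thesis
  proof (cases "x \<in> pbox N (insert i J)")
    case True
    then have 1: "\<forall>j\<in>-{i}. if j \<in> J then - real N \<le> x $ j \<and> x $ j < real N else 0 \<le> x $ j \<and> x $ j < 1"
      and 2: "- real N \<le> x $ i" "x $ i < real N" by (auto simp: pbox_def split: if_splits)
    from 2 have mem: "\<lfloor>x $ i\<rfloor> \<in> {- int N..<int N}" by (simp add: le_floor_iff floor_less_iff)
    have "(\<Sum>k\<in>{- int N..<int N}. indicator (pbox N J) (x + axis i (of_int (- k)))) =
      (\<Sum>k\<in>{- int N..<int N}. if k = \<lfloor>x $ i\<rfloor> then 1 else (0::ennreal))"
      by (intro sum.cong refl) (use 1 iff in \<open>auto simp: indicator_def\<close>)
    then show ?thesis using True mem by simp
  next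
    case False
    have "x + axis i (of_int (- k)) \<notin> pbox N J" if "k \<in> {- int N..<int N}" for k
    proof
      assume "x + axis i (of_int (- k)) \<in> pbox N J"
      then have 1: "\<forall>j\<in>-{i}. if j \<in> J then - real N \<le> x $ j \<and> x $ j < real N else 0 \<le> x $ j \<and> x $ j < 1"
        and 2: "k = \<lfloor>x $ i\<rfloor>" using iff by auto
      have "- int N \<le> \<lfloor>x $ i\<rfloor>" "\<lfloor>x $ i\<rfloor> < int N" using that 2 by auto
      then have "- real N \<le> x $ i" "x $ i < real N" by linarith+
      then have "x \<in> pbox N (insert i J)"
        using 1 unfolding pbox_def
        by (intro CollectI allI) (rename_tac j, case_tac "j = i", auto)
      with False show False ..
    qed
    then show ?thesis using False by (simp add: indicator_def)
  qed
qed

text \<open>Each new direction cuts the box into 2 N unit slabs, and by periodicity and translation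
  invariance all of them carry the same integral.\<close>

lemma nn_integral_pbox:
  fixes g :: "real ^ 'n \<Rightarrow> ennreal"
  assumes g: "g \<in> borel_measurable lebesgue" "Y_periodic g"
  shows "(\<integral>\<^sup>+x. g x * indicator (pbox N J) x \<partial>lebesgue) =
    ennreal (real (2 * N) ^ card J) * (\<integral>\<^sup>+x. g x * indicator (pbox N {}) x \<partial>lebesgue)"
proof (induction J rule: finite_induct[OF finite])
  case 1 then show ?case by simp
next
  case (2 i J)
  note [measurable] = g(1)
  let ?I = "\<integral>\<^sup>+x. g x * indicator (pbox N J) x \<partial>lebesgue"
  have shift: "(\<integral>\<^sup>+x. g x * indicator (pbox N J) (x + axis i (of_int (- k))) \<partial>lebesgue) = ?I" for k
  proof -
    have "(\<integral>\<^sup>+x. g x * indicator (pbox N J) (x + axis i (of_int (- k))) \<partial>lebesgue)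
      = (\<integral>\<^sup>+x. g (x + axis i (of_int (- k))) * indicator (pbox N J) (x + axis i (of_int (- k))) \<partial>lebesgue)"
      by (rule nn_integral_cong_AE, use Y_periodic_int[OF g(2), of i "- k"] in eventually_elim) simp
    also have "\<dots> = ?I"
      by (rule nn_integral_plus[where g = "\<lambda>x. g x * indicator (pbox N J) x"]) measurable
    finally show ?thesis .
  qed
  have ind: "(\<lambda>x. indicator (pbox N J) (x + a) :: ennreal) \<in> borel_measurable lebesgue" for a
    by (rule meas_plus) measurable
  have "(\<integral>\<^sup>+x. g x * indicator (pbox N (insert i J)) x \<partial>lebesgue)
    = (\<integral>\<^sup>+x. (\<Sum>k\<in>{- int N..<int N}. g x * indicator (pbox N J) (x + axis i (of_int (- k)))) \<partial>lebesgue)"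
    by (simp only: indicator_pbox_insert[OF 2(2)] sum_distrib_left)
  also have "\<dots> = (\<Sum>k\<in>{- int N..<int N}. \<integral>\<^sup>+x. g x * indicator (pbox N J) (x + axis i (of_int (- k))) \<partial>lebesgue)"
    by (rule nn_integral_sum) (intro borel_measurable_times_ennreal g(1) ind)
  also have "\<dots> = of_nat (2 * N) * ?I"
    unfolding shift by (simp add: nat_mult_distrib)
  also have "\<dots> = ennreal (real (2 * N) ^ card (insert i J)) * (\<integral>\<^sup>+x. g x * indicator (pbox N {}) x \<partial>lebesgue)"
    unfolding 2(3) using 2(1,2)
    by (simp add: ennreal_mult ennreal_of_nat_eq_real_of_nat mult.assoc)
  finally show ?case .
qed

lemma AE_pbox_cell: "AE x in lebesgue. x \<in> pbox N {} \<longleftrightarrow> x \<in> (Ycell :: (real ^ 'n) set)"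
proof -
  have "negligible (cbox 0 (\<chi> i. 1) - box 0 (\<chi> i. 1) :: (real ^ 'n) set)"
    by (rule negligible_frontier_interval)
  then have "AE x in lebesgue. x \<notin> (cbox 0 (\<chi> i. 1) - box 0 (\<chi> i. 1) :: (real ^ 'n) set)"
    unfolding negligible_iff_null_sets by (rule AE_not_in)
  then show ?thesis
  proof eventually_elim
    case (elim x)
    have "x \<in> pbox N {} \<Longrightarrow> x \<in> cbox 0 (\<chi> i. 1)" by (auto simp: pbox_def mem_box_cart less_imp_le)
    moreover have "x \<in> Ycell \<Longrightarrow> x \<in> pbox N {}" by (auto simp: pbox_def Ycell_iff less_imp_le)
    ultimately show ?case using elim by (auto simp: Ycell_def)
  qed
qed

lemma nn_integral_cell:
  assumes [measurable]: "g \<in> borel_measurable lebesgue"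
  shows "(\<integral>\<^sup>+x. g x * indicator (pbox N {}) x \<partial>lebesgue) = integral\<^sup>N cell g"
proof -
  have "(\<integral>\<^sup>+x. g x * indicator (pbox N {}) x \<partial>lebesgue) = (\<integral>\<^sup>+x. g x * indicator Ycell x \<partial>lebesgue)"
    by (rule nn_integral_cong_AE, use AE_pbox_cell in eventually_elim) (auto simp: indicator_def)
  then show ?thesis by (simp add: nn_integral_restrict_space)
qed

text \<open>The integer part of t is absorbed by periodicity. For the fractional part s, the layer
  \<open>U\<close> of points with \<open>x $ i < s\<close> leaves the cell on one side and re-enters
  on the other, shifted by a full period.\<close>

lemma nn_integral_cell_axis:
  fixes g :: "real ^ 'n \<Rightarrow> ennreal"
  assumes g: "g \<in> borel_measurable lebesgue" "Y_periodic g"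
  shows "(\<integral>\<^sup>+x. g (x + axis i t) \<partial>cell) = integral\<^sup>N cell g"
proof -
  note [measurable] = g(1)
  have "AE x in lebesgue. g (x + axis i (frac t) + axis i (of_int \<lfloor>t\<rfloor>)) = g (x + axis i (frac t))"
    by (rule AE_plus[OF Y_periodic_int[OF g(2)]])
  then have "(\<integral>\<^sup>+x. g (x + axis i t) \<partial>cell) = (\<integral>\<^sup>+x. g (x + axis i (frac t)) \<partial>cell)"
    by (intro nn_integral_cong_AE AE_cellI, eventually_elim)
       (simp add: add.assoc axis_add[symmetric] frac_def)
  also have "\<dots> = integral\<^sup>N cell g"
  proof -
    define s where "s = frac t"
    have s: "0 \<le> s" "s < 1" by (auto simp: s_def frac_lt_1)
    let ?Q = "pbox 0 {} :: (real ^ 'n) set"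
    define U where "U = {x. x $ i < s} \<inter> ?Q"
    have [measurable]: "U \<in> sets borel" "?Q - U \<in> sets borel" unfolding U_def by measurable
    have [measurable]: "U \<in> sets lebesgue" "?Q - U \<in> sets lebesgue"
      by (auto intro: sets_completionI_sets)
    have ind: "(\<lambda>x. indicator U (x + a) :: ennreal) \<in> borel_measurable lebesgue" for a
      by (rule meas_plus) measurable
    have split: "indicator ?Q (x + axis i (- s)) = (indicator (?Q - U) x + indicator U (x + axis i (- 1)) :: ennreal)" for x
    proof -
      have a: "x + axis i (- s) \<in> ?Q \<longleftrightarrow> (\<forall>j\<in>-{i}. 0 \<le> x $ j \<and> x $ j < 1) \<and> s \<le> x $ i \<and> x $ i < 1 + s"
        unfolding pbox_def by (auto simp: axis_def)
      have b: "x \<in> ?Q - U \<longleftrightarrow> (\<forall>j\<in>-{i}. 0 \<le> x $ j \<and> x $ j < 1) \<and> s \<le> x $ i \<and> x $ i < 1"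
        using s unfolding pbox_def U_def by (auto; smt (verit))
      have c: "x + axis i (- 1) \<in> U \<longleftrightarrow> (\<forall>j\<in>-{i}. 0 \<le> x $ j \<and> x $ j < 1) \<and> 1 \<le> x $ i \<and> x $ i < 1 + s"
        using s unfolding pbox_def U_def by (auto simp: axis_def)
      show ?thesis using a b c s unfolding indicator_def by auto
    qed
    have "(\<integral>\<^sup>+x. g (x + axis i s) \<partial>cell) = (\<integral>\<^sup>+x. g (x + axis i s) * indicator ?Q x \<partial>lebesgue)"
      by (simp add: nn_integral_cell meas_plus)
    also have "\<dots> = (\<integral>\<^sup>+x. g (x + axis i s) * indicator ?Q (x + axis i s + axis i (- s)) \<partial>lebesgue)"
      by (simp add: add.assoc axis_add[symmetric]) (simp add: axis_def zero_vec_def[symmetric])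
    also have "\<dots> = (\<integral>\<^sup>+x. g x * indicator ?Q (x + axis i (- s)) \<partial>lebesgue)"
      by (rule nn_integral_plus[where g = "\<lambda>x. g x * indicator ?Q (x + axis i (- s))"])
         (intro borel_measurable_times_ennreal g(1) meas_plus, measurable)
    also have "\<dots> = (\<integral>\<^sup>+x. g x * indicator (?Q - U) x + g x * indicator U (x + axis i (- 1)) \<partial>lebesgue)"
      by (simp add: split distrib_left)
    also have "\<dots> = (\<integral>\<^sup>+x. g x * indicator (?Q - U) x \<partial>lebesgue) + (\<integral>\<^sup>+x. g x * indicator U (x + axis i (- 1)) \<partial>lebesgue)"
      by (rule nn_integral_add) (auto intro!: borel_measurable_times_ennreal ind)
    also have "(\<integral>\<^sup>+x. g x * indicator U (x + axis i (- 1)) \<partial>lebesgue)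
        = (\<integral>\<^sup>+x. g (x + axis i (- 1)) * indicator U (x + axis i (- 1)) \<partial>lebesgue)"
      by (rule nn_integral_cong_AE, use Y_periodic_int[OF g(2), of i "- 1"] in eventually_elim) simp
    also have "\<dots> = (\<integral>\<^sup>+x. g x * indicator U x \<partial>lebesgue)"
      by (rule nn_integral_plus[where g = "\<lambda>x. g x * indicator U x"]) measurable
    also have "(\<integral>\<^sup>+x. g x * indicator (?Q - U) x \<partial>lebesgue) + \<dots>
       = (\<integral>\<^sup>+x. g x * indicator (?Q - U) x + g x * indicator U x \<partial>lebesgue)"
      by (rule nn_integral_add[symmetric]) measurable
    also have "\<dots> = (\<integral>\<^sup>+x. g x * indicator ?Q x \<partial>lebesgue)"
      by (rule nn_integral_cong) (auto simp: indicator_def U_def)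
    finally show ?thesis by (simp add: nn_integral_cell s_def)
  qed
  finally show ?thesis .
qed

lemma nn_integral_cell_plus:
  fixes g :: "real ^ 'n \<Rightarrow> ennreal"
  assumes g: "g \<in> borel_measurable lebesgue" "Y_periodic g"
  shows "(\<integral>\<^sup>+x. g (x + a) \<partial>cell) = integral\<^sup>N cell g"
proof -
  have "(\<integral>\<^sup>+x. g (x + (\<Sum>i\<in>J. axis i (a $ i))) \<partial>cell) = integral\<^sup>N cell g" for J
    using finite[of J]
  proof (induction J rule: finite_induct)
    case (insert i J)
    let ?b = "\<Sum>i\<in>J. axis i (a $ i)"
    have "(\<integral>\<^sup>+x. g (x + axis i (a $ i) + ?b) \<partial>cell) = (\<integral>\<^sup>+x. g (x + ?b) \<partial>cell)"
      by (rule nn_integral_cell_axis[where g = "\<lambda>x. g (x + ?b)"]) (intro meas_plus Y_periodic_plus g)+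
    then show ?case using insert by (simp add: add.assoc)
  qed simp
  from this[of UNIV] show ?thesis by (simp add: sum_axis)
qed


lemma
  fixes f :: "real ^ 'n \<Rightarrow> real"
  assumes f: "f \<in> borel_measurable lebesgue" "Y_periodic f"
  shows integrable_cell_plus: "integrable cell f \<Longrightarrow> integrable cell (\<lambda>x. f (x + a))"
    and integral_cell_plus: "integrable cell f \<Longrightarrow> (\<integral>x. f (x + a) \<partial>cell) = integral\<^sup>L cell f"
proof -
  have nn: "(\<integral>\<^sup>+x. ennreal (h (f (x + a))) \<partial>cell) = (\<integral>\<^sup>+x. ennreal (h (f x)) \<partial>cell)"
    if [measurable]: "h \<in> borel_measurable borel" for h
    by (rule nn_integral_cell_plus[where g = "\<lambda>x. ennreal (h (f x))"])
       (use f in \<open>auto intro!: Y_periodic_comp[of f "\<lambda>y. ennreal (h y)"]\<close>)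
  assume int: "integrable cell f"
  have m: "(\<lambda>x. f (x + a)) \<in> borel_measurable cell" by (intro cell_measurable meas_plus f)
  show i: "integrable cell (\<lambda>x. f (x + a))"
    using int nn[of norm] m by (simp add: integrable_iff_bounded)
  show "(\<integral>x. f (x + a) \<partial>cell) = integral\<^sup>L cell f"
    using nn[of "\<lambda>y. y"] nn[of uminus] by (simp add: real_lebesgue_integral_def[OF i] real_lebesgue_integral_def[OF int])
qed

text \<open>The indicator of the exceptional set is periodic. If its integral over the cell
  vanishes, so does its integral over every cube \<open>pbox N UNIV\<close>, and these cubes exhaust
  the space.\<close>

lemma AE_cell_imp_AE:
  assumes Q: "Measurable.pred lebesgue Q" "Y_periodic Q" and ae: "AE x in cell. Q x"
  shows "AE x in (lebesgue :: (real ^ 'n) measure). Q x"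
proof -
  define g :: "real ^ 'n \<Rightarrow> ennreal" where "g x = (if Q x then 0 else 1)" for x
  have m [measurable]: "g \<in> borel_measurable lebesgue" using Q(1) unfolding g_def by measurable
  have p: "Y_periodic g" unfolding g_def using Q(2) by (rule Y_periodic_comp)
  have "integral\<^sup>N cell g = 0"
    by (subst nn_integral_0_iff_AE) (use ae in \<open>auto simp: g_def intro!: cell_measurable m elim: eventually_mono\<close>)
  then have "AE x in lebesgue. g x * indicator (pbox N UNIV) x = 0" for N
    using nn_integral_pbox[OF m p, of N UNIV] by (simp add: nn_integral_cell[OF m] nn_integral_0_iff_AE)
  then have "AE x in lebesgue. \<forall>N. g x * indicator (pbox N UNIV) x = 0"
    unfolding AE_all_countable by blast
  then show ?thesis
  proof eventually_elim
    case (elim x)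
    obtain N :: nat where N: "norm x < real N" using reals_Archimedean2 by blast
    have "x \<in> pbox N UNIV"
      using N component_le_norm_cart[of x] unfolding pbox_def by (auto simp: abs_le_iff) (smt (verit))+
    then have "g x = 0" using elim[rule_format, of N] by simp
    then show ?case by (simp add: g_def split: if_splits)
  qed
qed

lemma compact_subset_pbox:
  assumes "compact (K :: (real ^ 'n) set)" obtains N where "K \<subseteq> pbox N UNIV"
proof -
  obtain B where B: "\<And>x. x \<in> K \<Longrightarrow> norm x \<le> B" using compact_imp_bounded[OF assms] by (auto simp: bounded_iff)
  obtain N :: nat where N: "B < real N" using reals_Archimedean2 by blast
  have "K \<subseteq> pbox N UNIV"
  proof
    fix x assume "x \<in> K"
    from B[OF this] show "x \<in> pbox N UNIV"
      using N component_le_norm_cart[of x] unfolding pbox_def by (auto simp: abs_le_iff) (smt (verit))+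
  qed
  with that show ?thesis .
qed

lemma set_integrable_periodic:
  fixes f :: "real ^ 'n \<Rightarrow> real"
  assumes f: "f \<in> borel_measurable lebesgue" "Y_periodic f" "integrable cell f" and K: "compact K"
  shows "set_integrable lebesgue K f"
proof -
  obtain N where N: "K \<subseteq> pbox N UNIV" using compact_subset_pbox[OF K] .
  have [measurable]: "K \<in> sets lebesgue" using K by (simp add: compact_imp_closed)
  note [measurable] = f(1)
  have "(\<integral>\<^sup>+x. ennreal (norm (indicator K x *\<^sub>R f x)) \<partial>lebesgue)
      \<le> (\<integral>\<^sup>+x. ennreal (norm (f x)) * indicator (pbox N UNIV) x \<partial>lebesgue)"
    by (rule nn_integral_mono) (use N in \<open>auto simp: indicator_def\<close>)
  also have "\<dots> = ennreal (real (2 * N) ^ CARD('n)) * (\<integral>\<^sup>+x. ennreal (norm (f x)) \<partial>cell)"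
    using f(2) by (subst nn_integral_pbox)
      (auto intro: Y_periodic_comp[where f = f and h = "\<lambda>y. ennreal (norm y)", simplified] simp: nn_integral_cell)
  also have "\<dots> < \<infinity>"
    using f(3) by (simp add: integrable_iff_bounded ennreal_mult_less_top)
  finally show ?thesis
    unfolding set_integrable_def by (intro integrableI_bounded) auto
qed

section \<open>Periodic square integrable functions as a Hilbert space\<close>

lemma set_integrable_imp_cell:
  fixes f :: "real ^ 'n \<Rightarrow> real"
  assumes "\<And>K. compact K \<Longrightarrow> set_integrable lebesgue K f"
  shows "integrable cell f"
proof -
  have "set_integrable lebesgue Ycell f"
    by (rule set_integrable_subset[OF assms[of "cbox 0 (\<chi> i. 1)"]])
       (auto simp: Ycell_def box_subset_cbox)
  then show ?thesis by (simp add: set_integrable_def integrable_restrict_space)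
qed

lemma L2_per_iff:
  fixes f :: "real ^ 'n \<Rightarrow> real"
  shows "f \<in> L2_per \<longleftrightarrow> f \<in> borel_measurable lebesgue \<and> Y_periodic f \<and> f \<in> sqint cell"
proof
  assume "f \<in> L2_per"
  then show "f \<in> borel_measurable lebesgue \<and> Y_periodic f \<and> f \<in> sqint cell"
    using set_integrable_imp_cell[of "\<lambda>x. (f x)\<^sup>2"]
    by (auto simp: L2_per_def L2_loc_def sqint_def cell_measurable)
next
  assume f: "f \<in> borel_measurable lebesgue \<and> Y_periodic f \<and> f \<in> sqint cell"
  then have "set_integrable lebesgue K (\<lambda>x. (f x)\<^sup>2)" if "compact K" for K
    using that by (intro set_integrable_periodic Y_periodic_comp[where f = f and h = "\<lambda>y. y\<^sup>2"])
      (auto simp: sqint_def)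
  with f show "f \<in> L2_per" by (simp add: L2_per_def L2_loc_def)
qed

lemma L2_per_meas [measurable_dest]:
  fixes f :: "real ^ 'n \<Rightarrow> real" shows "f \<in> L2_per \<Longrightarrow> f \<in> borel_measurable lebesgue"
  by (simp add: L2_per_iff)

lemma L2_per_periodic: "f \<in> L2_per \<Longrightarrow> Y_periodic f"
  by (simp add: L2_per_def)

lemma L2_per_sqint:
  fixes f :: "real ^ 'n \<Rightarrow> real" shows "f \<in> L2_per \<Longrightarrow> f \<in> sqint cell"
  by (simp add: L2_per_iff)

lemma L2_loc_L1_loc: "f \<in> L2_loc \<Longrightarrow> f \<in> L1_loc"
proof -
  assume f: "f \<in> L2_loc"
  then have m [measurable]: "f \<in> borel_measurable lebesgue" by (simp add: L2_loc_def)
  have "set_integrable lebesgue K f" if K: "compact K" for K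
  proof -
    have [measurable]: "K \<in> sets lebesgue" using K by (simp add: compact_imp_closed)
    have "set_integrable lebesgue K (\<lambda>x. 1 + (f x)\<^sup>2)"
    proof (rule set_integral_add)
      show "set_integrable lebesgue K (\<lambda>x. (f x)\<^sup>2)" using f K by (auto simp: L2_loc_def)
      have "emeasure lebesgue K < \<infinity>" using K emeasure_compact_finite by (simp add: compact_imp_closed)
      then show "set_integrable lebesgue K (\<lambda>x. 1 :: real)"
        by (simp add: set_integrable_def)
    qed
    then show ?thesis
    proof (rule set_integrable_bound)
      show "set_borel_measurable lebesgue K f" unfolding set_borel_measurable_def by measurable
      have "\<bar>a\<bar> \<le> 1 + a\<^sup>2" for a :: real
        using abs_mult_le_half_squares[of 1 a] zero_le_power2[of a] by simp
      then show "AE x\<in>K in lebesgue. norm (f x) \<le> norm (1 + (f x)\<^sup>2)" by simp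
    qed
  qed
  with m show "f \<in> L1_loc" by (simp add: L1_loc_def)
qed

lemma L2_per_L1_loc: "f \<in> L2_per \<Longrightarrow> f \<in> L1_loc"
  by (simp add: L2_per_def L2_loc_L1_loc)

lemma L2_per_add:
  fixes f g :: "real ^ 'n \<Rightarrow> real"
  shows "f \<in> L2_per \<Longrightarrow> g \<in> L2_per \<Longrightarrow> (\<lambda>x. f x + g x) \<in> L2_per"
  by (auto simp: L2_per_iff intro: sqint_add Y_periodic_comp2[where h = "\<lambda>a b. a + b"] borel_measurable_add)

lemma L2_per_cmult:
  fixes f :: "real ^ 'n \<Rightarrow> real"
  shows "f \<in> L2_per \<Longrightarrow> (\<lambda>x. c * f x) \<in> L2_per"
  by (auto simp: L2_per_iff intro: sqint_cmult Y_periodic_comp[where h = "\<lambda>a. c * a"] borel_measurable_times)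

lemma L2_per_const [simp]: "(\<lambda>x. c :: real) \<in> L2_per"
  by (simp add: L2_per_iff cell.sqint_const)

lemma L2_per_diff:
  fixes f g :: "real ^ 'n \<Rightarrow> real"
  shows "f \<in> L2_per \<Longrightarrow> g \<in> L2_per \<Longrightarrow> (\<lambda>x. f x - g x) \<in> L2_per"
  using L2_per_add[OF _ L2_per_cmult[of g "-1"]] by simp

lemma L2_per_sum:
  assumes "\<And>i. i \<in> I \<Longrightarrow> f i \<in> L2_per" shows "(\<lambda>x. \<Sum>i\<in>I. f i x :: real) \<in> L2_per"
  using assms by (induction I rule: infinite_finite_induct) (auto intro: L2_per_add)

lemma L2_per_plus:
  fixes f :: "real ^ 'n \<Rightarrow> real"
  assumes "f \<in> L2_per" shows "(\<lambda>x. f (x + a)) \<in> L2_per"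
proof -
  have "integrable cell (\<lambda>x. (f (x + a))\<^sup>2)"
    using assms by (intro integrable_cell_plus[where f = "\<lambda>x. (f x)\<^sup>2"]
        Y_periodic_comp[where f = f and h = "\<lambda>y. y\<^sup>2"])
      (auto simp: L2_per_iff sqint_def)
  then show ?thesis
    using assms by (auto simp: L2_per_iff sqint_def meas_plus cell_measurable Y_periodic_plus)
qed

abbreviation pnrm :: "(real ^ 'n \<Rightarrow> real) \<Rightarrow> real" where "pnrm \<equiv> L2nrm cell"

abbreviation pip :: "(real ^ 'n \<Rightarrow> real) \<Rightarrow> (real ^ 'n \<Rightarrow> real) \<Rightarrow> real" where
  "pip f g \<equiv> (\<integral>x. f x * g x \<partial>cell)"

lemma pip_plus:
  assumes "f \<in> L2_per" "g \<in> L2_per"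
  shows "pip (\<lambda>x. f (x + a)) (\<lambda>x. g (x + a)) = pip f g"
  using assms
  by (intro integral_cell_plus[where f = "\<lambda>x. f x * g x"] Y_periodic_comp2[where h = "\<lambda>a b. a * b"])
     (auto simp: L2_per_iff intro: sqint_mult borel_measurable_times)

lemma pip_plus_left:
  assumes "f \<in> L2_per" "g \<in> L2_per"
  shows "pip (\<lambda>x. f (x + a)) g = pip f (\<lambda>x. g (x - a))"
  using pip_plus[OF assms(1) L2_per_plus[OF assms(2), of "- a"], of a] by simp

lemma pnrm_plus: "f \<in> L2_per \<Longrightarrow> pnrm (\<lambda>x. f (x + a)) = pnrm f"
  by (simp add: L2.nrm_def pip_plus)

lemma mean_plus:
  fixes f :: "real ^ 'n \<Rightarrow> real"
  shows "f \<in> L2_per \<Longrightarrow> (\<integral>x. f (x + a) \<partial>cell) = integral\<^sup>L cell f"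
  by (rule integral_cell_plus) (auto simp: L2_per_iff intro: cell.sqint_integrable)

lemma L2_per_AE_eq:
  fixes f g :: "real ^ 'n \<Rightarrow> real"
  assumes "f \<in> L2_per" "g \<in> L2_per" "pnrm (\<lambda>x. f x - g x) = 0"
  shows "AE x in lebesgue. f x = g x"
proof (rule AE_cell_imp_AE)
  show "Measurable.pred lebesgue (\<lambda>x. f x = g x)" using assms by measurable
  show "Y_periodic (\<lambda>x. f x = g x)"
    using assms by (intro Y_periodic_comp2[where h = "(=)"] L2_per_periodic)
  show "AE x in cell. f x = g x"
    using assms L2nrm_eq_0_iff[OF L2.diff_mem[OF L2_per_sqint L2_per_sqint], of f g] by simp
qed

lemma semi_hilbert_L2_per: "semi_hilbert (L2_per :: (real ^ 'n \<Rightarrow> real) set) pip"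
proof -
  have 1: "semi_inner (L2_per :: (real ^ 'n \<Rightarrow> real) set) pip"
  proof
    fix f g h :: "real ^ 'n \<Rightarrow> real" and c :: real
    assume f: "f \<in> L2_per"
    show "(\<lambda>t. c *\<^sub>R f t) \<in> L2_per" using f by (simp add: L2_per_cmult)
    show "0 \<le> pip f f" by simp
    assume g: "g \<in> L2_per"
    show "(\<lambda>t. f t + g t) \<in> L2_per" using f g by (rule L2_per_add)
    show "pip f g = pip g f" by (simp add: mult.commute)
    show "pip (\<lambda>t. c *\<^sub>R f t) g = c * pip f g" using f g by (intro L2.ip_scale L2_per_sqint)
    assume h: "h \<in> L2_per"
    show "pip (\<lambda>t. f t + g t) h = pip f h + pip g h" using f g h by (intro L2.ip_add L2_per_sqint)
  qed simp
  interpret P: semi_inner "L2_per :: (real ^ 'n \<Rightarrow> real) set" pip by (rule 1)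
  show ?thesis
  proof
    fix f :: "nat \<Rightarrow> real ^ 'n \<Rightarrow> real"
    assume f: "\<And>k. f k \<in> L2_per" and C: "L2.nrm_Cauchy cell f"
    show "\<exists>l\<in>L2_per. (\<lambda>k. pnrm (\<lambda>t. f k t - l t)) \<longlonglongrightarrow> 0"
    proof (rule cell.sqint_Cauchy_subseq[OF L2_per_sqint[OF f] C])
      fix r :: "nat \<Rightarrow> nat"
      assume conv: "AE x in cell. convergent (\<lambda>k. f (r k) x)"
        and lim: "\<And>l. l \<in> borel_measurable cell \<Longrightarrow> (AE x in cell. (\<lambda>k. f (r k) x) \<longlonglongrightarrow> l x) \<Longrightarrow>
           l \<in> sqint cell \<and> (\<lambda>k. pnrm (\<lambda>x. f k x - l x)) \<longlonglongrightarrow> 0"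
      \<comment> \<open>Taking \<open>lim\<close> at every point makes periodicity automatic: for
        almost every x the sequences at x and at x plus a unit vector coincide, so
        \<open>lim\<close> has the same value there whether or not they converge. Convergence itself
        is known only on the cell.\<close>
      define l where "l x = Topological_Spaces.lim (\<lambda>k. f (r k) x)" for x
      have [measurable]: "f k \<in> borel_measurable lebesgue" for k using f by (rule L2_per_meas)
      have m: "l \<in> borel_measurable lebesgue" unfolding l_def by measurable
      have "Y_periodic l"
        unfolding Y_periodic_def
      proof
        fix i
        have "AE x in lebesgue. \<forall>k. f (r k) (x + axis i 1) = f (r k) x"
          using L2_per_periodic[OF f] by (simp add: AE_all_countable Y_periodic_def)
        then show "AE x in lebesgue. l (x + axis i 1) = l x"
          by eventually_elim (simp add: l_def)
      qed
      moreover have *: "l \<in> sqint cell \<and> (\<lambda>k. pnrm (\<lambda>x. f k x - l x)) \<longlonglongrightarrow> 0"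
      proof (rule lim)
        show "l \<in> borel_measurable cell" using m by (rule cell_measurable)
        show "AE x in cell. (\<lambda>k. f (r k) x) \<longlonglongrightarrow> l x"
          using conv by eventually_elim (simp add: convergent_LIMSEQ_iff l_def)
      qed
      ultimately have "l \<in> L2_per" using m by (simp add: L2_per_iff)
      with * show ?thesis by blast
    qed
  qed
qed

lemmas L2_per_complete = semi_hilbert.complete[OF semi_hilbert_L2_per]

section \<open>Smooth functions\<close>

lemma pderiv_atI: "(f has_derivative D) (at x) \<Longrightarrow> pderiv_at i f x = D (axis i 1)"
  by (simp add: pderiv_at_def frechet_derivative_at[symmetric])

lemma Ck_Suc_imp_Ck: "Ck (Suc k) f \<Longrightarrow> Ck k f"
proof (induction k arbitrary: f)
  case 0 then show ?case by (simp add: differentiable_imp_continuous_on)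
next
  case (Suc k) then show ?case by (metis Ck.simps(2))
qed

lemma Ck_differentiable: "Ck (Suc k) f \<Longrightarrow> f differentiable (at x)"
  by (simp add: differentiable_on_def)

lemma Ck_has_derivative: "Ck (Suc k) f \<Longrightarrow> (f has_derivative frechet_derivative f (at x)) (at x)"
  using Ck_differentiable frechet_derivative_works by blast

lemma Ck_frechet: "Ck (Suc k) f \<Longrightarrow> Ck k (\<lambda>x. frechet_derivative f (at x) (axis i 1))"
  by (simp add: pderiv_at_def[abs_def])

lemma Ck_SucI:
  assumes "\<And>x. (f has_derivative D x) (at x)" "\<And>i. Ck k (\<lambda>x. D x (axis i 1))"
  shows "Ck (Suc k) f"
proof -
  have "pderiv_at i f = (\<lambda>x. D x (axis i 1))" for i
    using assms(1) by (auto simp: pderiv_atI)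
  then show ?thesis
    using assms by (auto simp: differentiable_on_def differentiable_def)
qed

lemma Ck_const [simp]: "Ck k (\<lambda>x. c)"
proof (induction k arbitrary: c)
  case (Suc k) show ?case by (rule Ck_SucI[where D = "\<lambda>x h. 0"]) (auto simp: Suc)
qed simp

lemma Ck_add: "Ck k f \<Longrightarrow> Ck k g \<Longrightarrow> Ck k (\<lambda>x. f x + g x)"
proof (induction k arbitrary: f g)
  case (Suc k)
  note D = Ck_has_derivative[OF Suc(2)] Ck_has_derivative[OF Suc(3)]
  show ?case
    by (rule Ck_SucI[OF has_derivative_add[OF D]])
       (intro Suc.IH Ck_frechet Suc.prems)
qed (simp add: continuous_on_add)

lemma Ck_mult: "Ck k f \<Longrightarrow> Ck k g \<Longrightarrow> Ck k (\<lambda>x. f x * g x)"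
proof (induction k arbitrary: f g)
  case (Suc k)
  note D = Ck_has_derivative[OF Suc(2)] Ck_has_derivative[OF Suc(3)]
  show ?case
    by (rule Ck_SucI[OF has_derivative_mult[OF D]])
       (intro Ck_add Suc.IH Ck_frechet Suc.prems Suc.prems[THEN Ck_Suc_imp_Ck])
qed (simp add: continuous_on_mult)

lemma Ck_diff: "Ck k f \<Longrightarrow> Ck k g \<Longrightarrow> Ck k (\<lambda>x. f x - g x)"
  using Ck_add[of k f "\<lambda>x. - 1 * g x"] Ck_mult[of k "\<lambda>x. - 1" g] by simp

lemma Ck_prod: "(\<And>i. i \<in> I \<Longrightarrow> Ck k (f i)) \<Longrightarrow> Ck k (\<lambda>x. \<Prod>i\<in>I. f i x)"
  by (induction I rule: infinite_finite_induct) (auto intro: Ck_mult)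

lemma Ck_coord: "Ck k (\<lambda>x. x $ i)"
proof (cases k)
  case 0 then show ?thesis by (simp add: continuous_on_component)
next
  case (Suc m)
  then show ?thesis
    by (simp only:) (rule Ck_SucI[where D = "\<lambda>x h. h $ i"], auto intro!: bounded_linear_imp_has_derivative bounded_linear_vec_nth)
qed

text \<open>Differentiation shifts the phase by pi / 2, so the induction closes within one family
  once \<open>d\<close> is arbitrary.\<close>

lemma Ck_cos: "Ck k (\<lambda>x. cos (c * x $ i + d))"
proof (induction k arbitrary: d)
  case 0 show ?case by (auto intro!: continuous_intros)
next
  case (Suc k)
  have "((\<lambda>x. cos (c * x $ i + d)) has_derivative (\<lambda>h. (c * h $ i) * cos (c * x $ i + (d + pi / 2)))) (at x)" for x :: "real ^ 'a"
  proof -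
    have "((\<lambda>x. cos (c * x $ i + d)) has_derivative (\<lambda>h. (c * h $ i) * - sin (c * x $ i + d))) (at x)"
      by (auto intro!: derivative_eq_intros bounded_linear.has_derivative[OF bounded_linear_vec_nth])
    moreover have "cos (c * x $ i + (d + pi / 2)) = - sin (c * x $ i + d)"
      by (simp add: add.assoc[symmetric] cos_add)
    ultimately show ?thesis by simp
  qed
  then show ?case by (rule Ck_SucI) (intro Ck_mult Suc.IH Ck_const)
qed

lemma Ck_exp: "Ck k u \<Longrightarrow> Ck k (\<lambda>x. exp (u x))"
proof (induction k)
  case 0 then show ?case by (auto intro!: continuous_intros)
next
  case (Suc k)
  have "((\<lambda>x. exp (u x)) has_derivative (\<lambda>h. exp (u x) * frechet_derivative u (at x) h)) (at x)" for x
    using has_derivative_exp[OF Ck_has_derivative[OF Suc(2), of x]] by (simp add: mult.commute)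
  then show ?case
    by (rule Ck_SucI) (intro Ck_mult Suc.IH Ck_frechet Suc.prems[THEN Ck_Suc_imp_Ck] Suc.prems)
qed

section \<open>Smooth approximations of indicator functions\<close>

definition flat :: "nat \<Rightarrow> real \<Rightarrow> real" where
  "flat m t = (if t > 0 then (1 / t) ^ m * exp (- (1 / t)) else 0)"

lemma flat_pos [simp]: "t > 0 \<Longrightarrow> flat 0 t > 0" and flat_nonneg: "0 \<le> flat 0 t"
  and flat_nonpos [simp]: "t \<le> 0 \<Longrightarrow> flat m t = 0"
  by (auto simp: flat_def)

lemma flat_tendsto_0: "(flat m \<longlongrightarrow> 0) (at 0)"
proof (rule filterlim_split_at)
  have "\<forall>\<^sub>F t in at_left 0. flat m t = 0"
    by (auto simp: flat_def eventually_at_filter)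
  then show "(flat m \<longlongrightarrow> 0) (at_left 0)" by (rule tendsto_eventually)
  have "((\<lambda>t. inverse t ^ m / exp (inverse t)) \<longlongrightarrow> (0::real)) (at_right 0)"
    by (rule filterlim_compose[OF tendsto_power_div_exp_0 filterlim_inverse_at_top_right])
  moreover have "\<forall>\<^sub>F t in at_right 0. inverse t ^ m / exp (inverse t) = flat m t"
    unfolding eventually_at_filter
    by (auto simp: flat_def exp_minus divide_simps intro!: always_eventually)
  ultimately show "(flat m \<longlongrightarrow> 0) (at_right 0)" by (rule Lim_transform_eventually)
qed

text \<open>The family is closed under differentiation up to linear combinations, which gives
  smoothness by induction. At 0 the difference quotient of \<open>flat m\<close> is exactly
  \<open>flat (Suc m)\<close>, so the derivative there is a limit already computed.\<close>

lemma flat_deriv: "(flat m has_real_derivative - real m * flat (Suc m) t + flat (m + 2) t) (at t)"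
proof -
  consider "t > 0" | "t < 0" | "t = 0" by linarith
  then show ?thesis
  proof cases
    case 1
    have "((\<lambda>t. (1 / t) ^ m * exp (- (1 / t))) has_real_derivative - real m * flat (Suc m) t + flat (m + 2) t) (at t)"
    proof (cases m)
      case 0
      then show ?thesis using 1
        by (auto intro!: derivative_eq_intros simp: flat_def field_simps power2_eq_square)
    next
      case (Suc k)
      have d: "((\<lambda>t. 1 / t) has_real_derivative - (1 / (t * t))) (at t)"
        using 1 by (auto intro!: derivative_eq_intros)
      have e: "((\<lambda>t. exp (- (1 / t))) has_real_derivative exp (- (1 / t)) * (- (- (1 / (t * t))))) (at t)"
        by (rule DERIV_fun_exp[OF DERIV_minus[OF d]])
      show ?thesis unfolding Suc
        by (rule DERIV_cong[OF DERIV_mult[OF DERIV_power_Suc[OF d, of k] e]])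
           (use 1 in \<open>simp add: flat_def field_simps\<close>)
    qed
    then show ?thesis
      by (rule has_field_derivative_transform_within_open[of _ _ _ "{0<..}"]) (use 1 in \<open>auto simp: flat_def\<close>)
  next
    case 2
    have "((\<lambda>t. 0) has_real_derivative - real m * flat (Suc m) t + flat (m + 2) t) (at t)"
      using 2 by simp
    then show ?thesis
      by (rule has_field_derivative_transform_within_open[of _ _ _ "{..<0}"]) (use 2 in auto)
  next
    case 3
    have "(\<lambda>h. (flat m (0 + h) - flat m 0) / h) = flat (Suc m)"
      by (auto simp: flat_def fun_eq_iff)
    then show ?thesis using 3 flat_tendsto_0[of "Suc m"] by (simp add: DERIV_def)
  qed
qed

lemma Ck_flat: "Ck k u \<Longrightarrow> Ck k (\<lambda>x. flat m (u x))"
proof (induction k arbitrary: m)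
  case 0
  have "continuous_on UNIV (flat m)"
    by (rule DERIV_continuous_on) (rule has_field_derivative_at_within[OF flat_deriv])
  then show ?case using 0 continuous_on_compose2[of UNIV "flat m" UNIV u] by simp
next
  case (Suc k)
  have "((\<lambda>x. flat m (u x)) has_derivative
      (\<lambda>h. frechet_derivative u (at x) h * (- real m * flat (Suc m) (u x) + flat (m + 2) (u x)))) (at x)" for x
    using has_derivative_compose[OF Ck_has_derivative[OF Suc(2)] flat_deriv[of m "u x", unfolded has_field_derivative_def]]
    by (simp add: mult.commute)
  then show ?case
    by (rule Ck_SucI) (intro Ck_mult Ck_add Ck_const Suc.IH Ck_frechet Suc.prems[THEN Ck_Suc_imp_Ck] Suc.prems)
qed

text \<open>The product is positive exactly where all \<open>u i\<close> are, and 1 - exp (- m p)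
  tends to 1 there and is 0 elsewhere. With parabolas for \<open>u\<close> this yields compactly
  supported approximations of a box, with cosines periodic ones.\<close>

definition smooth_ind :: "('n \<Rightarrow> real ^ 'n \<Rightarrow> real) \<Rightarrow> nat \<Rightarrow> real ^ 'n \<Rightarrow> real" where
  "smooth_ind u m x = 1 - exp (- real m * (\<Prod>i\<in>UNIV. flat 0 (u i x)))"

lemma Ck_smooth_ind: "(\<And>i. Ck k (u i)) \<Longrightarrow> Ck k (smooth_ind u m)"
  unfolding smooth_ind_def[abs_def] by (intro Ck_diff Ck_const Ck_exp Ck_mult Ck_prod Ck_flat)

lemma smooth_ind_bounds: "0 \<le> smooth_ind u m x" "smooth_ind u m x \<le> 1"
  unfolding smooth_ind_def by (auto intro!: mult_nonneg_nonneg prod_nonneg flat_nonneg)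

lemma smooth_ind_eq_0: "u i x \<le> 0 \<Longrightarrow> smooth_ind u m x = 0"
proof -
  assume "u i x \<le> 0"
  then have "(\<Prod>i\<in>UNIV. flat 0 (u i x)) = 0" by (intro prod_zero bexI[of _ i]) auto
  then show ?thesis by (simp add: smooth_ind_def)
qed

lemma smooth_ind_tendsto: "(\<lambda>m. smooth_ind u m x) \<longlonglongrightarrow> indicator {x. \<forall>i. 0 < u i x} x"
proof (cases "\<forall>i. 0 < u i x")
  case True
  define p where "p = (\<Prod>i\<in>UNIV. flat 0 (u i x))"
  have p: "0 < p" unfolding p_def using True by (intro prod_pos) auto
  have "(\<lambda>m. exp (- p) ^ m) \<longlonglongrightarrow> 0" by (rule LIMSEQ_realpow_zero) (use p in auto)
  then have "(\<lambda>m. 1 - exp (- p) ^ m) \<longlonglongrightarrow> 1 - 0" by (rule tendsto_diff[OF tendsto_const])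
  moreover have "smooth_ind u m x = 1 - exp (- p) ^ m" for m
    by (simp add: smooth_ind_def p_def[symmetric] exp_of_nat_mult[symmetric])
  ultimately show ?thesis using True by (simp add: indicator_def)
next
  case False
  then obtain i where "u i x \<le> 0" by (auto simp: not_less)
  then show ?thesis using False by (auto simp: smooth_ind_eq_0)
qed


section \<open>Test functions\<close>

lemma test_functionsI:
  assumes "\<And>k. Ck k \<phi>" "compact K" "\<And>x. x \<notin> K \<Longrightarrow> \<phi> x = 0"
  shows "\<phi> \<in> test_functions"
proof -
  have "{x. \<phi> x \<noteq> 0} \<subseteq> K" using assms(3) by auto
  then have "closure {x. \<phi> x \<noteq> 0} \<subseteq> K" using assms(2) by (intro closure_minimal) (auto simp: compact_imp_closed)
  then have "compact (closure {x. \<phi> x \<noteq> 0})"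
    using compact_Int_closed[OF assms(2) closed_closure[of "{x. \<phi> x \<noteq> 0}"]] by (simp add: Int_absorb1)
  with assms(1) show ?thesis by (simp add: test_functions_def)
qed

lemma test_Ck: "\<phi> \<in> test_functions \<Longrightarrow> Ck k \<phi>"
  by (simp add: test_functions_def)

lemma test_continuous: "\<phi> \<in> test_functions \<Longrightarrow> continuous_on UNIV \<phi>"
  using test_Ck[of \<phi> 0] by simp

lemma test_has_derivative: "\<phi> \<in> test_functions \<Longrightarrow> (\<phi> has_derivative frechet_derivative \<phi> (at x)) (at x)"
  by (rule Ck_has_derivative[OF test_Ck[of \<phi> "Suc 0"]])

lemma test_support:
  assumes "\<phi> \<in> test_functions" obtains K where "compact K" "\<And>x. x \<notin> K \<Longrightarrow> \<phi> x = 0"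
proof
  show "compact (closure {x. \<phi> x \<noteq> 0})" using assms by (simp add: test_functions_def)
  show "\<phi> x = 0" if "x \<notin> closure {x. \<phi> x \<noteq> 0}" for x
    using that closure_subset[of "{x. \<phi> x \<noteq> 0}"] by auto
qed

lemma test_meas [measurable_dest]: "\<phi> \<in> test_functions \<Longrightarrow> \<phi> \<in> borel_measurable lebesgue"
  by (simp add: measurable_completion borel_measurable_continuous_onI test_continuous)

lemma test_bounded:
  assumes "\<phi> \<in> test_functions" obtains B where "\<And>x. \<bar>\<phi> x\<bar> \<le> B" "0 \<le> B"
proof -
  obtain K where K: "compact K" "\<And>x. x \<notin> K \<Longrightarrow> \<phi> x = 0" using test_support[OF assms] by blast
  have "bounded (\<phi> ` K)"
    by (intro compact_imp_bounded compact_continuous_image K continuous_on_subset[OF test_continuous[OF assms]]) simp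
  then obtain B where B: "\<And>x. x \<in> K \<Longrightarrow> \<bar>\<phi> x\<bar> \<le> B" by (auto simp: bounded_iff)
  have "\<bar>\<phi> x\<bar> \<le> max B 0" for x using B[of x] K(2)[of x] by (cases "x \<in> K") auto
  then show ?thesis by (intro that[of "max B 0"]) auto
qed

lemma test_pderiv:
  assumes "\<phi> \<in> test_functions" shows "pderiv_at i \<phi> \<in> test_functions"
proof (rule test_functionsI)
  show "Ck k (pderiv_at i \<phi>)" for k using test_Ck[OF assms, of "Suc k"] by simp
  show "compact (closure {x. \<phi> x \<noteq> 0})" using assms by (simp add: test_functions_def)
  fix x assume x: "x \<notin> closure {x. \<phi> x \<noteq> 0}"
  have "(\<phi> has_derivative (\<lambda>h. 0)) (at x)"
  proof (rule has_derivative_transform_within_open)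
    show "((\<lambda>x. 0) has_derivative (\<lambda>h. 0)) (at x)" by simp
    show "open (- closure {x. \<phi> x \<noteq> 0})" by auto
    show "0 = \<phi> y" if "y \<in> - closure {x. \<phi> x \<noteq> 0}" for y
      using that closure_subset[of "{x. \<phi> x \<noteq> 0}"] by auto
  qed (use x in simp)
  then show "pderiv_at i \<phi> x = 0" by (simp add: pderiv_atI)
qed

lemma pderiv_at_plus:
  assumes "\<phi> differentiable (at (x + a))"
  shows "pderiv_at i (\<lambda>y. \<phi> (y + a)) x = pderiv_at i \<phi> (x + a)"
proof -
  have "(\<phi> has_derivative frechet_derivative \<phi> (at (x + a))) (at (x + a))"
    using assms by (simp add: frechet_derivative_works)
  then have "((\<lambda>y. \<phi> (y + a)) has_derivative frechet_derivative \<phi> (at (x + a))) (at x)"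
    by (rule has_derivative_compose[rotated, where f = "\<lambda>y. y + a"]) (auto intro!: derivative_eq_intros)
  then show ?thesis by (simp add: pderiv_atI) (simp add: pderiv_at_def)
qed

lemma Ck_plus: "Ck k f \<Longrightarrow> Ck k (\<lambda>x. f (x + a))"
proof (induction k arbitrary: f)
  case 0 then show ?case
    using continuous_on_compose2[of UNIV f UNIV "\<lambda>x. x + a"] by (simp add: continuous_intros)
next
  case (Suc k)
  have "((\<lambda>y. f (y + a)) has_derivative frechet_derivative f (at (x + a))) (at x)" for x
    by (rule has_derivative_compose[OF _ Ck_has_derivative[OF Suc(2)], where f = "\<lambda>y. y + a"])
       (auto intro!: derivative_eq_intros)
  then show ?case
    by (rule Ck_SucI) (intro Suc.IH[where f = "\<lambda>x. frechet_derivative f (at x) (axis i 1)" for i] Ck_frechet Suc.prems)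
qed

lemma test_plus:
  assumes "\<phi> \<in> test_functions" shows "(\<lambda>x. \<phi> (x + a)) \<in> test_functions"
proof -
  obtain K where K: "compact K" "\<And>x. x \<notin> K \<Longrightarrow> \<phi> x = 0" using test_support[OF assms] by blast
  show ?thesis
  proof (rule test_functionsI)
    show "Ck k (\<lambda>x. \<phi> (x + a))" for k by (intro Ck_plus test_Ck assms)
    show "compact ((\<lambda>x. x + - a) ` K)" using compact_translation[OF K(1), of "- a"] by (simp add: add.commute)
    show "\<phi> (x + a) = 0" if "x \<notin> (\<lambda>x. x + - a) ` K" for x
    proof (rule K(2))
      show "x + a \<notin> K" using that by (force simp: image_iff)
    qed
  qed
qed

lemma test_mult:
  assumes "\<And>k. Ck k f" "\<phi> \<in> test_functions" shows "(\<lambda>x. f x * \<phi> x) \<in> test_functions"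
proof -
  obtain K where K: "compact K" "\<And>x. x \<notin> K \<Longrightarrow> \<phi> x = 0" using test_support[OF assms(2)] by blast
  show ?thesis by (rule test_functionsI[OF _ K(1)]) (auto intro: Ck_mult assms test_Ck simp: K)
qed

lemma L1_loc_mult_integrable:
  assumes f: "f \<in> L1_loc" and g: "g \<in> borel_measurable lebesgue" "\<And>x. \<bar>g x\<bar> \<le> B"
    "compact K" "\<And>x. x \<notin> K \<Longrightarrow> g x = 0"
  shows "integrable lebesgue (\<lambda>x. f x * g x)"
proof (rule Bochner_Integration.integrable_bound)
  have [measurable]: "f \<in> borel_measurable lebesgue" using f by (simp add: L1_loc_def)
  have [measurable]: "K \<in> sets lebesgue" using g(3) by (simp add: compact_imp_closed)
  show "integrable lebesgue (\<lambda>x. B * (indicator K x *\<^sub>R f x))"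
    using f g(3) by (auto simp: L1_loc_def set_integrable_def)
  show "(\<lambda>x. f x * g x) \<in> borel_measurable lebesgue" using g(1) by measurable
  have "\<bar>f x * g x\<bar> \<le> \<bar>B * (indicator K x *\<^sub>R f x)\<bar>" for x
  proof (cases "x \<in> K")
    case True
    have "\<bar>g x\<bar> \<le> \<bar>B\<bar>" using g(2)[of x] by linarith
    from mult_left_mono[OF this, of "\<bar>f x\<bar>"] show ?thesis
      using True by (simp add: abs_mult mult.commute[of "\<bar>B\<bar>"])
  qed (simp add: g)
  then show "AE x in lebesgue. norm (f x * g x) \<le> norm (B * (indicator K x *\<^sub>R f x))" by simp
qed

lemma L1_loc_test_integrable:
  assumes "f \<in> L1_loc" "\<phi> \<in> test_functions" shows "integrable lebesgue (\<lambda>x. f x * \<phi> x)"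
proof -
  obtain K where K: "compact K" "\<And>x. x \<notin> K \<Longrightarrow> \<phi> x = 0" using test_support[OF assms(2)] by blast
  obtain B where B: "\<And>x. \<bar>\<phi> x\<bar> \<le> B" using test_bounded[OF assms(2)] by blast
  show ?thesis by (rule L1_loc_mult_integrable[OF assms(1) test_meas[OF assms(2)] B K])
qed

lemma test_directional_deriv:
  assumes "\<phi> \<in> test_functions"
  shows "((\<lambda>t. \<phi> (x + axis i t)) has_real_derivative pderiv_at i \<phi> (x + axis i t)) (at t)"
proof -
  have ax: "axis i s = s *\<^sub>R (axis i 1 :: real ^ 'a)" for s by (simp add: vec_eq_iff axis_def)
  have "((\<lambda>t. x + axis i t) has_derivative (\<lambda>h. h *\<^sub>R axis i 1)) (at t)"
  proof -
    have eq: "(\<lambda>t. x + axis i t) = (\<lambda>t. x + t *\<^sub>R axis i 1)"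
      by (rule ext) (simp only: ax[symmetric])
    show ?thesis unfolding eq by (auto intro!: derivative_eq_intros)
  qed
  from has_derivative_compose[OF this test_has_derivative[OF assms]]
  have "((\<lambda>t. \<phi> (x + axis i t)) has_derivative
      (\<lambda>h. frechet_derivative \<phi> (at (x + axis i t)) (h *\<^sub>R axis i 1))) (at t)" .
  moreover have "linear (frechet_derivative \<phi> (at (x + axis i t)))"
    using test_has_derivative[OF assms] by (blast intro: has_derivative_linear)
  ultimately show ?thesis
    by (simp add: has_field_derivative_def pderiv_at_def linear_scale mult_commute_abs)
qed

lemma norm_axis_real: "norm (axis i s :: real ^ 'n) = \<bar>s\<bar>"
proof -
  have "axis i s = s *\<^sub>R (axis i 1 :: real ^ 'n)" by (simp add: vec_eq_iff axis_def)
  then show ?thesis by simp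
qed

lemma axis_zero [simp]: "axis i 0 = (0 :: real ^ 'n)"
  by (simp add: vec_eq_iff axis_def)

text \<open>Differentiation under the integral sign by dominated convergence. The translation sits
  on the test function, so \<open>f\<close> need only be locally integrable.\<close>

lemma integral_test_deriv:
  assumes f: "f \<in> L1_loc" and \<phi>: "\<phi> \<in> test_functions"
  shows "((\<lambda>t. \<integral>x. f x * \<phi> (x + axis i t) \<partial>lebesgue) has_real_derivative
    (\<integral>x. f x * pderiv_at i \<phi> x \<partial>lebesgue)) (at 0)"
proof -
  let ?c = "\<lambda>t. \<integral>x. f x * \<phi> (x + axis i t) \<partial>lebesgue"
  have [measurable]: "f \<in> borel_measurable lebesgue" using f by (simp add: L1_loc_def)
  note tests = test_plus[OF \<phi>] test_pderiv[OF \<phi>]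
  note [measurable] = test_meas[OF \<phi>] tests[THEN test_meas]
  obtain K where K: "compact K" "\<And>x. x \<notin> K \<Longrightarrow> \<phi> x = 0" using test_support[OF \<phi>] by blast
  obtain B where B: "\<And>x. \<bar>pderiv_at i \<phi> x\<bar> \<le> B" "0 \<le> B" using test_bounded[OF test_pderiv[OF \<phi>]] by blast
  \<comment> \<open>The closed 1-neighbourhood of the support: for steps of size at most 1 the
    difference quotients vanish outside it and are bounded by \<open>B\<close> on it.\<close>
  define K' where "K' = {x + y | x y. x \<in> K \<and> y \<in> cball (0 :: real ^ 'a) 1}"
  have K': "compact K'" unfolding K'_def by (rule compact_sums[OF K(1)]) simp
  have [measurable]: "K' \<in> sets lebesgue" using K' by (simp add: compact_imp_closed)
  have quot: "\<bar>(\<phi> (x + axis i t) - \<phi> x) / t\<bar> \<le> B * indicator K' x" if t: "t \<noteq> 0" "\<bar>t\<bar> \<le> 1" for x t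
  proof (cases "x \<in> K'")
    case False
    have "x + axis i s \<notin> K" if "\<bar>s\<bar> \<le> 1" for s
    proof
      assume "x + axis i s \<in> K"
      then have "x + axis i s + axis i (- s) \<in> K'" unfolding K'_def using that
        by (intro CollectI exI[of _ "x + axis i s"] exI[of _ "axis i (- s)"]) (simp add: norm_axis_real)
      with False show False by (simp add: add.assoc axis_add[symmetric])
    qed
    from this[of t] this[of 0] t show ?thesis using False by (simp add: K(2))
  next
    case True
    have "norm (\<phi> (x + axis i t) - \<phi> (x + axis i 0)) \<le> B * norm (t - 0)"
      by (rule field_differentiable_bound[of UNIV "\<lambda>t. \<phi> (x + axis i t)"])
         (use test_directional_deriv[OF \<phi>] B in \<open>auto\<close>)
    then show ?thesis using True t by (simp add: abs_divide divide_le_eq)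
  qed
  have "((\<lambda>h. (?c (0 + h) - ?c 0) / h) \<longlongrightarrow> (\<integral>x. f x * pderiv_at i \<phi> x \<partial>lebesgue)) (at 0)"
    unfolding tendsto_at_iff_sequentially
  proof (intro allI impI)
    fix h :: "nat \<Rightarrow> real" assume "\<forall>i. h i \<in> UNIV - {0}" and h0: "h \<longlonglongrightarrow> 0"
    then have hn: "h n \<noteq> 0" for n by auto
    have "\<forall>\<^sub>F n in sequentially. \<bar>h n\<bar> < 1" using h0 tendstoD[OF h0, of 1] by simp
    \<comment> \<open>The domination requires steps of size at most 1, so the first \<open>N\<close>
      terms of the sequence are dropped.\<close>
    then obtain N where N: "\<And>n. n \<ge> N \<Longrightarrow> \<bar>h n\<bar> < 1" by (auto simp: eventually_sequentially)
    have eq: "((\<lambda>h. (?c (0 + h) - ?c 0) / h) \<circ> h) n = (\<integral>x. f x * ((\<phi> (x + axis i (h n)) - \<phi> x) / h n) \<partial>lebesgue)" for n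
      using L1_loc_test_integrable[OF f \<phi>] L1_loc_test_integrable[OF f tests(1)]
      by (simp add: right_diff_distrib diff_divide_distrib)
    have "(\<lambda>n. \<integral>x. f x * ((\<phi> (x + axis i (h (n + N))) - \<phi> x) / h (n + N)) \<partial>lebesgue)
        \<longlonglongrightarrow> (\<integral>x. f x * pderiv_at i \<phi> x \<partial>lebesgue)"
    proof (rule integral_dominated_convergence)
      show "integrable lebesgue (\<lambda>x. \<bar>f x\<bar> * (B * indicator K' x))"
      proof -
        have "set_integrable lebesgue K' f" using f K' by (simp add: L1_loc_def)
        then have "integrable lebesgue (\<lambda>x. B * \<bar>indicator K' x *\<^sub>R f x\<bar>)" by (simp add: set_integrable_def)
        then show ?thesis by (simp add: abs_mult mult_ac)
      qed
      show "AE x in lebesgue. (\<lambda>n. f x * ((\<phi> (x + axis i (h (n + N))) - \<phi> x) / h (n + N))) \<longlonglongrightarrow> f x * pderiv_at i \<phi> x"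
      proof (rule AE_I2, intro tendsto_mult tendsto_const)
        fix x
        have "((\<lambda>h. (\<phi> (x + axis i (0 + h)) - \<phi> (x + axis i 0)) / h) \<longlongrightarrow> pderiv_at i \<phi> (x + axis i 0)) (at 0)"
          using test_directional_deriv[OF \<phi>, of x i 0] by (simp only: DERIV_def)
        then have "((\<lambda>h. (\<phi> (x + axis i h) - \<phi> x) / h) \<longlongrightarrow> pderiv_at i \<phi> x) (at 0)" by simp
        then have "((\<lambda>h. (\<phi> (x + axis i h) - \<phi> x) / h) \<circ> (\<lambda>n. h (n + N))) \<longlonglongrightarrow> pderiv_at i \<phi> x"
          unfolding tendsto_at_iff_sequentially
          by (elim allE impE) (use hn LIMSEQ_ignore_initial_segment[OF h0, of N] in auto)
        then show "(\<lambda>n. (\<phi> (x + axis i (h (n + N))) - \<phi> x) / h (n + N)) \<longlonglongrightarrow> pderiv_at i \<phi> x" by (simp add: o_def)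
      qed
      show "AE x in lebesgue. norm (f x * ((\<phi> (x + axis i (h (n + N))) - \<phi> x) / h (n + N))) \<le> \<bar>f x\<bar> * (B * indicator K' x)" for n
      proof (rule AE_I2)
        fix x
        have "\<bar>(\<phi> (x + axis i (h (n + N))) - \<phi> x) / h (n + N)\<bar> \<le> B * indicator K' x"
          using N[of "n + N"] by (intro quot hn) auto
        from mult_left_mono[OF this, of "\<bar>f x\<bar>"]
        show "norm (f x * ((\<phi> (x + axis i (h (n + N))) - \<phi> x) / h (n + N))) \<le> \<bar>f x\<bar> * (B * indicator K' x)"
          by (simp add: abs_mult)
      qed
    qed measurable
    then have "(\<lambda>n. ((\<lambda>h. (?c (0 + h) - ?c 0) / h) \<circ> h) (n + N)) \<longlonglongrightarrow> (\<integral>x. f x * pderiv_at i \<phi> x \<partial>lebesgue)"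
      by (simp only: eq)
    then show "((\<lambda>h. (?c (0 + h) - ?c 0) / h) \<circ> h) \<longlonglongrightarrow> (\<integral>x. f x * pderiv_at i \<phi> x \<partial>lebesgue)"
      by (rule LIMSEQ_offset)
  qed
  then show ?thesis by (simp only: DERIV_def)
qed

text \<open>The integral of a translated test function does not depend on the translation; its
  derivative in the translation parameter is the integral of the partial derivative.\<close>

lemma integral_pderiv_test:
  assumes \<phi>: "\<phi> \<in> test_functions" shows "(\<integral>x. pderiv_at i \<phi> x \<partial>lebesgue) = 0"
proof -
  have one: "(\<lambda>x. 1) \<in> L1_loc"
    by (intro L2_per_L1_loc L2_per_const)
  have "(\<lambda>t. \<integral>x. 1 * \<phi> (x + axis i t) \<partial>lebesgue) = (\<lambda>t. \<integral>x. \<phi> x \<partial>lebesgue)"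
    using integral_lebesgue_plus[OF test_meas[OF \<phi>]] by simp
  then have "((\<lambda>t. \<integral>x. 1 * \<phi> (x + axis i t) \<partial>lebesgue) has_real_derivative 0) (at 0)" by simp
  from DERIV_unique[OF integral_test_deriv[OF one \<phi>] this] show ?thesis by simp
qed

text \<open>The product of a smooth function with a test function is a test function, and the
  integral of its derivative is zero.\<close>

lemma has_weak_pderiv_smooth:
  assumes f: "\<And>k. Ck k f" shows "has_weak_pderiv i f (pderiv_at i f)"
proof -
  have cont: "f \<in> L1_loc" if "Ck 0 f" for f :: "real ^ 'a \<Rightarrow> real"
  proof -
    have c: "continuous_on UNIV f" using that by simp
    have "set_integrable lebesgue K f" if "compact K" for K
    proof -
      have "set_integrable lborel K f"
        unfolding set_integrable_def
        by (rule borel_integrable_compact) (use that c continuous_on_subset in auto)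
      then show ?thesis unfolding set_integrable_def
        by (subst integrable_completion) (auto dest: borel_measurable_integrable)
    qed
    moreover have "f \<in> borel_measurable lebesgue"
      by (simp add: measurable_completion borel_measurable_continuous_onI c)
    ultimately show ?thesis by (simp add: L1_loc_def)
  qed
  have p: "Ck k (pderiv_at i f)" for k using f[of "Suc k"] by simp
  have L: "f \<in> L1_loc" "pderiv_at i f \<in> L1_loc" using cont[OF f] cont[OF p] by auto
  have "(\<integral>x. f x * pderiv_at i \<phi> x \<partial>lebesgue) = - (\<integral>x. pderiv_at i f x * \<phi> x \<partial>lebesgue)"
    if \<phi>: "\<phi> \<in> test_functions" for \<phi>
  proof -
    have "pderiv_at i (\<lambda>x. f x * \<phi> x) x = f x * pderiv_at i \<phi> x + pderiv_at i f x * \<phi> x" for x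
      by (subst pderiv_atI[OF has_derivative_mult[OF Ck_has_derivative[OF f] test_has_derivative[OF \<phi>]]])
         (simp add: pderiv_at_def)
    then have "0 = (\<integral>x. f x * pderiv_at i \<phi> x + pderiv_at i f x * \<phi> x \<partial>lebesgue)"
      using integral_pderiv_test[OF test_mult[OF f \<phi>], of i] by simp
    also have "\<dots> = (\<integral>x. f x * pderiv_at i \<phi> x \<partial>lebesgue) + (\<integral>x. pderiv_at i f x * \<phi> x \<partial>lebesgue)"
      by (intro Bochner_Integration.integral_add L1_loc_test_integrable L \<phi> test_pderiv)
    finally show ?thesis by simp
  qed
  with L show ?thesis by (simp add: has_weak_pderiv_def)
qed


section \<open>The fundamental lemma of the calculus of variations\<close>

text \<open>The positive and the negative part of the function are densities of two finite measures
  that agree on boxes. Boxes form a generator stable under intersection, so the measures are equal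
  and hence so are the parts.\<close>

lemma AE_zero_if_box_integrals_zero:
  fixes f :: "real ^ 'n \<Rightarrow> real"
  assumes f: "integrable lebesgue f" and box: "\<And>a b. (\<integral>x. f x * indicator (box a b) x \<partial>lebesgue) = 0"
  shows "AE x in lebesgue. f x = 0"
proof -
  \<comment> \<open>The generator argument runs on the Borel sigma-algebra, so \<open>f\<close> is
    exchanged for a Borel representative.\<close>
  obtain g where g [measurable]: "g \<in> borel_measurable borel" and fg: "AE x in lborel. f x = g x"
    using completion_ex_borel_measurable_real[OF borel_measurable_integrable[OF f]] by auto
  have [measurable]: "f \<in> borel_measurable lebesgue" using f by auto
  have [measurable]: "g \<in> borel_measurable lebesgue" using g by (simp add: measurable_completion)
  have fg': "AE x in lebesgue. f x = g x" using fg by (rule AE_completion)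
  have intg: "integrable lborel g"
  proof -
    have "integrable lebesgue g" by (rule integrable_cong_AE_imp[OF f]) (use fg' in auto)
    then show ?thesis by (simp add: integrable_completion)
  qed
  have box': "(\<integral>x. g x * indicator (box a b) x \<partial>lborel) = 0" for a b
  proof -
    have "(\<integral>x. g x * indicator (box a b) x \<partial>lborel) = (\<integral>x. g x * indicator (box a b) x \<partial>lebesgue)"
      by (rule integral_completion[symmetric]) simp
    also have "\<dots> = (\<integral>x. f x * indicator (box a b) x \<partial>lebesgue)"
    proof (rule integral_cong_AE)
      have [measurable]: "box a b \<in> sets lebesgue" by simp
      show "(\<lambda>x. g x * indicator (box a b) x) \<in> borel_measurable lebesgue"
        "(\<lambda>x. f x * indicator (box a b) x) \<in> borel_measurable lebesgue" by measurable
      show "AE x in lebesgue. g x * indicator (box a b) x = f x * indicator (box a b) x"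
        using fg' by eventually_elim simp
    qed
    finally show ?thesis by (simp add: box)
  qed
  let ?P = "density lborel (\<lambda>x. ennreal (g x))" and ?N = "density lborel (\<lambda>x. ennreal (- g x))"
  have fin: "(\<integral>\<^sup>+x. ennreal (h (g x)) \<partial>lborel) < \<infinity>" if "\<And>y. h y \<le> \<bar>y\<bar>" for h :: "real \<Rightarrow> real"
  proof -
    have "(\<integral>\<^sup>+x. ennreal (h (g x)) \<partial>lborel) \<le> (\<integral>\<^sup>+x. ennreal (norm (g x)) \<partial>lborel)"
      by (rule nn_integral_mono) (auto intro!: ennreal_leI that)
    also have "\<dots> < \<infinity>" using intg by (simp add: integrable_iff_bounded)
    finally show ?thesis .
  qed
  have emP: "emeasure ?P (box a b) = (\<integral>\<^sup>+x. ennreal (g x * indicator (box a b) x) \<partial>lborel)"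
    and emN: "emeasure ?N (box a b) = (\<integral>\<^sup>+x. ennreal (- (g x * indicator (box a b) x)) \<partial>lborel)" for a b
    by (auto simp: emeasure_density indicator_def intro!: nn_integral_cong)
  have le: "emeasure ?P X \<le> (\<integral>\<^sup>+x. ennreal (g x) \<partial>lborel)" "emeasure ?N X \<le> (\<integral>\<^sup>+x. ennreal (- g x) \<partial>lborel)"
    if "X \<in> sets borel" for X
    using that by (auto simp: emeasure_density indicator_def intro!: nn_integral_mono)
  have finP: "emeasure ?P X < \<infinity>" and finN: "emeasure ?N X < \<infinity>" if "X \<in> sets borel" for X
    using le_less_trans[OF le(1)[OF that] fin[of "\<lambda>y. y"]] le_less_trans[OF le(2)[OF that] fin[of uminus]]
    by auto
  have "?P = ?N"
  proof (rule measure_eqI_generator_eq[where E = "range (\<lambda>(a, b). box a b)" and \<Omega> = UNIV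
        and A = "\<lambda>n. box (- (real n *\<^sub>R One)) (real n *\<^sub>R One)"])
    show "Int_stable (range (\<lambda>(a, b). box a b :: (real ^ 'n) set))"
      by (auto simp: Int_stable_def box_Int_box)
    show "emeasure ?P X = emeasure ?N X" if X: "X \<in> range (\<lambda>(a, b). box a b)" for X
    proof -
      obtain a b where X: "X = box a b" using X by auto
      have int: "integrable lborel (\<lambda>x. g x * indicator (box a b) x)"
        by (rule integrable_real_mult_indicator[OF _ intg]) simp
      have "enn2real (emeasure ?P X) = enn2real (emeasure ?N X)"
        using box'[of a b] unfolding real_lebesgue_integral_def[OF int] X emP emN by simp
      then show ?thesis using finP[of X] finN[of X] X
        by (metis borel_open open_box ennreal_enn2real infinity_ennreal_def)
    qed
    show "sets ?P = sigma_sets UNIV (range (\<lambda>(a, b). box a b))"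
      and "sets ?N = sigma_sets UNIV (range (\<lambda>(a, b). box a b))"
      by (simp_all add: borel_eq_box)
    show "(\<Union>i. box (- (real i *\<^sub>R One)) (real i *\<^sub>R One)) = (UNIV :: (real ^ 'n) set)"
      by (rule UN_box_eq_UNIV)
    show "emeasure ?P (box (- (real i *\<^sub>R One)) (real i *\<^sub>R One)) \<noteq> \<infinity>" for i
      using finP[of "box (- (real i *\<^sub>R One)) (real i *\<^sub>R One)"] by auto
  qed auto
  then have "AE x in lborel. ennreal (g x) = ennreal (- g x)"
    using fin[of "\<lambda>y. y", OF abs_ge_self] by (subst (asm) finite_density_unique) auto
  then have "AE x in lborel. g x = 0"
    by eventually_elim (metis ennreal_eq_0_iff ennreal_neg linorder_le_cases neg_0_le_iff_le order_antisym neg_le_0_iff_le)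
  then have "AE x in lebesgue. g x = 0" by (rule AE_completion)
  with fg' show ?thesis by eventually_elim simp
qed

text \<open>Only bounded pointwise approximations of box indicators that are orthogonal to
  \<open>f\<close> enter, and convergence is asked only inside the outer box. This serves both
  compactly supported bumps and periodic ones, whose convergence outside the cell is
  different.\<close>

lemma AE_zero_on_box:
  fixes f :: "real ^ 'n \<Rightarrow> real"
  assumes int: "integrable lebesgue (\<lambda>x. indicator (box c d) x * f x)"
    and approx: "\<And>a b. box a b \<noteq> {} \<Longrightarrow> box a b \<subseteq> box c d \<Longrightarrow> \<exists>\<phi> :: nat \<Rightarrow> real ^ 'n \<Rightarrow> real.
       (\<forall>m. \<phi> m \<in> borel_measurable lebesgue) \<and> (\<forall>m x. \<bar>\<phi> m x\<bar> \<le> 1) \<and>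
       (\<forall>x\<in>box c d. (\<lambda>m. \<phi> m x) \<longlonglongrightarrow> indicator (box a b) x) \<and>
       (\<forall>m. (\<integral>x. indicator (box c d) x * f x * \<phi> m x \<partial>lebesgue) = 0)"
  shows "AE x in lebesgue. x \<in> box c d \<longrightarrow> f x = 0"
proof -
  let ?f = "\<lambda>x. indicator (box c d) x * f x"
  have "AE x in lebesgue. ?f x = 0"
  proof (rule AE_zero_if_box_integrals_zero[OF int])
    fix a b :: "real ^ 'n"
    obtain a' b' where ab: "box a b \<inter> box c d = box a' b'"
      using box_Int_box[of a b c d] by (intro that)
    have eq: "?f x * indicator (box a b) x = ?f x * indicator (box a' b') x" for x
      by (simp add: ab[symmetric] indicator_def)
    show "(\<integral>x. ?f x * indicator (box a b) x \<partial>lebesgue) = 0"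
    proof (cases "box a' b' = {}")
      case True then show ?thesis unfolding eq by simp
    next
      case False
      moreover have "box a' b' \<subseteq> box c d" using ab by blast
      ultimately obtain \<phi> :: "nat \<Rightarrow> real ^ 'n \<Rightarrow> real"
        where \<phi>: "\<And>m. \<phi> m \<in> borel_measurable lebesgue" "\<And>m x. \<bar>\<phi> m x\<bar> \<le> 1"
          "\<And>x. x \<in> box c d \<Longrightarrow> (\<lambda>m. \<phi> m x) \<longlonglongrightarrow> indicator (box a' b') x"
          "\<And>m. (\<integral>x. ?f x * \<phi> m x \<partial>lebesgue) = 0"
        using approx[of a' b'] by blast
      have "(\<lambda>m. \<integral>x. ?f x * \<phi> m x \<partial>lebesgue) \<longlonglongrightarrow> (\<integral>x. ?f x * indicator (box a' b') x \<partial>lebesgue)"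
      proof (rule integral_dominated_convergence)
        show "integrable lebesgue (\<lambda>x. \<bar>?f x\<bar>)" using int by (rule integrable_abs)
        have [measurable]: "box a' b' \<in> sets lebesgue" by simp
        show "(\<lambda>x. ?f x * indicator (box a' b') x) \<in> borel_measurable lebesgue"
          by (rule borel_measurable_times[OF borel_measurable_integrable[OF int]]) measurable
        show "(\<lambda>x. ?f x * \<phi> m x) \<in> borel_measurable lebesgue" for m
          by (rule borel_measurable_times[OF borel_measurable_integrable[OF int] \<phi>(1)])
        show "AE x in lebesgue. (\<lambda>m. ?f x * \<phi> m x) \<longlonglongrightarrow> ?f x * indicator (box a' b') x"
        proof (rule AE_I2)
          fix x
          show "(\<lambda>m. ?f x * \<phi> m x) \<longlonglongrightarrow> ?f x * indicator (box a' b') x"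
            using tendsto_mult[OF tendsto_const \<phi>(3)[of x], of "?f x"] by (cases "x \<in> box c d") auto
        qed
        show "AE x in lebesgue. norm (?f x * \<phi> m x) \<le> \<bar>?f x\<bar>" for m
          using mult_left_mono[OF \<phi>(2)[of m], of "\<bar>?f x\<bar>" for x] by (intro AE_I2) (simp add: abs_mult)
      qed
      then show ?thesis unfolding eq \<phi>(4) by (simp add: LIMSEQ_const_iff)
    qed
  qed
  then show ?thesis by eventually_elim (auto simp: indicator_def split: if_splits)
qed

lemma fundamental_lemma_box:
  fixes f :: "real ^ 'n \<Rightarrow> real"
  assumes int: "integrable lebesgue (\<lambda>x. indicator (box c d) x * f x)"
    and zero: "\<And>\<phi>. \<phi> \<in> test_functions \<Longrightarrow> (\<And>x. x \<notin> box c d \<Longrightarrow> \<phi> x = 0) \<Longrightarrow> (\<integral>x. f x * \<phi> x \<partial>lebesgue) = 0"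
  shows "AE x in lebesgue. x \<in> box c d \<longrightarrow> f x = 0"
proof (rule AE_zero_on_box[OF int])
  fix a b :: "real ^ 'n" assume ne: "box a b \<noteq> {}" and sub: "box a b \<subseteq> box c d"
  define u where "u i x = (x $ i - a $ i) * (b $ i - x $ i)" for i and x :: "real ^ 'n"
  have lt: "a $ i < b $ i" for i using ne by (simp add: interval_ne_empty_cart)
  have pos: "0 < u i x \<longleftrightarrow> a $ i < x $ i \<and> x $ i < b $ i" for i x
    using lt[of i] unfolding u_def zero_less_mult_iff by auto
  have set: "{x. \<forall>i. 0 < u i x} = box a b" by (auto simp: pos mem_box_cart)
  have out: "smooth_ind u m x = 0" if "x \<notin> box a b" for m x
    using that smooth_ind_eq_0[of u _ x m] by (auto simp: set[symmetric] not_less)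
  have test: "smooth_ind u m \<in> test_functions" for m
  proof (rule test_functionsI[where K = "cbox a b"])
    show "Ck k (smooth_ind u m)" for k
      unfolding u_def by (intro Ck_smooth_ind Ck_mult Ck_diff Ck_coord Ck_const)
    show "smooth_ind u m x = 0" if "x \<notin> cbox a b" for x
      using that box_subset_cbox[of a b] by (intro out) auto
  qed simp
  have "(\<integral>x. indicator (box c d) x * f x * smooth_ind u m x \<partial>lebesgue) = 0" for m
  proof -
    have "(\<integral>x. indicator (box c d) x * f x * smooth_ind u m x \<partial>lebesgue) = (\<integral>x. f x * smooth_ind u m x \<partial>lebesgue)"
      by (rule Bochner_Integration.integral_cong) (use out sub in \<open>auto simp: indicator_def\<close>)
    also have "\<dots> = 0" using out sub by (intro zero test) auto
    finally show ?thesis .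
  qed
  moreover have "\<bar>smooth_ind u m x\<bar> \<le> 1" for m x using smooth_ind_bounds[of u m x] by simp
  moreover have "(\<lambda>m. smooth_ind u m x) \<longlonglongrightarrow> indicator (box a b) x" for x
    using smooth_ind_tendsto[of u x] by (simp add: set)
  ultimately show "\<exists>\<phi> :: nat \<Rightarrow> real ^ 'n \<Rightarrow> real. (\<forall>m. \<phi> m \<in> borel_measurable lebesgue) \<and> (\<forall>m x. \<bar>\<phi> m x\<bar> \<le> 1) \<and>
       (\<forall>x\<in>box c d. (\<lambda>m. \<phi> m x) \<longlonglongrightarrow> indicator (box a b) x) \<and>
       (\<forall>m. (\<integral>x. indicator (box c d) x * f x * \<phi> m x \<partial>lebesgue) = 0)"
    using test_meas[OF test] by (intro exI[of _ "smooth_ind u"]) auto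
qed

lemma fundamental_lemma:
  assumes f: "f \<in> L1_loc" and zero: "\<And>\<phi>. \<phi> \<in> test_functions \<Longrightarrow> (\<integral>x. f x * \<phi> x \<partial>lebesgue) = 0"
  shows "AE x in lebesgue. f x = 0"
proof -
  have "AE x in lebesgue. x \<in> box (- (real N *\<^sub>R One)) (real N *\<^sub>R One) \<longrightarrow> f x = 0" for N
  proof (rule fundamental_lemma_box[OF _ zero])
    have "set_integrable lebesgue (box (- (real N *\<^sub>R One)) (real N *\<^sub>R One)) f"
      by (rule set_integrable_subset[of _ "cbox (- (real N *\<^sub>R One)) (real N *\<^sub>R One)"])
         (use f in \<open>auto simp: L1_loc_def box_subset_cbox\<close>)
    then show "integrable lebesgue (\<lambda>x. indicator (box (- (real N *\<^sub>R One)) (real N *\<^sub>R One)) x * f x)"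
      by (simp add: set_integrable_def)
  qed
  then have "AE x in lebesgue. \<forall>N::nat. x \<in> box (- (real N *\<^sub>R One)) (real N *\<^sub>R One) \<longrightarrow> f x = 0"
    unfolding AE_all_countable by blast
  then show ?thesis
  proof eventually_elim
    case (elim x)
    have "x \<in> (\<Union>N::nat. box (- (real N *\<^sub>R One)) (real N *\<^sub>R One))" unfolding UN_box_eq_UNIV by simp
    then show ?case using elim by blast
  qed
qed

text \<open>The difference of two candidates annihilates every test function.\<close>

lemma weak_pderiv_unique:
  assumes "has_weak_pderiv i f g" "has_weak_pderiv i f h"
  shows "AE x in lebesgue. g x = h x"
proof -
  have L: "g \<in> L1_loc" "h \<in> L1_loc" using assms by (auto simp: has_weak_pderiv_def)
  have "AE x in lebesgue. g x - h x = 0"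
  proof (rule fundamental_lemma)
    show "(\<lambda>x. g x - h x) \<in> L1_loc"
      using L by (auto simp: L1_loc_def intro: set_integral_diff borel_measurable_diff)
    fix \<phi> :: "real ^ 'a \<Rightarrow> real" assume \<phi>: "\<phi> \<in> test_functions"
    show "(\<integral>x. (g x - h x) * \<phi> x \<partial>lebesgue) = 0"
      using assms \<phi> L1_loc_test_integrable[OF L(1) \<phi>] L1_loc_test_integrable[OF L(2) \<phi>]
      by (simp add: left_diff_distrib has_weak_pderiv_def)
  qed
  then show ?thesis by eventually_elim simp
qed

lemma weak_pderiv_wpd: "has_weak_pderiv i f g \<Longrightarrow> has_weak_pderiv i f (wpd i f)"
  unfolding wpd_def by (rule someI[of "has_weak_pderiv i f"])

lemma wpd_eq_AE: "has_weak_pderiv i f g \<Longrightarrow> AE x in lebesgue. wpd i f x = g x"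
  using weak_pderiv_unique weak_pderiv_wpd by blast

section \<open>Density of test functions supported in the cell\<close>

lemma integral_cell_test:
  fixes f :: "real ^ 'n \<Rightarrow> real"
  assumes "\<And>x. x \<notin> Ycell \<Longrightarrow> \<phi> x = 0"
  shows "(\<integral>x. f x * \<phi> x \<partial>cell) = (\<integral>x. f x * \<phi> x \<partial>lebesgue)"
proof -
  have "(\<integral>x. f x * \<phi> x \<partial>cell) = (\<integral>x. indicator Ycell x *\<^sub>R (f x * \<phi> x) \<partial>lebesgue)"
    by (rule integral_restrict_space) simp
  also have "\<dots> = (\<integral>x. f x * \<phi> x \<partial>lebesgue)"
    by (rule Bochner_Integration.integral_cong) (use assms in \<open>auto simp: indicator_def\<close>)
  finally show ?thesis .
qed

lemma test_sqint_cell: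
  assumes "\<phi> \<in> test_functions" shows "\<phi> \<in> sqint (cell :: (real ^ 'n) measure)"
proof -
  obtain B where B: "\<And>x. \<bar>\<phi> x\<bar> \<le> B" using test_bounded[OF assms] by blast
  have "integrable cell (\<lambda>x. (\<phi> x)\<^sup>2)"
  proof (rule cell.integrable_const_bound[where B = "B\<^sup>2"])
    have "(\<phi> x)\<^sup>2 \<le> B\<^sup>2" for x using B[of x] by (metis abs_ge_zero order_trans power2_abs power_mono)
    then show "AE x in cell. norm ((\<phi> x)\<^sup>2) \<le> B\<^sup>2" by simp
  qed (use cell_measurable[OF test_meas[OF assms]] in auto)
  then show ?thesis using cell_measurable[OF test_meas[OF assms]] by (simp add: sqint_def)
qed

text \<open>The functional \<open>pip f\<close> is represented on the non-closed subspace of test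
  functions by a limit \<open>p\<close> of test functions. Then \<open>f - p\<close> annihilates all
  of them, so \<open>p\<close> is \<open>f\<close> almost everywhere by the fundamental
  lemma.\<close>

lemma test_functions_dense:
  fixes f :: "real ^ 'n \<Rightarrow> real"
  assumes f: "f \<in> sqint cell"
  shows "\<exists>\<phi>. (\<forall>k::nat. \<phi> k \<in> test_functions) \<and> (\<forall>k x. x \<notin> Ycell \<longrightarrow> \<phi> k x = 0) \<and>
    (\<lambda>k. pnrm (\<lambda>x. \<phi> k x - f x)) \<longlonglongrightarrow> 0"
proof -
  interpret H: semi_hilbert "sqint cell" pip by (rule cell.semi_hilbert_sqint)
  define S where "S = {\<phi> :: real ^ 'n \<Rightarrow> real. \<phi> \<in> test_functions \<and> (\<forall>x. x \<notin> Ycell \<longrightarrow> \<phi> x = 0)}"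
  have SV: "S \<subseteq> sqint cell" by (auto simp: S_def test_sqint_cell)
  have mem: "\<phi> \<in> S" if "\<And>k. Ck k \<phi>" "\<And>x. x \<notin> Ycell \<Longrightarrow> \<phi> x = 0" for \<phi>
  proof -
    have "\<phi> \<in> test_functions"
      by (rule test_functionsI[where K = "cbox 0 (\<chi> i. 1)"])
         (use that box_subset_cbox[of 0 "(\<chi> i. 1) :: real ^ 'n"] in \<open>auto simp: Ycell_def\<close>)
    then show ?thesis using that by (simp add: S_def)
  qed
  have S: "semi_inner S pip"
  proof
    fix x y z :: "real ^ 'n \<Rightarrow> real" and c :: real
    assume x: "x \<in> S"
    show "(\<lambda>t. c *\<^sub>R x t) \<in> S"
      by (rule mem) (use x in \<open>auto simp: S_def intro: Ck_mult test_Ck\<close>)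
    show "0 \<le> pip x x" by simp
    assume y: "y \<in> S"
    show "(\<lambda>t. x t + y t) \<in> S"
      by (rule mem) (use x y in \<open>auto simp: S_def intro: Ck_add test_Ck\<close>)
    show "pip x y = pip y x" by (simp add: mult.commute)
    show "pip (\<lambda>t. c *\<^sub>R x t) y = c * pip x y" using x y SV by (intro L2.ip_scale) auto
    assume z: "z \<in> S"
    show "pip (\<lambda>t. x t + y t) z = pip x z + pip y z" using x y z SV by (intro L2.ip_add) auto
  next
    show "(\<lambda>t. 0) \<in> S" by (rule mem) auto
  qed
  show ?thesis
  proof (rule H.riesz_on_subspace[OF S SV, where L = "pip f" and C = "pnrm f"])
    fix \<phi> p assume \<phi>: "\<And>k::nat. \<phi> k \<in> S" and p: "p \<in> sqint cell"
      and lim: "(\<lambda>k. pnrm (\<lambda>x. \<phi> k x - p x)) \<longlonglongrightarrow> 0" and eq: "\<And>s. s \<in> S \<Longrightarrow> pip p s = pip f s"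
    have d: "(\<lambda>x. f x - p x) \<in> sqint cell" using f p by (rule L2.diff_mem)
    have "AE x in lebesgue. x \<in> box 0 (\<chi> i. 1) \<longrightarrow> f x - p x = 0"
    proof (rule fundamental_lemma_box)
      show "integrable lebesgue (\<lambda>x. indicator (box 0 (\<chi> i. 1)) x * (f x - p x))"
        using cell.sqint_integrable[OF d] by (simp add: integrable_restrict_space Ycell_def[symmetric] set_integrable_def)
      fix \<psi> :: "real ^ 'n \<Rightarrow> real"
      assume "\<psi> \<in> test_functions" and out: "\<And>x. x \<notin> box 0 (\<chi> i. 1) \<Longrightarrow> \<psi> x = 0"
      then have \<psi>: "\<psi> \<in> S" by (simp add: S_def Ycell_def)
      have "(\<integral>x. (f x - p x) * \<psi> x \<partial>lebesgue) = (\<integral>x. (f x - p x) * \<psi> x \<partial>cell)"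
        by (rule integral_cell_test[symmetric]) (use out in \<open>auto simp: Ycell_def\<close>)
      also have "\<dots> = 0" using eq[OF \<psi>] L2.ip_diff[OF f p, of \<psi>] \<psi> SV by auto
      finally show "(\<integral>x. (f x - p x) * \<psi> x \<partial>lebesgue) = 0" .
    qed
    then have "AE x in cell. f x = p x" unfolding AE_cell by eventually_elim (auto simp: Ycell_def)
    moreover have "\<phi> k \<in> sqint cell" for k using \<phi> SV by blast
    ultimately have "pnrm (\<lambda>x. \<phi> k x - f x) = pnrm (\<lambda>x. \<phi> k x - p x)" for k
      using f p by (intro L2nrm_cong_AE sqint_meas L2.diff_mem) (auto elim!: eventually_mono)
    then show ?thesis using \<phi> lim by (intro exI[of _ \<phi>]) (auto simp: S_def)
  next
    fix s assume s: "s \<in> S"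
    show "\<bar>pip f s\<bar> \<le> pnrm f * pnrm s" using s SV by (intro L2.cauchy_schwarz f) auto
    show "pip f (\<lambda>x. c *\<^sub>R s x) = c * pip f s" for c using s SV by (intro L2.ip_scale_right f) auto
    fix t assume t: "t \<in> S"
    show "pip f (\<lambda>x. s x + t x) = pip f s + pip f t" using s t SV by (intro L2.ip_add_right f) auto
  qed
qed

section \<open>Weak derivatives of periodic functions\<close>

lemma L1_loc_add: "f \<in> L1_loc \<Longrightarrow> g \<in> L1_loc \<Longrightarrow> (\<lambda>x. f x + g x) \<in> L1_loc"
  by (auto simp: L1_loc_def intro: set_integral_add borel_measurable_add)

lemma L1_loc_cmult: "f \<in> L1_loc \<Longrightarrow> (\<lambda>x. c * f x) \<in> L1_loc"
  by (auto simp: L1_loc_def intro: borel_measurable_times)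

lemma L1_loc_plus:
  assumes f: "f \<in> L1_loc" shows "(\<lambda>x. f (x + a)) \<in> L1_loc"
proof -
  have "set_integrable lebesgue K (\<lambda>x. f (x + a))" if K: "compact K" for K
  proof -
    let ?K = "(\<lambda>x. x + a) ` K"
    have "compact ?K" using compact_translation[OF K, of a] by (simp add: add.commute)
    then have "set_integrable lebesgue ?K f" using f by (simp add: L1_loc_def)
    from integrable_lebesgue_plus[OF this[unfolded set_integrable_def], of a]
    show ?thesis unfolding set_integrable_def
      by (rule Bochner_Integration.integrable_cong[THEN iffD1, rotated -1]) (auto simp: indicator_def image_iff)
  qed
  then show ?thesis using f by (simp add: L1_loc_def meas_plus)
qed

lemma L1_loc_cong_AE:
  assumes f: "f \<in> L1_loc" and g: "g \<in> borel_measurable lebesgue" "AE x in lebesgue. f x = g x"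
  shows "g \<in> L1_loc"
proof -
  have "set_integrable lebesgue K g" if K: "compact K" for K
    unfolding set_integrable_def
  proof (rule integrable_cong_AE_imp)
    show "integrable lebesgue (\<lambda>x. indicator K x *\<^sub>R f x)"
      using f K by (simp add: L1_loc_def set_integrable_def)
    have [measurable]: "K \<in> sets lebesgue" using K by (simp add: compact_imp_closed)
    show "(\<lambda>x. indicator K x *\<^sub>R g x) \<in> borel_measurable lebesgue" using g(1) by measurable
    show "AE x in lebesgue. indicator K x *\<^sub>R f x = indicator K x *\<^sub>R g x"
      using g(2) by eventually_elim simp
  qed
  then show ?thesis using g by (simp add: L1_loc_def)
qed

lemma weak_pderiv_L1_loc:
  assumes "has_weak_pderiv i f g" shows "f \<in> L1_loc" "g \<in> L1_loc"
  using assms by (auto simp: has_weak_pderiv_def)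

lemma weak_pderiv_test:
  assumes "has_weak_pderiv i f g" "\<phi> \<in> test_functions"
  shows "(\<integral>x. f x * pderiv_at i \<phi> x \<partial>lebesgue) = - (\<integral>x. g x * \<phi> x \<partial>lebesgue)"
  using assms by (auto simp: has_weak_pderiv_def)

lemma weak_pderiv_add:
  assumes f: "has_weak_pderiv i f f'" and g: "has_weak_pderiv i g g'"
  shows "has_weak_pderiv i (\<lambda>x. f x + g x) (\<lambda>x. f' x + g' x)"
proof -
  note L = weak_pderiv_L1_loc[OF f] weak_pderiv_L1_loc[OF g]
  have "(\<integral>x. (f x + g x) * pderiv_at i \<phi> x \<partial>lebesgue) = - (\<integral>x. (f' x + g' x) * \<phi> x \<partial>lebesgue)"
    if \<phi>: "\<phi> \<in> test_functions" for \<phi>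
    using weak_pderiv_test[OF f \<phi>] weak_pderiv_test[OF g \<phi>] L[THEN L1_loc_test_integrable, OF \<phi>]
      L[THEN L1_loc_test_integrable, OF test_pderiv[OF \<phi>]]
    by (simp add: distrib_right)
  then show ?thesis using L by (simp add: has_weak_pderiv_def L1_loc_add)
qed

lemma weak_pderiv_cmult:
  assumes f: "has_weak_pderiv i f f'"
  shows "has_weak_pderiv i (\<lambda>x. c * f x) (\<lambda>x. c * f' x)"
  using weak_pderiv_L1_loc[OF f] weak_pderiv_test[OF f]
  by (simp add: has_weak_pderiv_def L1_loc_cmult mult.assoc)

lemma weak_pderiv_diff:
  assumes "has_weak_pderiv i f f'" "has_weak_pderiv i g g'"
  shows "has_weak_pderiv i (\<lambda>x. f x - g x) (\<lambda>x. f' x - g' x)"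
  using weak_pderiv_add[OF assms(1) weak_pderiv_cmult[OF assms(2), of "- 1"]] by simp

lemma weak_pderiv_const: "has_weak_pderiv i (\<lambda>x. c) (\<lambda>x. 0)"
proof -
  have "pderiv_at i (\<lambda>x. c) = (\<lambda>x. 0)" by (rule ext) (auto intro!: pderiv_atI[where D = "\<lambda>h. 0"])
  then show ?thesis using has_weak_pderiv_smooth[of "\<lambda>x. c" i] by simp
qed

lemma weak_pderiv_plus:
  assumes f: "has_weak_pderiv i f g"
  shows "has_weak_pderiv i (\<lambda>x. f (x + a)) (\<lambda>x. g (x + a))"
proof -
  note L = weak_pderiv_L1_loc[OF f]
  have "(\<integral>x. f (x + a) * pderiv_at i \<phi> x \<partial>lebesgue) = - (\<integral>x. g (x + a) * \<phi> x \<partial>lebesgue)"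
    if \<phi>: "\<phi> \<in> test_functions" for \<phi>
  proof -
    let ?\<psi> = "\<lambda>x. \<phi> (x + - a)"
    have \<psi>: "?\<psi> \<in> test_functions" by (rule test_plus[OF \<phi>])
    have p: "pderiv_at i (\<lambda>x. \<phi> (x - a)) x = pderiv_at i \<phi> (x - a)" for x
      using pderiv_at_plus[OF Ck_differentiable[OF test_Ck[OF \<phi>]], where a = "- a" and i = i and x = x] by simp
    have m: "f \<in> borel_measurable lebesgue" "g \<in> borel_measurable lebesgue" using L by (auto simp: L1_loc_def)
    have "(\<integral>x. f (x + a) * pderiv_at i \<phi> x \<partial>lebesgue) = (\<integral>x. f x * pderiv_at i ?\<psi> x \<partial>lebesgue)"
      using integral_lebesgue_plus[OF borel_measurable_times[OF m(1) test_meas[OF test_pderiv[OF \<psi>]]], of a i] by (simp add: p)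
    also have "\<dots> = - (\<integral>x. g x * ?\<psi> x \<partial>lebesgue)" by (rule weak_pderiv_test[OF f \<psi>])
    also have "(\<integral>x. g x * ?\<psi> x \<partial>lebesgue) = (\<integral>x. g (x + a) * \<phi> x \<partial>lebesgue)"
      using integral_lebesgue_plus[OF borel_measurable_times[OF m(2) test_meas[OF \<psi>]], of a] by simp
    finally show ?thesis .
  qed
  then show ?thesis using L by (simp add: has_weak_pderiv_def L1_loc_plus)
qed

lemma weak_pderiv_cong_AE:
  assumes f: "has_weak_pderiv i f g"
    and "f' \<in> borel_measurable lebesgue" "AE x in lebesgue. f x = f' x"
    and "g' \<in> borel_measurable lebesgue" "AE x in lebesgue. g x = g' x"
  shows "has_weak_pderiv i f' g'"
proof -
  note L = weak_pderiv_L1_loc[OF f]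
  have L': "f' \<in> L1_loc" "g' \<in> L1_loc" using L1_loc_cong_AE L assms(2-) by blast+
  have "(\<integral>x. f' x * pderiv_at i \<phi> x \<partial>lebesgue) = - (\<integral>x. g' x * \<phi> x \<partial>lebesgue)"
    if \<phi>: "\<phi> \<in> test_functions" for \<phi>
  proof -
    have m: "f \<in> borel_measurable lebesgue" "g \<in> borel_measurable lebesgue" using L by (auto simp: L1_loc_def)
    have "(\<integral>x. f' x * pderiv_at i \<phi> x \<partial>lebesgue) = (\<integral>x. f x * pderiv_at i \<phi> x \<partial>lebesgue)"
      by (rule integral_cong_AE) (use assms(3) in \<open>auto intro!: borel_measurable_times assms m test_meas[OF test_pderiv[OF \<phi>]] elim: eventually_mono\<close>)
    moreover have "(\<integral>x. g' x * \<phi> x \<partial>lebesgue) = (\<integral>x. g x * \<phi> x \<partial>lebesgue)"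
      by (rule integral_cong_AE) (use assms(5) in \<open>auto intro!: borel_measurable_times assms m test_meas[OF \<phi>] elim: eventually_mono\<close>)
    ultimately show ?thesis using weak_pderiv_test[OF f \<phi>] by simp
  qed
  with L' show ?thesis by (simp add: has_weak_pderiv_def)
qed

lemma L2_per_cong_AE:
  fixes f g :: "real ^ 'n \<Rightarrow> real"
  assumes f: "f \<in> L2_per" and g: "g \<in> borel_measurable lebesgue" "AE x in lebesgue. f x = g x"
  shows "g \<in> L2_per"
proof -
  have "g \<in> sqint cell"
    by (rule sqint_cong_AE[OF L2_per_sqint[OF f] cell_measurable[OF g(1)] AE_cellI[OF g(2)]])
  moreover have "Y_periodic g"
    unfolding Y_periodic_def
  proof
    fix i
    have "AE x in lebesgue. f (x + axis i 1) = g (x + axis i 1)" by (rule AE_plus[OF g(2)])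
    moreover have "AE x in lebesgue. f (x + axis i 1) = f x"
      using L2_per_periodic[OF f] by (simp add: Y_periodic_def)
    ultimately show "AE x in lebesgue. g (x + axis i 1) = g x"
      using g(2) by eventually_elim simp
  qed
  ultimately show ?thesis using g(1) by (simp add: L2_per_iff)
qed

text \<open>\<open>H1_per\<close> asks the derivative only to be locally square integrable. Its
  periodicity follows from uniqueness: the derivative shifted by a period is the weak derivative of
  the shifted function, which is the function itself.\<close>

lemma weak_pderiv_L2_per:
  fixes f :: "real ^ 'n \<Rightarrow> real"
  assumes f: "Y_periodic f" and g: "g \<in> L2_loc" and fg: "has_weak_pderiv i f g"
  shows "g \<in> L2_per"
proof -
  have m: "f \<in> borel_measurable lebesgue" "g \<in> borel_measurable lebesgue"
    using weak_pderiv_L1_loc[OF fg] by (auto simp: L1_loc_def)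
  have "AE x in lebesgue. g (x + axis j 1) = g x" for j
  proof (rule weak_pderiv_unique[OF _ fg])
    show "has_weak_pderiv i f (\<lambda>x. g (x + axis j 1))"
      by (rule weak_pderiv_cong_AE[OF weak_pderiv_plus[OF fg, of "axis j 1"]])
         (use f m in \<open>auto simp: Y_periodic_def intro: meas_plus\<close>)
  qed
  then show ?thesis using g by (simp add: L2_per_def Y_periodic_def)
qed

section \<open>First order Sobolev functions and limits of weak derivatives\<close>

lemma H1_per_L2_per: "f \<in> H1_per \<Longrightarrow> f \<in> L2_per"
  by (simp add: H1_per_def)

lemma H1_per_weak_pderiv: "f \<in> H1_per \<Longrightarrow> has_weak_pderiv i f (wpd i f)"
  by (auto simp: H1_per_def intro: weak_pderiv_wpd)

lemma H1_per_wpd_L2_per: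
  assumes f: "f \<in> H1_per" shows "wpd i f \<in> L2_per"
proof -
  obtain g where g: "g \<in> L2_loc" "has_weak_pderiv i f g" using f by (auto simp: H1_per_def)
  have "g \<in> L2_per" using weak_pderiv_L2_per[OF L2_per_periodic[OF H1_per_L2_per[OF f]] g] .
  moreover have "wpd i f \<in> borel_measurable lebesgue"
    using weak_pderiv_L1_loc(2)[OF H1_per_weak_pderiv[OF f]] by (simp add: L1_loc_def)
  ultimately show ?thesis
    using wpd_eq_AE[OF g(2)] by (rule_tac L2_per_cong_AE) (auto elim: eventually_mono)
qed

lemma H1_perI:
  assumes "f \<in> L2_per" "\<And>i. g i \<in> L2_per" "\<And>i. has_weak_pderiv i f (g i)"
  shows "f \<in> H1_per"
  using assms by (auto simp: H1_per_def L2_per_def)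

text \<open>The value \<open>wpd i f\<close> is an arbitrary choice; in norms and products it can be
  exchanged for any weak derivative that is known explicitly.\<close>

lemma
  assumes f: "f \<in> H1_per" and g: "has_weak_pderiv i f g"
  shows pnrm_wpd: "pnrm (wpd i f) = pnrm g"
    and pip_wpd_left: "d \<in> L2_per \<Longrightarrow> pip (wpd i f) d = pip g d"
    and pip_wpd_right: "d \<in> L2_per \<Longrightarrow> pip d (wpd i f) = pip d g"
proof -
  have ae: "AE x in lebesgue. wpd i f x = g x" by (rule wpd_eq_AE[OF g])
  have m: "g \<in> borel_measurable lebesgue" using weak_pderiv_L1_loc(2)[OF g] by (simp add: L1_loc_def)
  have g2: "g \<in> L2_per" by (rule L2_per_cong_AE[OF H1_per_wpd_L2_per[OF f] m ae])
  have eq: "AE x in cell. wpd i f x = g x" using ae by (rule AE_cellI)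
  have mc: "wpd i f \<in> borel_measurable cell" "g \<in> borel_measurable cell"
    using g2 H1_per_wpd_L2_per[OF f] by (auto intro: cell_measurable)
  show "pnrm (wpd i f) = pnrm g" by (rule L2nrm_cong_AE[OF mc eq])
  assume "d \<in> L2_per"
  then have d: "d \<in> borel_measurable cell" by (intro cell_measurable L2_per_meas)
  show 1: "pip (wpd i f) d = pip g d"
    by (rule integral_cong_AE) (use eq in \<open>auto intro!: borel_measurable_times mc d elim: eventually_mono\<close>)
  then show "pip d (wpd i f) = pip d g" by (simp add: mult.commute)
qed

lemma H1_per_add:
  assumes "f \<in> H1_per" "g \<in> H1_per" shows "(\<lambda>x. f x + g x) \<in> H1_per"
  by (rule H1_perI[where g = "\<lambda>i x. wpd i f x + wpd i g x"])
     (intro L2_per_add weak_pderiv_add H1_per_L2_per H1_per_wpd_L2_per H1_per_weak_pderiv assms)+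

lemma H1_per_diff:
  assumes "f \<in> H1_per" "g \<in> H1_per" shows "(\<lambda>x. f x - g x) \<in> H1_per"
  by (rule H1_perI[where g = "\<lambda>i x. wpd i f x - wpd i g x"])
     (intro L2_per_diff weak_pderiv_diff H1_per_L2_per H1_per_wpd_L2_per H1_per_weak_pderiv assms)+

lemma H1_per_cmult:
  assumes "f \<in> H1_per" shows "(\<lambda>x. c * f x) \<in> H1_per"
  by (rule H1_perI[OF L2_per_cmult L2_per_cmult weak_pderiv_cmult])
     (use assms in \<open>auto intro: H1_per_L2_per H1_per_wpd_L2_per H1_per_weak_pderiv\<close>)

lemma H1_per_const: "(\<lambda>x. c) \<in> H1_per"
  by (rule H1_perI[OF L2_per_const L2_per_const weak_pderiv_const])

lemma H1_per_plus:
  assumes "f \<in> H1_per" shows "(\<lambda>x. f (x + a)) \<in> H1_per"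
  by (rule H1_perI[OF L2_per_plus L2_per_plus weak_pderiv_plus])
     (use assms in \<open>auto intro: H1_per_L2_per H1_per_wpd_L2_per H1_per_weak_pderiv\<close>)

text \<open>The support of \<phi> meets only finitely many cells, so pairing with \<phi> over the
  whole space is continuous for the norm of a single cell.\<close>

lemma test_pairing_bound:
  assumes \<phi>: "\<phi> \<in> test_functions"
  shows "\<exists>C. \<forall>f\<in>L2_per. \<bar>\<integral>x. f x * \<phi> x \<partial>lebesgue\<bar> \<le> C * pnrm (f :: real ^ 'n \<Rightarrow> real)"
proof -
  obtain K where K: "compact K" "\<And>x. x \<notin> K \<Longrightarrow> \<phi> x = 0" using test_support[OF \<phi>] by blast
  obtain B where B: "\<And>x. \<bar>\<phi> x\<bar> \<le> B" "0 \<le> B" using test_bounded[OF \<phi>] by blast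
  obtain N where N: "K \<subseteq> pbox N UNIV" using compact_subset_pbox[OF K(1)] .
  let ?C = "B * real (2 * N) ^ CARD('n)"
  have "\<bar>\<integral>x. f x * \<phi> x \<partial>lebesgue\<bar> \<le> ?C * pnrm f" if f: "f \<in> L2_per" for f :: "real ^ 'n \<Rightarrow> real"
  proof -
    have [measurable]: "f \<in> borel_measurable lebesgue" using f by (rule L2_per_meas)
    have int: "integrable cell f" using f by (intro cell.sqint_integrable L2_per_sqint)
    have "ennreal \<bar>\<integral>x. f x * \<phi> x \<partial>lebesgue\<bar> \<le> (\<integral>\<^sup>+x. ennreal (norm (f x * \<phi> x)) \<partial>lebesgue)"
      using integral_norm_bound_ennreal[OF L1_loc_test_integrable[OF L2_per_L1_loc[OF f] \<phi>]] by simp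
    also have "\<dots> \<le> (\<integral>\<^sup>+x. ennreal B * (ennreal \<bar>f x\<bar> * indicator (pbox N UNIV) x) \<partial>lebesgue)"
    proof (rule nn_integral_mono)
      fix x
      have "\<bar>f x * \<phi> x\<bar> \<le> B * \<bar>f x\<bar>"
        using mult_right_mono[OF B(1)[of x], of "\<bar>f x\<bar>"] by (simp add: abs_mult mult.commute)
      then show "ennreal (norm (f x * \<phi> x)) \<le> ennreal B * (ennreal \<bar>f x\<bar> * indicator (pbox N UNIV) x)"
        using N K(2)[of x] B(2) by (cases "x \<in> K") (auto simp: indicator_def ennreal_mult[symmetric] intro!: ennreal_leI)
    qed
    also have "\<dots> = ennreal B * (ennreal (real (2 * N) ^ CARD('n)) * (\<integral>\<^sup>+x. ennreal \<bar>f x\<bar> \<partial>cell))"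
      by (subst nn_integral_cmult, measurable, subst nn_integral_pbox)
         (auto intro: Y_periodic_comp[where f = f and h = "\<lambda>y. ennreal \<bar>y\<bar>"] L2_per_periodic f simp: nn_integral_cell)
    also have "(\<integral>\<^sup>+x. ennreal \<bar>f x\<bar> \<partial>cell) = ennreal (\<integral>x. \<bar>f x\<bar> \<partial>cell)"
      using int by (intro nn_integral_eq_integral) auto
    also have "ennreal B * (ennreal (real (2 * N) ^ CARD('n)) * ennreal (\<integral>x. \<bar>f x\<bar> \<partial>cell))
        = ennreal (?C * (\<integral>x. \<bar>f x\<bar> \<partial>cell))"
      using B(2) by (simp add: ennreal_mult mult.assoc)
    finally have "\<bar>\<integral>x. f x * \<phi> x \<partial>lebesgue\<bar> \<le> ?C * (\<integral>x. \<bar>f x\<bar> \<partial>cell)"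
      using B(2) by (simp add: ennreal_le_iff)
    also have "\<dots> \<le> ?C * pnrm f"
      using cell.L1_le_L2nrm[OF L2_per_sqint[OF f]] B(2) by (intro mult_left_mono) (auto simp: space_cell)
    finally show ?thesis .
  qed
  then show ?thesis by blast
qed

text \<open>The weak derivative is a closed operator: both sides of its defining identity are
  continuous in \<open>pnrm\<close>. Completeness of H1 rests on this.\<close>

lemma weak_pderiv_limit:
  fixes F G :: "nat \<Rightarrow> real ^ 'n \<Rightarrow> real"
  assumes F: "\<And>k. F k \<in> L2_per" and G: "\<And>k. G k \<in> L2_per" and FG: "\<And>k. has_weak_pderiv i (F k) (G k)"
    and f: "f \<in> L2_per" "(\<lambda>k. pnrm (\<lambda>x. F k x - f x)) \<longlonglongrightarrow> 0"
    and g: "g \<in> L2_per" "(\<lambda>k. pnrm (\<lambda>x. G k x - g x)) \<longlonglongrightarrow> 0"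
  shows "has_weak_pderiv i f g"
proof -
  have lim: "(\<lambda>k. \<integral>x. F k x * \<phi> x \<partial>lebesgue) \<longlonglongrightarrow> (\<integral>x. f x * \<phi> x \<partial>lebesgue)"
    if \<phi>: "\<phi> \<in> test_functions" and F: "\<And>k. F k \<in> L2_per" and f: "f \<in> L2_per" "(\<lambda>k. pnrm (\<lambda>x. F k x - f x)) \<longlonglongrightarrow> 0"
    for \<phi> f and F :: "nat \<Rightarrow> real ^ 'n \<Rightarrow> real"
  proof -
    obtain C where C: "\<And>f. f \<in> L2_per \<Longrightarrow> \<bar>\<integral>x. f x * \<phi> x \<partial>lebesgue\<bar> \<le> C * pnrm f"
      using test_pairing_bound[OF \<phi>] by blast
    have "(\<lambda>k. (\<integral>x. F k x * \<phi> x \<partial>lebesgue) - (\<integral>x. f x * \<phi> x \<partial>lebesgue)) \<longlonglongrightarrow> 0"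
    proof (rule Lim_null_comparison)
      show "(\<lambda>k. C * pnrm (\<lambda>x. F k x - f x)) \<longlonglongrightarrow> 0" using tendsto_mult_left[OF f(2), of C] by simp
      show "\<forall>\<^sub>F k in sequentially. norm ((\<integral>x. F k x * \<phi> x \<partial>lebesgue) - (\<integral>x. f x * \<phi> x \<partial>lebesgue)) \<le> C * pnrm (\<lambda>x. F k x - f x)"
        using C[OF L2_per_diff[OF F f(1)]] L1_loc_test_integrable[OF L2_per_L1_loc[OF F] \<phi>]
          L1_loc_test_integrable[OF L2_per_L1_loc[OF f(1)] \<phi>]
        by (simp add: left_diff_distrib)
    qed
    then show ?thesis by (simp add: LIM_zero_iff)
  qed
  have "(\<integral>x. f x * pderiv_at i \<phi> x \<partial>lebesgue) = - (\<integral>x. g x * \<phi> x \<partial>lebesgue)" if \<phi>: "\<phi> \<in> test_functions" for \<phi>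
  proof (rule LIMSEQ_unique)
    show "(\<lambda>k. \<integral>x. F k x * pderiv_at i \<phi> x \<partial>lebesgue) \<longlonglongrightarrow> (\<integral>x. f x * pderiv_at i \<phi> x \<partial>lebesgue)"
      by (rule lim[OF test_pderiv[OF \<phi>] F f])
    show "(\<lambda>k. \<integral>x. F k x * pderiv_at i \<phi> x \<partial>lebesgue) \<longlonglongrightarrow> - (\<integral>x. g x * \<phi> x \<partial>lebesgue)"
      using tendsto_minus[OF lim[OF \<phi> G g]] weak_pderiv_test[OF FG \<phi>] by simp
  qed
  then show ?thesis using f g by (simp add: has_weak_pderiv_def L2_per_L1_loc)
qed


section \<open>Difference quotients\<close>

definition Dq :: "'n \<Rightarrow> real \<Rightarrow> (real ^ 'n \<Rightarrow> real) \<Rightarrow> real ^ 'n \<Rightarrow> real" where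
  "Dq i h f x = (f (x + axis i h) - f x) / h"

lemma Dq_alt: "Dq i h f = (\<lambda>x. (1 / h) * (f (x + axis i h) - f x))"
  by (simp add: Dq_def fun_eq_iff)

lemma Dq_L2_per: "f \<in> L2_per \<Longrightarrow> Dq i h f \<in> L2_per"
  unfolding Dq_alt by (intro L2_per_cmult L2_per_diff L2_per_plus)

lemma Dq_weak_pderiv: "has_weak_pderiv j f g \<Longrightarrow> has_weak_pderiv j (Dq i h f) (Dq i h g)"
  unfolding Dq_alt by (intro weak_pderiv_cmult weak_pderiv_diff weak_pderiv_plus)

lemma Dq_H1_per: "f \<in> H1_per \<Longrightarrow> Dq i h f \<in> H1_per"
  unfolding Dq_alt by (intro H1_per_cmult H1_per_diff H1_per_plus)

lemma pip_Dq_right: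
  assumes "f \<in> L2_per" "d \<in> L2_per"
  shows "pip d (Dq i h f) = (pip d (\<lambda>x. f (x + axis i h)) - pip d f) / h"
proof -
  note S = L2_per_sqint[OF L2_per_plus[OF assms(1), of "axis i h"]] L2_per_sqint[OF assms(1)] L2_per_sqint[OF assms(2)]
  show ?thesis
    unfolding Dq_alt using L2.ip_scale_right[OF L2.diff_mem[OF S(1,2)] S(3), of "1 / h"] L2.ip_diff_right[OF S]
    by simp
qed

lemma pip_Dq_adjoint:
  assumes "f \<in> L2_per" "d \<in> L2_per"
  shows "pip d (Dq i h f) = - pip (Dq i (- h) d) f"
proof -
  have "pip (Dq i (- h) d) f = (pip f (\<lambda>x. d (x + axis i (- h))) - pip f d) / (- h)"
    using pip_Dq_right[of d f i "- h"] assms by (simp add: mult.commute)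
  also have "pip f (\<lambda>x. d (x + axis i (- h))) = pip (\<lambda>x. f (x + axis i h)) d"
  proof -
    have ax: "x + axis i (- h) = x - axis i h" for x :: "real ^ 'a" by (simp add: vec_eq_iff axis_def)
    show ?thesis unfolding ax by (rule pip_plus_left[OF assms, symmetric])
  qed
  finally show ?thesis
    using pip_Dq_right[of f d i h] assms by (simp add: mult.commute)
qed

text \<open>As \<phi> vanishes outside the cell, the product over the cell is an integral over the
  whole space, where the translation can be moved onto \<phi>.\<close>

lemma pip_test_translate:
  fixes f :: "real ^ 'n \<Rightarrow> real"
  assumes \<phi>: "\<phi> \<in> test_functions" "\<And>x. x \<notin> Ycell \<Longrightarrow> \<phi> x = 0" and f: "f \<in> L2_per"
  shows "pip \<phi> (\<lambda>x. f (x + axis i t)) = (\<integral>x. f x * \<phi> (x + axis i (- t)) \<partial>lebesgue)"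
proof -
  have "pip \<phi> (\<lambda>x. f (x + axis i t)) = (\<integral>x. f (x + axis i t) * \<phi> x \<partial>lebesgue)"
    using integral_cell_test[OF \<phi>(2), where f = "\<lambda>x. f (x + axis i t)"] by (simp add: mult.commute)
  also have "\<dots> = (\<integral>x. f x * \<phi> (x + axis i (- t)) \<partial>lebesgue)"
  proof -
    have "(\<lambda>x. f x * \<phi> (x + axis i (- t))) \<in> borel_measurable lebesgue"
      by (intro borel_measurable_times L2_per_meas[OF f] test_meas[OF test_plus[OF \<phi>(1)]])
    from integral_lebesgue_plus[OF this, of "axis i t"]
    show ?thesis by (simp add: add.assoc axis_add[symmetric])
  qed
  finally show ?thesis .
qed

text \<open>The derivative at t reduces to the one at 0 by testing with \<phi> shifted by -t; the
  reflection s -> t - s accounts for the translation having moved to the other factor.\<close>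

lemma pip_test_translate_deriv:
  fixes f :: "real ^ 'n \<Rightarrow> real"
  assumes \<phi>: "\<phi> \<in> test_functions" "\<And>x. x \<notin> Ycell \<Longrightarrow> \<phi> x = 0"
    and f: "f \<in> L2_per" and g: "g \<in> L2_per" and fg: "has_weak_pderiv i f g"
  shows "((\<lambda>t. pip \<phi> (\<lambda>x. f (x + axis i t))) has_real_derivative pip \<phi> (\<lambda>x. g (x + axis i t))) (at t)"
proof -
  let ?\<psi> = "\<lambda>x. \<phi> (x + axis i (- t))"
  have \<psi>: "?\<psi> \<in> test_functions" by (rule test_plus[OF \<phi>(1)])
  have "((\<lambda>s. \<integral>x. f x * ?\<psi> (x + axis i s) \<partial>lebesgue) has_real_derivative
      (\<integral>x. f x * pderiv_at i ?\<psi> x \<partial>lebesgue)) (at 0)"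
    by (rule integral_test_deriv[OF L2_per_L1_loc[OF f] \<psi>])
  also have "(\<integral>x. f x * pderiv_at i ?\<psi> x \<partial>lebesgue) = - pip \<phi> (\<lambda>x. g (x + axis i t))"
    using weak_pderiv_test[OF fg \<psi>] pip_test_translate[OF \<phi> g, of i t] by simp
  finally have "((\<lambda>s. \<integral>x. f x * ?\<psi> (x + axis i s) \<partial>lebesgue) has_real_derivative
      - pip \<phi> (\<lambda>x. g (x + axis i t))) (at (t - t))" by simp
  moreover have "((\<lambda>s. t - s) has_real_derivative - 1) (at t)" by (auto intro!: derivative_eq_intros)
  ultimately have "((\<lambda>s. \<integral>x. f x * ?\<psi> (x + axis i (t - s)) \<partial>lebesgue) has_real_derivative
      - pip \<phi> (\<lambda>x. g (x + axis i t)) * - 1) (at t)"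
    using DERIV_chain'[where f = "\<lambda>s. t - s" and g = "\<lambda>s. \<integral>x. f x * ?\<psi> (x + axis i s) \<partial>lebesgue"] by blast
  moreover have "(\<integral>x. f x * ?\<psi> (x + axis i (t - s)) \<partial>lebesgue) = pip \<phi> (\<lambda>x. f (x + axis i s))" for s
    by (simp add: pip_test_translate[OF \<phi> f] add.assoc axis_add[symmetric])
  ultimately show ?thesis by simp
qed

lemma mean_value_at_0:
  assumes "\<And>t. (c has_real_derivative c' t) (at t)" "h \<noteq> 0"
  shows "\<exists>\<xi>. \<bar>\<xi>\<bar> \<le> \<bar>h\<bar> \<and> (c h - c 0) / h = c' \<xi>"
proof (cases "h > 0")
  case True
  then obtain z where "0 < z" "z < h" "c h - c 0 = (h - 0) * c' z"
    using MVT2[of 0 h c c'] assms(1) by blast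
  then show ?thesis by (intro exI[of _ z]) auto
next
  case False
  with assms(2) have "h < 0" by simp
  then obtain z where "h < z" "z < 0" "c 0 - c h = (0 - h) * c' z"
    using MVT2[of h 0 c c'] assms(1) by blast
  then show ?thesis using \<open>h < 0\<close> by (intro exI[of _ z]) (auto simp: field_simps)
qed

text \<open>The weak form of the fact that a difference quotient of \<open>f\<close> is an average of translates of
  its derivative: approximate \<open>d\<close> by test functions and use the mean value theorem for these.\<close>

lemma pip_Dq_estimate:
  fixes f :: "real ^ 'n \<Rightarrow> real"
  assumes d: "d \<in> L2_per" and f: "f \<in> L2_per" and g: "g \<in> L2_per" and fg: "has_weak_pderiv i f g"
    and h: "h \<noteq> 0" and B: "\<And>t. \<bar>t\<bar> \<le> \<bar>h\<bar> \<Longrightarrow> \<bar>pip d (\<lambda>x. g (x + axis i t)) - m\<bar> \<le> B"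
  shows "\<bar>pip d (Dq i h f) - m\<bar> \<le> B"
proof -
  obtain \<phi> where \<phi>: "\<And>k::nat. \<phi> k \<in> test_functions" "\<And>k x. x \<notin> Ycell \<Longrightarrow> \<phi> k x = 0"
    and lim: "(\<lambda>k. pnrm (\<lambda>x. \<phi> k x - d x)) \<longlonglongrightarrow> 0"
    using test_functions_dense[OF L2_per_sqint[OF d]] by blast
  have s: "\<phi> k \<in> sqint cell" "d \<in> sqint cell" "(\<lambda>x. g (x + a)) \<in> sqint cell" "(\<lambda>x. f (x + a)) \<in> sqint cell"
    "f \<in> sqint cell" for k a
    using test_sqint_cell[OF \<phi>(1)] d f g by (auto intro: L2_per_sqint L2_per_plus)
  have bound: "\<bar>pip (\<phi> k) (Dq i h f) - m\<bar> \<le> B + pnrm (\<lambda>x. \<phi> k x - d x) * pnrm g" for k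
  proof -
    have "((\<lambda>t. pip (\<phi> k) (\<lambda>x. f (x + axis i t))) has_real_derivative pip (\<phi> k) (\<lambda>x. g (x + axis i t))) (at t)" for t
      by (rule pip_test_translate_deriv[OF \<phi> f g fg])
    \<comment> \<open>The intermediate point depends on \<open>k\<close> and need not converge.
      Hence \<open>B\<close> has to bound all translates up to \<open>\<bar>h\<bar>\<close>, and the
      error of replacing \<open>d\<close> by \<open>\<phi> k\<close> is estimated uniformly in the
      translate.\<close>
    from mean_value_at_0[OF this h] obtain \<xi> where \<xi>: "\<bar>\<xi>\<bar> \<le> \<bar>h\<bar>"
      and eq: "(pip (\<phi> k) (\<lambda>x. f (x + axis i h)) - pip (\<phi> k) f) / h = pip (\<phi> k) (\<lambda>x. g (x + axis i \<xi>))"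
      by auto
    have "pip (\<phi> k) (Dq i h f) = (pip (\<phi> k) (\<lambda>x. f (x + axis i h)) - pip (\<phi> k) f) / h"
      unfolding Dq_alt using L2.ip_scale_right[OF L2.diff_mem[OF s(4,5)] s(1)] L2.ip_diff_right[OF s(4,5,1)]
      by simp
    moreover have "\<bar>pip (\<lambda>x. \<phi> k x - d x) (\<lambda>x. g (x + axis i \<xi>))\<bar> \<le> pnrm (\<lambda>x. \<phi> k x - d x) * pnrm g"
      using L2.cauchy_schwarz[OF L2.diff_mem[OF s(1,2)] s(3)] by (simp add: pnrm_plus[OF g])
    ultimately show ?thesis using B[OF \<xi>] eq L2.ip_diff[OF s(1,2,3)] by simp
  qed
  show ?thesis
  proof (rule LIMSEQ_le)
    have Dq: "Dq i h f \<in> sqint cell" by (intro L2_per_sqint Dq_L2_per f)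
    show "(\<lambda>k. \<bar>pip (\<phi> k) (Dq i h f) - m\<bar>) \<longlonglongrightarrow> \<bar>pip d (Dq i h f) - m\<bar>"
      by (intro tendsto_intros L2.tendsto_ip s(1,2) Dq lim)
    show "(\<lambda>k. B + pnrm (\<lambda>x. \<phi> k x - d x) * pnrm g) \<longlonglongrightarrow> B"
      using tendsto_add[OF tendsto_const tendsto_mult_right[OF lim, of "pnrm g"], of B] by simp
  qed (use bound in blast)
qed

section \<open>Translations in L2 and convergence of difference quotients\<close>

text \<open>The squared norm of the difference is twice \<open>pip f f - ?p t\<close>, so weak
  continuity at 0 is enough. For that the first factor is replaced by a test function, against which
  translation is even differentiable.\<close>

lemma translation_continuous:
  fixes f :: "real ^ 'n \<Rightarrow> real"
  assumes f: "f \<in> L2_per"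
  shows "((\<lambda>t. pnrm (\<lambda>x. f (x + axis i t) - f x)) \<longlongrightarrow> 0) (at 0)"
proof -
  obtain \<phi> where \<phi>: "\<And>k::nat. \<phi> k \<in> test_functions" "\<And>k x. x \<notin> Ycell \<Longrightarrow> \<phi> k x = 0"
    and lim: "(\<lambda>k. pnrm (\<lambda>x. \<phi> k x - f x)) \<longlonglongrightarrow> 0"
    using test_functions_dense[OF L2_per_sqint[OF f]] by blast
  have s: "\<phi> k \<in> sqint cell" "(\<lambda>x. f (x + a)) \<in> sqint cell" "f \<in> sqint cell" for k a
    using test_sqint_cell[OF \<phi>(1)] f by (auto intro: L2_per_sqint L2_per_plus)
  let ?p = "\<lambda>t. pip f (\<lambda>x. f (x + axis i t))"
  have "(?p \<longlongrightarrow> pip f f) (at 0)"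
  proof (rule tendstoI)
    fix e :: real assume e: "0 < e"
    have lim2: "(\<lambda>k. 2 * (pnrm (\<lambda>x. \<phi> k x - f x) * pnrm f)) \<longlonglongrightarrow> 2 * (0 * pnrm f)"
      by (intro tendsto_intros lim)
    have "\<forall>\<^sub>F k in sequentially. 2 * (pnrm (\<lambda>x. \<phi> k x - f x) * pnrm f) < e / 2"
      using order_tendstoD(2)[OF lim2, of "e / 2"] e by simp
    then obtain k where k: "2 * (pnrm (\<lambda>x. \<phi> k x - f x) * pnrm f) < e / 2"
      by (auto simp: eventually_sequentially)
    have "(\<lambda>t. \<integral>x. f x * \<phi> k (x + axis i t) \<partial>lebesgue) \<midarrow>0\<rightarrow> (\<integral>x. f x * \<phi> k (x + axis i 0) \<partial>lebesgue)"
      using DERIV_isCont[OF integral_test_deriv[OF L2_per_L1_loc[OF f] \<phi>(1)[of k], of i]] by (simp add: isCont_def)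
    moreover have "(\<lambda>t. - t) \<midarrow>0\<rightarrow> (0 :: real)" "\<forall>\<^sub>F t in at 0. - t \<noteq> (0 :: real)"
      using tendsto_minus[OF tendsto_ident_at[of "0::real" UNIV]] by (auto simp: eventually_at_filter)
    ultimately have "(\<lambda>t. \<integral>x. f x * \<phi> k (x + axis i (- t)) \<partial>lebesgue) \<midarrow>0\<rightarrow> (\<integral>x. f x * \<phi> k (x + axis i 0) \<partial>lebesgue)"
      by (rule tendsto_compose_eventually)
    then have "(\<lambda>t. pip (\<phi> k) (\<lambda>x. f (x + axis i t))) \<midarrow>0\<rightarrow> pip (\<phi> k) f"
      using pip_test_translate[OF \<phi> f, of k i] pip_test_translate[OF \<phi> f, of k i 0] by simp
    from tendstoD[OF this, of "e / 2"] e
    have "\<forall>\<^sub>F t in at 0. \<bar>pip (\<phi> k) (\<lambda>x. f (x + axis i t)) - pip (\<phi> k) f\<bar> < e / 2" by (simp add: dist_real_def)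
    then show "\<forall>\<^sub>F t in at 0. dist (?p t) (pip f f) < e"
    proof eventually_elim
      case (elim t)
      have "\<bar>pip (\<lambda>x. \<phi> k x - f x) (\<lambda>x. f (x + a))\<bar> \<le> pnrm (\<lambda>x. \<phi> k x - f x) * pnrm f" for a
        using L2.cauchy_schwarz[OF L2.diff_mem[OF s(1,3)] s(2), of k a] by (simp add: pnrm_plus[OF f])
      from this[of "axis i t"] this[of 0]
      have "\<bar>pip (\<phi> k) (\<lambda>x. f (x + axis i t)) - ?p t\<bar> \<le> pnrm (\<lambda>x. \<phi> k x - f x) * pnrm f"
        "\<bar>pip (\<phi> k) f - pip f f\<bar> \<le> pnrm (\<lambda>x. \<phi> k x - f x) * pnrm f"
        using L2.ip_diff[OF s(1,3,2), of k "axis i t"] L2.ip_diff[OF s(1,3,3), of k] by simp_all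
      then show ?case unfolding dist_real_def using elim k by linarith
    qed
  qed
  then have "((\<lambda>t. sqrt (2 * pip f f - 2 * ?p t)) \<longlongrightarrow> sqrt (2 * pip f f - 2 * pip f f)) (at 0)"
    by (intro tendsto_intros)
  moreover have "pnrm (\<lambda>x. f (x + axis i t) - f x) = sqrt (2 * pip f f - 2 * ?p t)" for t
  proof -
    have com: "pip (\<lambda>x. f (x + axis i t)) f = ?p t" by (simp only: mult.commute)
    have "pip (\<lambda>x. f (x + axis i t) - f x) (\<lambda>x. f (x + axis i t) - f x) = 2 * pip f f - 2 * ?p t"
      unfolding L2.ip_diff[OF s(2,3) L2.diff_mem[OF s(2,3)]] L2.ip_diff_right[OF s(2,3,2)] L2.ip_diff_right[OF s(2,3,3)]
        pip_plus[OF f f] com by linarith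
    then show ?thesis by (simp add: L2.nrm_def)
  qed
  ultimately show ?thesis by simp
qed

lemma translation_modulus:
  fixes f :: "real ^ 'n \<Rightarrow> real"
  assumes f: "f \<in> L2_per" and e: "0 < e"
  obtains r where "r > 0" "\<And>t. \<bar>t\<bar> < r \<Longrightarrow> pnrm (\<lambda>x. f (x + axis i t) - f x) \<le> e"
proof -
  obtain r where r: "r > 0" and less: "\<And>t. t \<noteq> 0 \<Longrightarrow> \<bar>t\<bar> < r \<Longrightarrow> \<bar>pnrm (\<lambda>x. f (x + axis i t) - f x)\<bar> < e"
    using tendstoD[OF translation_continuous[OF f, of i] e] by (auto simp: eventually_at dist_real_def)
  have "pnrm (\<lambda>x. f (x + axis i t) - f x) \<le> e" if "\<bar>t\<bar> < r" for t
    using less[of t] that e by (cases "t = 0") auto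
  with r that show thesis by blast
qed

lemma le_if_square_le: "a * a \<le> a * b \<Longrightarrow> 0 \<le> a \<Longrightarrow> 0 \<le> b \<Longrightarrow> a \<le> b" for a b :: real
  by (cases "a = 0") auto

text \<open>Duality with the error itself: for \<open>?d = Dq i h f - g\<close> the product of
  \<open>?d\<close> with \<open>Dq i h f - g\<close> is the square of its norm, while the estimate
  for difference quotients bounds it by that norm times the modulus of continuity of
  \<open>g\<close>.\<close>

lemma Dq_tendsto:
  fixes f :: "real ^ 'n \<Rightarrow> real"
  assumes f: "f \<in> L2_per" and g: "g \<in> L2_per" and fg: "has_weak_pderiv i f g"
  shows "((\<lambda>h. pnrm (\<lambda>x. Dq i h f x - g x)) \<longlongrightarrow> 0) (at 0)"
proof (rule tendstoI)
  fix e :: real assume e: "0 < e"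
  then obtain r where r: "r > 0" and le: "\<And>t. \<bar>t\<bar> < r \<Longrightarrow> pnrm (\<lambda>x. g (x + axis i t) - g x) \<le> e / 2"
    using translation_modulus[OF g, of "e / 2" i] by (auto simp: half_gt_zero)
  have "pnrm (\<lambda>x. Dq i h f x - g x) \<le> e / 2" if h: "h \<noteq> 0" "\<bar>h\<bar> < r" for h
  proof -
    let ?d = "\<lambda>x. Dq i h f x - g x"
    have d: "?d \<in> L2_per" by (intro L2_per_diff Dq_L2_per f g)
    have "\<bar>pip ?d (Dq i h f) - pip ?d g\<bar> \<le> pnrm ?d * (e / 2)"
    proof (rule pip_Dq_estimate[OF d f g fg h(1)])
      fix t assume t: "\<bar>t\<bar> \<le> \<bar>h\<bar>"
      have "\<bar>pip ?d (\<lambda>x. g (x + axis i t)) - pip ?d g\<bar> = \<bar>pip ?d (\<lambda>x. g (x + axis i t) - g x)\<bar>"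
        by (subst L2.ip_diff_right[OF L2_per_sqint[OF L2_per_plus[OF g]] L2_per_sqint[OF g] L2_per_sqint[OF d]]) (rule refl)
      also have "\<dots> \<le> pnrm ?d * pnrm (\<lambda>x. g (x + axis i t) - g x)"
        by (rule L2.cauchy_schwarz[OF L2_per_sqint[OF d] L2_per_sqint[OF L2_per_diff[OF L2_per_plus[OF g] g]]])
      also have "\<dots> \<le> pnrm ?d * (e / 2)"
        using le[of t] t h d by (intro mult_left_mono) (auto simp: L2_per_sqint)
      finally show "\<bar>pip ?d (\<lambda>x. g (x + axis i t)) - pip ?d g\<bar> \<le> pnrm ?d * (e / 2)" .
    qed
    moreover have "pip ?d (Dq i h f) - pip ?d g = pnrm ?d * pnrm ?d"
      unfolding L2.ip_diff_right[OF L2_per_sqint[OF Dq_L2_per[OF f]] L2_per_sqint[OF g] L2_per_sqint[OF d], symmetric]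
      by (rule L2.nrm_sq[OF L2_per_sqint[OF d], unfolded power2_eq_square, symmetric])
    ultimately have "pnrm ?d * pnrm ?d \<le> pnrm ?d * (e / 2)" by linarith
    then show ?thesis
      by (rule le_if_square_le) (use e L2.nrm_nonneg[OF L2_per_sqint[OF d]] in auto)
  qed
  then show "\<forall>\<^sub>F h in at 0. dist (pnrm (\<lambda>x. Dq i h f x - g x)) 0 < e"
    unfolding eventually_at using r e L2.nrm_nonneg[OF L2_per_sqint[OF L2_per_diff[OF Dq_L2_per[OF f] g]]]
    by (intro exI[of _ r]) (force simp: dist_real_def)
qed

text \<open>The same duality, with the quotient tested against itself and centre 0.\<close>

lemma translation_Lipschitz:
  fixes f :: "real ^ 'n \<Rightarrow> real"
  assumes f: "f \<in> L2_per" and g: "g \<in> L2_per" and fg: "has_weak_pderiv i f g"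
  shows "pnrm (\<lambda>x. f (x + axis i t) - f x) \<le> \<bar>t\<bar> * pnrm g"
proof (cases "t = 0")
  case False
  let ?d = "Dq i t f"
  have d: "?d \<in> L2_per" by (rule Dq_L2_per[OF f])
  have "\<bar>pip ?d ?d - 0\<bar> \<le> pnrm ?d * pnrm g"
  proof (rule pip_Dq_estimate[OF d f g fg False])
    fix s
    show "\<bar>pip ?d (\<lambda>x. g (x + axis i s)) - 0\<bar> \<le> pnrm ?d * pnrm g"
      unfolding diff_0_right pnrm_plus[OF g, of "axis i s", symmetric]
      by (rule L2.cauchy_schwarz[OF L2_per_sqint[OF d] L2_per_sqint[OF L2_per_plus[OF g]]])
  qed
  from order_trans[OF abs_ge_self this[unfolded diff_0_right]]
  have "pnrm ?d * pnrm ?d \<le> pnrm ?d * pnrm g"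
    unfolding L2.nrm_sq[OF L2_per_sqint[OF d], unfolded power2_eq_square] .
  then have "pnrm ?d \<le> pnrm g"
    by (rule le_if_square_le) (rule L2.nrm_nonneg[OF L2_per_sqint], rule d g)+
  moreover have "(\<lambda>x. f (x + axis i t) - f x) = (\<lambda>x. t *\<^sub>R ?d x)"
    using False by (simp add: Dq_def fun_eq_iff)
  ultimately show ?thesis
    using L2.nrm_scale[OF L2_per_sqint[OF d], of t] by (simp add: mult_left_mono)
qed simp

text \<open>The translation is moved from \<open>g\<close> to \<open>d\<close>, so the error
  involves the modulus of continuity of the fixed function \<open>d\<close> and only the norm of
  \<open>g\<close>. This is uniform in \<open>f\<close>, as required where \<open>f\<close> itself
  varies with the step size.\<close>

lemma pip_Dq_near_derivative:
  fixes f :: "real ^ 'n \<Rightarrow> real"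
  assumes d: "d \<in> L2_per" and f: "f \<in> L2_per" and g: "g \<in> L2_per" and fg: "has_weak_pderiv i f g"
    and h: "h \<noteq> 0" and w: "\<And>t. \<bar>t\<bar> \<le> \<bar>h\<bar> \<Longrightarrow> pnrm (\<lambda>x. d (x + axis i t) - d x) \<le> w"
  shows "\<bar>pip d (Dq i h f) - pip d g\<bar> \<le> w * pnrm g"
proof (rule pip_Dq_estimate[OF d f g fg h])
  fix t assume t: "\<bar>t\<bar> \<le> \<bar>h\<bar>"
  have ax: "x - axis i t = x + axis i (- t)" for x :: "real ^ 'n" by (simp add: vec_eq_iff axis_def)
  have "pip d (\<lambda>x. g (x + axis i t)) = pip (\<lambda>x. d (x + axis i (- t))) g"
    using pip_plus_left[OF g d, of "axis i t"] by (simp add: ax mult.commute)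
  then have "\<bar>pip d (\<lambda>x. g (x + axis i t)) - pip d g\<bar> = \<bar>pip (\<lambda>x. d (x + axis i (- t)) - d x) g\<bar>"
    using d g by (subst L2.ip_diff) (auto intro: L2_per_sqint L2_per_plus)
  also have "\<dots> \<le> pnrm (\<lambda>x. d (x + axis i (- t)) - d x) * pnrm g"
    using d g by (intro L2.cauchy_schwarz L2_per_sqint L2_per_diff L2_per_plus)
  also have "\<dots> \<le> w * pnrm g" using w[of "- t"] t g by (intro mult_right_mono) (auto simp: L2_per_sqint)
  finally show "\<bar>pip d (\<lambda>x. g (x + axis i t)) - pip d g\<bar> \<le> w * pnrm g" .
qed

section \<open>Integration by parts for periodic functions\<close>

definition step :: "nat \<Rightarrow> real" where "step k = 1 / real (Suc k)"

lemma step_nz: "step k \<noteq> 0" "- step k \<noteq> 0" and step_lim: "step \<longlonglongrightarrow> 0" "(\<lambda>k. - step k) \<longlonglongrightarrow> 0"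
proof -
  show 1: "step \<longlonglongrightarrow> 0" unfolding step_def by (rule LIMSEQ_Suc[OF lim_const_over_n])
  from tendsto_minus[OF 1] show "(\<lambda>k. - step k) \<longlonglongrightarrow> 0" by simp
qed (simp_all add: step_def)

lemma Dq_seq_tendsto:
  fixes f :: "real ^ 'n \<Rightarrow> real"
  assumes "f \<in> H1_per" "\<And>k. s k \<noteq> 0" "s \<longlonglongrightarrow> (0::real)"
  shows "(\<lambda>k. pnrm (\<lambda>x. Dq i (s k) f x - wpd i f x)) \<longlonglongrightarrow> 0"
proof -
  have "((\<lambda>h. pnrm (\<lambda>x. Dq i h f x - wpd i f x)) \<longlongrightarrow> 0) (at 0)"
    using assms(1) by (intro Dq_tendsto H1_per_L2_per H1_per_wpd_L2_per H1_per_weak_pderiv)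
  moreover have "filterlim s (at 0) sequentially"
    using assms(2,3) by (auto simp: filterlim_at)
  ultimately show ?thesis by (rule filterlim_compose)
qed

text \<open>The limit of \<open>pip_Dq_adjoint\<close>; the steps have opposite signs on the two
  sides. Translation invariance over the cell is what removes boundary terms.\<close>

lemma integration_by_parts:
  assumes f: "f \<in> H1_per" and g: "g \<in> H1_per"
  shows "pip (wpd i f) g = - pip f (wpd i g)"
proof (rule LIMSEQ_unique)
  note L = L2_per_sqint[OF H1_per_L2_per[OF f]] L2_per_sqint[OF H1_per_L2_per[OF g]]
    L2_per_sqint[OF H1_per_wpd_L2_per[OF f]] L2_per_sqint[OF H1_per_wpd_L2_per[OF g]]
    L2_per_sqint[OF Dq_L2_per[OF H1_per_L2_per[OF f]]] L2_per_sqint[OF Dq_L2_per[OF H1_per_L2_per[OF g]]]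
  show "(\<lambda>k. pip (Dq i (step k) f) g) \<longlonglongrightarrow> pip (wpd i f) g"
    by (intro L2.tendsto_ip Dq_seq_tendsto f step_nz step_lim L)
  have "(\<lambda>k. pip (Dq i (- step k) g) f) \<longlonglongrightarrow> pip (wpd i g) f"
    by (intro L2.tendsto_ip Dq_seq_tendsto g step_nz step_lim L)
  then have "(\<lambda>k. - pip (Dq i (- step k) g) f) \<longlonglongrightarrow> - pip f (wpd i g)"
    by (intro tendsto_minus) (simp add: mult.commute)
  moreover have "- pip (Dq i (- step k) g) f = pip (Dq i (step k) f) g" for k
    using pip_Dq_adjoint[of f g i "step k"] f g by (simp add: H1_per_L2_per mult.commute)
  ultimately show "(\<lambda>k. pip (Dq i (step k) f) g) \<longlonglongrightarrow> - pip f (wpd i g)" by simp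
qed

lemma mean_wpd:
  assumes f: "f \<in> H1_per" shows "(\<integral>x. wpd i f x \<partial>cell) = 0"
proof -
  have "pip (wpd i f) (\<lambda>x. 1) = - pip f (wpd i (\<lambda>x. 1))"
    by (rule integration_by_parts[OF f H1_per_const])
  also have "pip f (wpd i (\<lambda>x. 1)) = pip f (\<lambda>x. 0)"
    by (rule pip_wpd_right[OF H1_per_const weak_pderiv_const H1_per_L2_per[OF f]])
  finally show ?thesis by simp
qed

text \<open>Second derivatives do not exist for H1 functions, so one derivative is replaced by a
  difference quotient. The quotient stays in H1 and commutes with weak derivatives, which permits
  integrating by parts before the limit.\<close>

lemma pip_wpd_swap:
  assumes f: "f \<in> H1_per" and g: "g \<in> H1_per"
  shows "pip (wpd i f) (wpd j g) = pip (wpd j f) (wpd i g)"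
proof (rule LIMSEQ_unique)
  note L = L2_per_sqint[OF H1_per_L2_per[OF f]] L2_per_sqint[OF H1_per_L2_per[OF g]]
    L2_per_sqint[OF H1_per_wpd_L2_per[OF f]] L2_per_sqint[OF H1_per_wpd_L2_per[OF g]]
    L2_per_sqint[OF Dq_L2_per[OF H1_per_L2_per[OF f]]] L2_per_sqint[OF Dq_L2_per[OF H1_per_L2_per[OF g]]]
  show "(\<lambda>k. pip (Dq i (step k) f) (wpd j g)) \<longlonglongrightarrow> pip (wpd i f) (wpd j g)"
    by (intro L2.tendsto_ip Dq_seq_tendsto f step_nz step_lim L)
  have "(\<lambda>k. pip (Dq i (- step k) g) (wpd j f)) \<longlonglongrightarrow> pip (wpd i g) (wpd j f)"
    by (intro L2.tendsto_ip Dq_seq_tendsto g step_nz step_lim L)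
  moreover have "pip (Dq i (- step k) g) (wpd j f) = pip (Dq i (step k) f) (wpd j g)" for k
  proof -
    have "pip (Dq i (- step k) g) (wpd j f) = - pip (wpd j (Dq i (- step k) g)) f"
      using integration_by_parts[OF Dq_H1_per[OF g] f, where i = j] by simp
    also have "pip (wpd j (Dq i (- step k) g)) f = pip (Dq i (- step k) (wpd j g)) f"
      by (intro pip_wpd_left Dq_H1_per Dq_weak_pderiv H1_per_weak_pderiv H1_per_L2_per f g)
    also have "- \<dots> = pip (wpd j g) (Dq i (step k) f)"
      by (rule pip_Dq_adjoint[symmetric, OF H1_per_L2_per[OF f] H1_per_wpd_L2_per[OF g]])
    finally show ?thesis by (simp add: mult.commute)
  qed
  ultimately show "(\<lambda>k. pip (Dq i (step k) f) (wpd j g)) \<longlonglongrightarrow> pip (wpd j f) (wpd i g)"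
    by (simp add: mult.commute)
qed

section \<open>The Poincare inequality\<close>

lemma translation_le_sum_axis:
  fixes f :: "real ^ 'n \<Rightarrow> real"
  assumes f: "f \<in> L2_per"
  shows "pnrm (\<lambda>x. f (x + a) - f x) \<le> (\<Sum>i\<in>UNIV. pnrm (\<lambda>x. f (x + axis i (a $ i)) - f x))"
proof -
  have "pnrm (\<lambda>x. f (x + (\<Sum>i\<in>J. axis i (a $ i))) - f x) \<le> (\<Sum>i\<in>J. pnrm (\<lambda>x. f (x + axis i (a $ i)) - f x))" for J
    using finite[of J]
  proof (induction J rule: finite_induct)
    case (insert i J)
    let ?b = "\<Sum>i\<in>J. axis i (a $ i)" let ?c = "axis i (a $ i)"
    have L: "(\<lambda>x. f (x + b)) \<in> sqint cell" "f \<in> sqint cell" for b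
      using f by (auto intro: L2_per_sqint L2_per_plus)
    have "pnrm (\<lambda>x. f (x + (?c + ?b)) - f x) \<le> pnrm (\<lambda>x. f (x + (?c + ?b)) - f (x + ?b)) + pnrm (\<lambda>x. f (x + ?b) - f x)"
      by (rule L2.nrm_triangle3[OF L(1) L(1) L(2)])
    also have "pnrm (\<lambda>x. f (x + (?c + ?b)) - f (x + ?b)) = pnrm (\<lambda>x. f (x + ?c) - f x)"
      using pnrm_plus[OF L2_per_diff[OF L2_per_plus[OF f, of ?c] f], of ?b] by (simp add: ac_simps)
    finally show ?case using insert by simp
  qed simp
  from this[of UNIV] show ?thesis by (simp add: sum_axis)
qed

text \<open>Translations by t and by t - 1 agree, so the shorter way round the circle counts. With t
  in place of the minimum the averaging argument would give the constant n / 6, which exceeds n /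
  pi^2.\<close>

lemma periodic_translation_bound:
  fixes f :: "real ^ 'n \<Rightarrow> real"
  assumes f: "f \<in> H1_per" and t: "0 \<le> t" "t \<le> 1"
  shows "pnrm (\<lambda>x. f (x + axis i t) - f x) \<le> min t (1 - t) * pnrm (wpd i f)"
proof -
  note fL = H1_per_L2_per[OF f]
  have Lip: "pnrm (\<lambda>x. f (x + axis i s) - f x) \<le> \<bar>s\<bar> * pnrm (wpd i f)" for s
    by (rule translation_Lipschitz[OF fL H1_per_wpd_L2_per[OF f] H1_per_weak_pderiv[OF f]])
  have "AE x in lebesgue. f (x + axis i (t - 1) + axis i 1) = f (x + axis i (t - 1))"
    using L2_per_periodic[OF fL] by (intro AE_plus) (simp add: Y_periodic_def)
  then have "AE x in cell. f (x + axis i t) - f x = f (x + axis i (t - 1)) - f x"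
    by (intro AE_cellI, eventually_elim) (simp add: add.assoc axis_add[symmetric])
  then have "pnrm (\<lambda>x. f (x + axis i t) - f x) = pnrm (\<lambda>x. f (x + axis i (t - 1)) - f x)"
    by (rule L2nrm_cong_AE[rotated 2]) (intro sqint_meas L2_per_sqint L2_per_diff L2_per_plus fL)+
  then show ?thesis using Lip[of t] Lip[of "t - 1"] t by (simp add: min_def)
qed

section \<open>Averaging over translates\<close>

lemma middle_half_measure: "(\<integral>x. indicator {x. 1/4 < x $ i \<and> x $ i < 3/4} x \<partial>cell) = (1/2 :: real)"
proof -
  define l u :: "real ^ 'a" where "l = (\<chi> j. if j = i then 1/4 else 0)" and "u = (\<chi> j. if j = i then 3/4 else 1)"
  have set: "{x. 1/4 < x $ i \<and> x $ i < 3/4} \<inter> Ycell = box l u"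
  proof (intro set_eqI iffI)
    fix x assume "x \<in> {x. 1/4 < x $ i \<and> x $ i < 3/4} \<inter> Ycell"
    then show "x \<in> box l u" by (simp add: mem_box_cart Ycell_iff l_def u_def)
  next
    fix x assume "x \<in> box l u"
    then have B: "(if j = i then 1/4 else 0) < x $ j \<and> x $ j < (if j = i then 3/4 else 1)" for j
      by (simp add: mem_box_cart l_def u_def)
    have "0 < x $ j \<and> x $ j < 1" for j using B[of j] by (cases "j = i") auto
    with B[of i] show "x \<in> {x. 1/4 < x $ i \<and> x $ i < 3/4} \<inter> Ycell" by (simp add: Ycell_iff)
  qed
  have le: "l $ j \<le> u $ j" for j by (simp add: l_def u_def)
  have "(\<integral>x. (indicator {x. 1/4 < x $ i \<and> x $ i < 3/4} x :: real) \<partial>cell)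
      = (\<integral>x. indicator Ycell x *\<^sub>R indicator {x. 1/4 < x $ i \<and> x $ i < 3/4} x \<partial>lebesgue)"
    by (rule integral_restrict_space) simp
  also have "\<dots> = (\<integral>x. indicator (box l u) x \<partial>lebesgue)"
    unfolding set[symmetric] by (rule Bochner_Integration.integral_cong) (auto simp: indicator_def)
  also have "\<dots> = measure lebesgue (box l u)" by simp
  also have "\<dots> = measure lborel (cbox l u)"
    by (subst measure_completion) (simp_all add: measure_lborel_box_eq measure_lborel_cbox_eq)
  also have "\<dots> = (\<Prod>j\<in>UNIV. u $ j - l $ j)"
    by (rule content_cbox_cart) (use le in \<open>simp add: interval_ne_empty_cart\<close>)
  also have "\<dots> = (\<Prod>j\<in>UNIV. if j = i then 1/2 else 1)"
    by (rule prod.cong) (auto simp: l_def u_def)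
  finally show ?thesis by simp
qed

text \<open>Fubini's theorem is applied to (x, a) -> g (x + a), whose joint measurability comes from
  Borel measurability of \<open>g\<close>; this transfers the resulting integrals back to
  \<open>cell\<close>.\<close>

lemma integral_lborel_cell:
  fixes h :: "real ^ 'n \<Rightarrow> real"
  assumes h: "h \<in> borel_measurable borel"
  shows "integral\<^sup>L (restrict_space lborel Ycell) h = integral\<^sup>L cell h"
    and "integrable (restrict_space lborel Ycell) h \<longleftrightarrow> integrable cell h"
proof -
  have Y [measurable]: "Ycell \<in> sets borel" by (simp add: Ycell_def)
  have [measurable]: "(\<lambda>x. indicator Ycell x *\<^sub>R h x) \<in> borel_measurable lborel" using h by measurable
  show "integral\<^sup>L (restrict_space lborel Ycell) h = integral\<^sup>L cell h"
    by (simp add: integral_restrict_space integral_completion del: real_scaleR_def)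
  show "integrable (restrict_space lborel Ycell) h \<longleftrightarrow> integrable cell h"
    by (simp add: integrable_restrict_space integrable_completion set_integrable_def del: real_scaleR_def)
qed

text \<open>After exchanging the integrals the inner one is the mean of a translate of
  \<open>g\<close>, which by periodicity is the mean of \<open>g\<close> whatever the
  translation.\<close>

lemma average_autocorrelation:
  fixes g :: "real ^ 'n \<Rightarrow> real"
  assumes g: "g \<in> borel_measurable borel" "g \<in> L2_per"
  shows "integrable cell (\<lambda>a. pip g (\<lambda>x. g (x + a)))"
    and "(\<integral>a. pip g (\<lambda>x. g (x + a)) \<partial>cell) = (integral\<^sup>L cell g)\<^sup>2"
proof -
  define C :: "(real ^ 'n) measure" where "C = restrict_space lborel Ycell"
  have Y [measurable]: "Ycell \<in> sets borel" by (simp add: Ycell_def)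
  have C_int: "integral\<^sup>L C h = integral\<^sup>L cell h" and C_able: "integrable C h \<longleftrightarrow> integrable cell h"
    if "h \<in> borel_measurable borel" for h :: "real ^ 'n \<Rightarrow> real"
    unfolding C_def using integral_lborel_cell[OF that] by auto
  interpret C: finite_measure C
  proof
    have "emeasure C (space C) = emeasure lebesgue (Ycell :: (real ^ 'n) set)"
      by (simp add: C_def space_restrict_space emeasure_restrict_space Ycell_def)
    then show "emeasure C (space C) \<noteq> \<infinity>" by (simp add: emeasure_Ycell)
  qed
  interpret P: pair_sigma_finite C C by standard
  have id [measurable]: "(\<lambda>x. x) \<in> C \<rightarrow>\<^sub>M borel" unfolding C_def by (rule measurable_restrict_space1) simp
  note [measurable] = g(1)
  have fs: "fst \<in> C \<Otimes>\<^sub>M C \<rightarrow>\<^sub>M borel" "snd \<in> C \<Otimes>\<^sub>M C \<rightarrow>\<^sub>M borel"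
    using measurable_compose[OF measurable_fst id] measurable_compose[OF measurable_snd id] by auto
  have meas: "(\<lambda>(x, a). g x * g (x + a)) \<in> borel_measurable (C \<Otimes>\<^sub>M C)"
    unfolding split_beta
    by (intro borel_measurable_times measurable_compose[OF fs(1) g(1)]
        measurable_compose[OF borel_measurable_add[OF fs] g(1)])
  have sec: "(\<lambda>a. g (x + a)) \<in> L2_per" for x
    using L2_per_plus[OF g(2), of x] by (simp add: add.commute)
  have sec_int: "integrable cell (\<lambda>a. g x * g (x + a))" for x
    using cell.sqint_integrable[OF L2_per_sqint[OF sec, of x]] by simp
  have bm: "(\<lambda>a. g x * g (x + a)) \<in> borel_measurable borel" "(\<lambda>a. \<bar>g x * g (x + a)\<bar>) \<in> borel_measurable borel" for x
    by measurable
  have absg: "(\<lambda>x. \<bar>g x\<bar>) \<in> L2_per"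
    using g(2) by (auto simp: L2_per_iff sqint_def intro: Y_periodic_comp[where h = abs] borel_measurable_abs)
  have int: "integrable (C \<Otimes>\<^sub>M C) (\<lambda>(x, a). g x * g (x + a))"
  proof (rule P.Fubini_integrable[OF meas])
    show "AE x in C. integrable C (\<lambda>a. case (x, a) of (x, a) \<Rightarrow> g x * g (x + a))"
    proof (rule AE_I2)
      fix x
      show "integrable C (\<lambda>a. case (x, a) of (x, a) \<Rightarrow> g x * g (x + a))"
        unfolding prod.case by (rule C_able[OF bm(1), THEN iffD2, OF sec_int])
    qed
    have "(\<integral>a. norm (case (x, a) of (x, a) \<Rightarrow> g x * g (x + a)) \<partial>C) = \<bar>g x\<bar> * (\<integral>a. \<bar>g a\<bar> \<partial>cell)" for x
    proof -
      have "(\<integral>a. norm (case (x, a) of (x, a) \<Rightarrow> g x * g (x + a)) \<partial>C) = (\<integral>a. \<bar>g x * g (x + a)\<bar> \<partial>cell)"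
        unfolding prod.case real_norm_def by (rule C_int[OF bm(2)])
      also have "\<dots> = (\<integral>a. \<bar>g x\<bar> * \<bar>g (a + x)\<bar> \<partial>cell)" by (simp only: abs_mult add.commute)
      also have "\<dots> = \<bar>g x\<bar> * (\<integral>a. \<bar>g a\<bar> \<partial>cell)" using mean_plus[OF absg] by simp
      finally show ?thesis .
    qed
    moreover have "integrable C (\<lambda>x. \<bar>g x\<bar> * (\<integral>a. \<bar>g a\<bar> \<partial>cell))"
      using cell.sqint_integrable[OF L2_per_sqint[OF absg]] by (simp add: C_able)
    ultimately show "integrable C (\<lambda>x. \<integral>a. norm (case (x, a) of (x, a) \<Rightarrow> g x * g (x + a)) \<partial>C)" by simp
  qed
  have inner: "(\<integral>x. g x * g (x + a) \<partial>C) = pip g (\<lambda>x. g (x + a))" for a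
    by (rule C_int) measurable
  have outer: "(\<lambda>a. pip g (\<lambda>x. g (x + a))) \<in> borel_measurable borel"
  proof -
    have "(\<lambda>a. \<integral>x. g x * g (x + a) \<partial>C) \<in> borel_measurable borel"
    proof (rule C.borel_measurable_lebesgue_integral)
      have sn: "snd \<in> borel \<Otimes>\<^sub>M C \<rightarrow>\<^sub>M borel" by (rule measurable_compose[OF measurable_snd id])
      show "(\<lambda>(a, x). g x * g (x + a)) \<in> borel_measurable (borel \<Otimes>\<^sub>M C)"
        unfolding split_beta
        by (intro borel_measurable_times measurable_compose[OF sn g(1)]
            measurable_compose[OF borel_measurable_add[OF sn measurable_fst] g(1)])
    qed
    then show ?thesis by (simp add: inner)
  qed
  show "integrable cell (\<lambda>a. pip g (\<lambda>x. g (x + a)))"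
    using P.integrable_snd[of "\<lambda>x a. g x * g (x + a)"] int C_able[OF outer] by (simp add: inner)
  have "(\<integral>a. pip g (\<lambda>x. g (x + a)) \<partial>cell) = (\<integral>a. \<integral>x. g x * g (x + a) \<partial>C \<partial>C)"
    using C_int[OF outer] by (simp add: inner)
  also have "\<dots> = (\<integral>x. \<integral>a. g x * g (x + a) \<partial>C \<partial>C)"
    by (rule P.Fubini_integral[OF int])
  also have "\<dots> = (\<integral>x. g x * integral\<^sup>L cell g \<partial>C)"
  proof (rule Bochner_Integration.integral_cong)
    fix x
    show "(\<integral>a. g x * g (x + a) \<partial>C) = g x * integral\<^sup>L cell g"
      using C_int[OF bm(1)[of x]] mean_plus[OF g(2), of x] by (simp add: add.commute)
  qed simp
  also have "\<dots> = (integral\<^sup>L cell g)\<^sup>2" using C_int[OF g(1)] by (simp add: power2_eq_square)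
  finally show "(\<integral>a. pip g (\<lambda>x. g (x + a)) \<partial>cell) = (integral\<^sup>L cell g)\<^sup>2" .
qed

text \<open>A mean zero function satisfies \<open>2 * \<parallel>f\<parallel>\<^sup>2 = \<integral> \<parallel>f (\<cdot> + a) - f\<parallel>\<^sup>2 da\<close>, and the translates are controlled
  by the gradient. The constant only has to be smaller than \<open>n / pi\<^sup>2\<close>, which allows the crude bound
  \<open>(min t (1 - t))\<^sup>2 \<le> 1 / 16\<close> off the middle half.\<close>

lemma poincare:
  fixes f :: "real ^ 'n \<Rightarrow> real"
  assumes f: "f \<in> H1_per" and mean: "integral\<^sup>L cell f = 0"
  shows "(pnrm f)\<^sup>2 \<le> 5 / 64 * real CARD('n) * (\<Sum>i\<in>UNIV. (pnrm (wpd i f))\<^sup>2)"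
proof -
  note fL = H1_per_L2_per[OF f]
  obtain g where g: "g \<in> borel_measurable borel" and ae: "AE x in lborel. f x = g x"
    using completion_ex_borel_measurable_real[OF L2_per_meas[OF fL]] by auto
  have ae': "AE x in lebesgue. f x = g x" using ae by (rule AE_completion)
  have gm: "g \<in> borel_measurable lebesgue" using g by (simp add: measurable_completion)
  have gL: "g \<in> L2_per" by (rule L2_per_cong_AE[OF fL gm ae'])
  let ?P = "\<Sum>i\<in>UNIV. (pnrm (wpd i f))\<^sup>2"
  \<comment> \<open>Each summand dominates (min t (1 - t))^2: it is 1/4 on the middle half and 1/16
    elsewhere. Its mean is 1/16 + 3/32 = 5/32, and halving produces the constant 5 n / 64.\<close>
  define q :: "real ^ 'n \<Rightarrow> real"
    where "q x = (\<Sum>i\<in>UNIV. 1 / 16 + 3 / 16 * indicator {x. 1/4 < x $ i \<and> x $ i < 3/4} x)" for x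
  have G: "2 * (pnrm f)\<^sup>2 - 2 * pip g (\<lambda>x. g (x + a)) \<le> q a * ?P" if a: "a \<in> Ycell" for a
  proof -
    have L: "(\<lambda>x. g (x + b)) \<in> sqint cell" "g \<in> sqint cell" for b
      using gL by (auto intro: L2_per_sqint L2_per_plus)
    have D: "(\<lambda>x. g (x + a) - g x) \<in> sqint cell" by (rule L2.diff_mem[OF L])
    have com: "pip (\<lambda>x. g (x + a)) g = pip g (\<lambda>x. g (x + a))" by (simp only: mult.commute)
    have "2 * (pnrm g)\<^sup>2 - 2 * pip g (\<lambda>x. g (x + a)) = (pnrm (\<lambda>x. g (x + a) - g x))\<^sup>2"
      unfolding L2.nrm_sq[OF L(2)] L2.nrm_sq[OF D] L2.ip_diff[OF L D] L2.ip_diff_right[OF L L(1)]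
        L2.ip_diff_right[OF L L(2)] pip_plus[OF gL gL] com by linarith
    also have "pnrm g = pnrm f"
      by (rule L2nrm_cong_AE) (use AE_cellI[OF ae'] gm L2_per_meas[OF fL] in \<open>auto intro: cell_measurable elim: eventually_mono\<close>)
    also have "pnrm (\<lambda>x. g (x + a) - g x) = pnrm (\<lambda>x. f (x + a) - f x)"
    proof (rule L2nrm_cong_AE)
      show "AE x in cell. g (x + a) - g x = f (x + a) - f x"
        using AE_cellI[OF AE_plus[OF ae', of a]] AE_cellI[OF ae'] by eventually_elim simp
    qed (use D L2.diff_mem[OF L2_per_sqint[OF L2_per_plus[OF fL]] L2_per_sqint[OF fL]] in \<open>auto intro: sqint_meas\<close>)
    also have "(pnrm (\<lambda>x. f (x + a) - f x))\<^sup>2 \<le> q a * ?P"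
    proof -
      define m where "m i = min (a $ i) (1 - a $ i)" for i
      have a01: "0 < a $ i" "a $ i < 1" for i using a by (auto simp: Ycell_iff)
      have m0: "0 \<le> m i" "m i \<le> 1/2" for i using a01[of i] by (auto simp: m_def min_def)
      have "pnrm (\<lambda>x. f (x + a) - f x) \<le> (\<Sum>i\<in>UNIV. pnrm (\<lambda>x. f (x + axis i (a $ i)) - f x))"
        by (rule translation_le_sum_axis[OF fL])
      also have "\<dots> \<le> (\<Sum>i\<in>UNIV. m i * pnrm (wpd i f))"
        unfolding m_def using a01 by (intro sum_mono periodic_translation_bound f) (auto simp: less_imp_le)
      finally have "(pnrm (\<lambda>x. f (x + a) - f x))\<^sup>2 \<le> (\<Sum>i\<in>UNIV. m i * pnrm (wpd i f))\<^sup>2"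
        by (rule power_mono) (rule L2.nrm_nonneg[OF L2.diff_mem[OF L2_per_sqint[OF L2_per_plus[OF fL]] L2_per_sqint[OF fL]]])
      also have "\<dots> \<le> (\<Sum>i\<in>UNIV. (m i)\<^sup>2) * ?P"
        by (rule Cauchy_Schwarz_ineq_sum)
      also have "(\<Sum>i\<in>UNIV. (m i)\<^sup>2) \<le> q a"
        unfolding q_def
      proof (rule sum_mono)
        fix i
        show "(m i)\<^sup>2 \<le> 1 / 16 + 3 / 16 * indicator {x. 1/4 < x $ i \<and> x $ i < 3/4} a"
        proof (cases "1/4 < a $ i \<and> a $ i < 3/4")
          case True
          have "(m i)\<^sup>2 \<le> (1/2)\<^sup>2" using m0 by (intro power_mono) auto
          then show ?thesis using True by (simp add: power2_eq_square)
        next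
          case False
          then have "m i \<le> 1/4" by (auto simp: m_def min_def)
          then have "(m i)\<^sup>2 \<le> (1/4)\<^sup>2" using m0 by (intro power_mono) auto
          then show ?thesis using False by (simp add: power2_eq_square)
        qed
      qed
      finally show ?thesis by (simp add: mult_right_mono sum_nonneg)
    qed
    finally show ?thesis .
  qed
  note av = average_autocorrelation[OF g gL]
  have one: "integral\<^sup>L cell (\<lambda>x. 1) = (1 :: real)" by (simp add: space_cell)
  have meang: "integral\<^sup>L cell g = 0"
  proof -
    have "integral\<^sup>L cell g = integral\<^sup>L cell f"
      by (rule integral_cong_AE) (use AE_cellI[OF ae'] gm L2_per_meas[OF fL] in \<open>auto intro: cell_measurable elim: eventually_mono\<close>)
    then show ?thesis using mean by simp
  qed
  have ind: "integrable cell (indicator {x. 1/4 < x $ i \<and> x $ i < 3/4} :: real ^ 'n \<Rightarrow> real)" for i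
  proof -
    have "{x :: real ^ 'n. 1/4 < x $ i \<and> x $ i < 3/4} \<in> sets borel" by measurable
    then have "(indicator {x. 1/4 < x $ i \<and> x $ i < 3/4} :: real ^ 'n \<Rightarrow> real) \<in> borel_measurable lebesgue"
      by (intro measurable_completion borel_measurable_indicator) simp
    then show ?thesis
      by (intro cell.integrable_const_bound[where B = 1] cell_measurable) (auto simp: indicator_def)
  qed
  have qint: "integrable cell q" unfolding q_def using ind by (intro Bochner_Integration.integrable_sum) auto
  have qval: "integral\<^sup>L cell q = 5 / 32 * real CARD('n)"
  proof -
    have int: "integrable cell (\<lambda>x. 1 / 16 :: real)" "integrable cell (\<lambda>x. 3 / 16 * indicator {x. 1/4 < x $ i \<and> x $ i < 3/4} x :: real)" for i :: 'n
      by (rule cell.sqint_integrable[OF cell.sqint_const], rule integrable_mult_right[OF ind])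
    have "(\<integral>x. 1 / 16 + 3 / 16 * indicator {x. 1/4 < x $ i \<and> x $ i < 3/4} x \<partial>cell) = (5 / 32 :: real)" for i :: 'n
      unfolding Bochner_Integration.integral_add[OF int] integral_mult_right_zero middle_half_measure
      by (simp add: space_cell)
    moreover have "integral\<^sup>L cell q = (\<Sum>i\<in>(UNIV :: 'n set). \<integral>x. 1 / 16 + 3 / 16 * indicator {x. 1/4 < x $ i \<and> x $ i < 3/4} x \<partial>cell)"
      unfolding q_def by (rule Bochner_Integration.integral_sum) (intro Bochner_Integration.integrable_add int)
    ultimately have "integral\<^sup>L cell q = (\<Sum>i\<in>(UNIV :: 'n set). 5 / 32)" by (simp only:)
    then show ?thesis by simp
  qed
  have "(\<integral>a. 2 * (pnrm f)\<^sup>2 - 2 * pip g (\<lambda>x. g (x + a)) \<partial>cell) \<le> (\<integral>a. q a * ?P \<partial>cell)"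
  proof (rule integral_mono_AE)
    show "integrable cell (\<lambda>a. 2 * (pnrm f)\<^sup>2 - 2 * pip g (\<lambda>x. g (x + a)))"
      by (intro Bochner_Integration.integrable_diff integrable_mult_right av(1)) simp
    show "integrable cell (\<lambda>a. q a * ?P)" using qint by simp
    show "AE a in cell. 2 * (pnrm f)\<^sup>2 - 2 * pip g (\<lambda>x. g (x + a)) \<le> q a * ?P"
      unfolding AE_cell using G by simp
  qed
  also have "(\<integral>a. 2 * (pnrm f)\<^sup>2 - 2 * pip g (\<lambda>x. g (x + a)) \<partial>cell) = 2 * (pnrm f)\<^sup>2"
    using av meang by (simp add: space_cell)
  also have "(\<integral>a. q a * ?P \<partial>cell) = 5 / 32 * real CARD('n) * ?P"
    by (simp add: qval)
  finally show ?thesis by simp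
qed

section \<open>Mean zero periodic functions as a Hilbert space\<close>

definition H1_per0 :: "(real ^ 'n \<Rightarrow> real) set" where
  "H1_per0 = {f \<in> H1_per. integral\<^sup>L cell f = 0}"

definition grad_ip :: "(real ^ 'n \<Rightarrow> real) \<Rightarrow> (real ^ 'n \<Rightarrow> real) \<Rightarrow> real" where
  "grad_ip f g = (\<Sum>i\<in>UNIV. pip (wpd i f) (wpd i g))"

lemma H1_per0_H1_per: "f \<in> H1_per0 \<Longrightarrow> f \<in> H1_per"
  and H1_per0_mean: "f \<in> H1_per0 \<Longrightarrow> integral\<^sup>L cell f = 0"
  by (auto simp: H1_per0_def)

lemma H1_per_integrable: "f \<in> H1_per \<Longrightarrow> integrable cell f"
  by (intro cell.sqint_integrable L2_per_sqint H1_per_L2_per)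

lemma H1_per0_add: "f \<in> H1_per0 \<Longrightarrow> g \<in> H1_per0 \<Longrightarrow> (\<lambda>x. f x + g x) \<in> H1_per0"
  by (auto simp: H1_per0_def H1_per_add H1_per_integrable)

lemma H1_per0_diff: "f \<in> H1_per0 \<Longrightarrow> g \<in> H1_per0 \<Longrightarrow> (\<lambda>x. f x - g x) \<in> H1_per0"
  by (auto simp: H1_per0_def H1_per_diff H1_per_integrable)

lemma H1_per0_cmult: "f \<in> H1_per0 \<Longrightarrow> (\<lambda>x. c * f x) \<in> H1_per0"
  by (auto simp: H1_per0_def H1_per_cmult H1_per_integrable)

lemma H1_per0_zero: "(\<lambda>x. 0) \<in> H1_per0"
  by (simp add: H1_per0_def H1_per_const)

lemma pip_wpd_add:
  assumes "f \<in> H1_per" "g \<in> H1_per" "d \<in> L2_per"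
  shows "pip (wpd i (\<lambda>x. f x + g x)) d = pip (wpd i f) d + pip (wpd i g) d"
  using assms
  by (simp add: pip_wpd_left[OF H1_per_add weak_pderiv_add[OF H1_per_weak_pderiv H1_per_weak_pderiv]]
      L2.ip_add L2_per_sqint H1_per_wpd_L2_per)

lemma pip_wpd_cmult:
  assumes "f \<in> H1_per" "d \<in> L2_per"
  shows "pip (wpd i (\<lambda>x. c * f x)) d = c * pip (wpd i f) d"
  using assms
  by (simp add: pip_wpd_left[OF H1_per_cmult weak_pderiv_cmult[OF H1_per_weak_pderiv]] mult.assoc)

lemma pnrm_wpd_diff:
  assumes "f \<in> H1_per" "g \<in> H1_per"
  shows "pnrm (wpd i (\<lambda>x. f x - g x)) = pnrm (\<lambda>x. wpd i f x - wpd i g x)"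
  using assms by (intro pnrm_wpd H1_per_diff weak_pderiv_diff H1_per_weak_pderiv)

lemma semi_inner_H1_per0: "semi_inner (H1_per0 :: (real ^ 'n \<Rightarrow> real) set) grad_ip"
proof
  fix f g h :: "real ^ 'n \<Rightarrow> real" and c :: real
  assume f: "f \<in> H1_per0"
  show "(\<lambda>t. c *\<^sub>R f t) \<in> H1_per0" using f by (simp add: H1_per0_cmult)
  show "0 \<le> grad_ip f f" unfolding grad_ip_def by (intro sum_nonneg) simp
  assume g: "g \<in> H1_per0"
  show "(\<lambda>t. f t + g t) \<in> H1_per0" using f g by (rule H1_per0_add)
  show "grad_ip f g = grad_ip g f" by (simp add: grad_ip_def mult.commute)
  show "grad_ip (\<lambda>t. c *\<^sub>R f t) g = c * grad_ip f g"
    using f g by (simp add: grad_ip_def pip_wpd_cmult H1_per0_H1_per H1_per_wpd_L2_per sum_distrib_left)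
  assume h: "h \<in> H1_per0"
  show "grad_ip (\<lambda>t. f t + g t) h = grad_ip f h + grad_ip g h"
    using f g h by (simp add: grad_ip_def pip_wpd_add H1_per0_H1_per H1_per_wpd_L2_per sum.distrib)
qed (rule H1_per0_zero)

interpretation H0: semi_inner "H1_per0 :: (real ^ 'n \<Rightarrow> real) set" grad_ip
  by (rule semi_inner_H1_per0)

lemma H0_nrm_sq: "f \<in> H1_per \<Longrightarrow> (H0.nrm f)\<^sup>2 = (\<Sum>i\<in>UNIV. (pnrm (wpd i f))\<^sup>2)"
  unfolding H0.nrm_def grad_ip_def
  by (subst real_sqrt_pow2) (auto intro!: sum_nonneg sum.cong simp: L2.nrm_sq L2_per_sqint H1_per_wpd_L2_per)

lemma pnrm_wpd_le: assumes "f \<in> H1_per0" shows "pnrm (wpd i f) \<le> H0.nrm f"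
proof (rule power2_le_imp_le)
  show "(pnrm (wpd i f))\<^sup>2 \<le> (H0.nrm f)\<^sup>2"
    unfolding H0_nrm_sq[OF H1_per0_H1_per[OF assms]] by (rule member_le_sum) auto
qed (use assms in simp)

definition poincare_const :: "'n itself \<Rightarrow> real" where
  "poincare_const _ = 5 / 64 * real CARD('n)"

lemma pnrm_le_H0_nrm:
  fixes f :: "real ^ 'n \<Rightarrow> real"
  assumes "f \<in> H1_per0" shows "(pnrm f)\<^sup>2 \<le> poincare_const TYPE('n) * (H0.nrm f)\<^sup>2"
  using poincare[of f] assms by (simp add: H1_per0_def H0_nrm_sq poincare_const_def)

lemma pnrm_le_sqrt:
  fixes f :: "real ^ 'n \<Rightarrow> real"
  assumes "f \<in> H1_per0" shows "pnrm f \<le> sqrt (poincare_const TYPE('n)) * H0.nrm f"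
proof (rule power2_le_imp_le)
  show "(pnrm f)\<^sup>2 \<le> (sqrt (poincare_const TYPE('n)) * H0.nrm f)\<^sup>2"
    using pnrm_le_H0_nrm[OF assms] by (simp add: power_mult_distrib poincare_const_def)
qed (use assms in \<open>simp add: poincare_const_def\<close>)

lemma pnrm_tendsto_0_if_H0:
  fixes f :: "nat \<Rightarrow> real ^ 'n \<Rightarrow> real"
  assumes "\<And>k. f k \<in> H1_per0" "(\<lambda>k. H0.nrm (f k)) \<longlonglongrightarrow> 0"
  shows "(\<lambda>k. pnrm (f k)) \<longlonglongrightarrow> 0"
proof (rule tendsto_sandwich[OF _ _ tendsto_const])
  show "\<forall>\<^sub>F k in sequentially. pnrm (f k) \<le> sqrt (poincare_const TYPE('n)) * H0.nrm (f k)"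
    using pnrm_le_sqrt[OF assms(1)] by simp
  show "(\<lambda>k. sqrt (poincare_const TYPE('n)) * H0.nrm (f k)) \<longlonglongrightarrow> 0"
    using tendsto_mult_left[OF assms(2), of "sqrt (poincare_const TYPE('n))"] by simp
  show "\<forall>\<^sub>F k in sequentially. 0 \<le> pnrm (f k)"
    using L2.nrm_nonneg[OF L2_per_sqint[OF H1_per_L2_per[OF H1_per0_H1_per[OF assms(1)]]]] by simp
qed

text \<open>The Poincare inequality turns Cauchy in the gradient into Cauchy in L2. The function and
  each derivative converge separately, closedness of the weak derivative matches the limits, and the
  mean is continuous.\<close>

lemma semi_hilbert_H1_per0: "semi_hilbert (H1_per0 :: (real ^ 'n \<Rightarrow> real) set) grad_ip"
proof
  fix f :: "nat \<Rightarrow> real ^ 'n \<Rightarrow> real"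
  assume f: "\<And>k. f k \<in> H1_per0" and C: "H0.nrm_Cauchy f"
  note fH = H1_per0_H1_per[OF f] note fL = H1_per_L2_per[OF fH] note wL = H1_per_wpd_L2_per[OF fH]
  let ?c = "sqrt (poincare_const TYPE('n))"
  have c: "0 \<le> ?c" by (simp add: poincare_const_def)
  have "L2.nrm_Cauchy cell f"
    unfolding L2.nrm_Cauchy_def
  proof (intro allI impI)
    fix e :: real assume e: "0 < e"
    have "0 < e / (?c + 1)" using e c by (intro divide_pos_pos add_nonneg_pos) auto
    then obtain N where N: "\<And>m n. m \<ge> N \<Longrightarrow> n \<ge> N \<Longrightarrow> H0.nrm (\<lambda>x. f m x - f n x) < e / (?c + 1)"
      using C unfolding H0.nrm_Cauchy_def by meson
    have "pnrm (\<lambda>x. f m x - f n x) < e" if "m \<ge> N" "n \<ge> N" for m n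
    proof -
      have "pnrm (\<lambda>x. f m x - f n x) \<le> ?c * H0.nrm (\<lambda>x. f m x - f n x)"
        by (rule pnrm_le_sqrt[OF H1_per0_diff[OF f f]])
      also have "\<dots> \<le> ?c * (e / (?c + 1))" using N[OF that] c by (intro mult_left_mono) auto
      also have "\<dots> < e"
      proof -
        have "?c * e < e * (?c + 1)" using e by (simp add: algebra_simps)
        moreover have "0 < ?c + 1" using c by linarith
        ultimately show ?thesis by (simp add: pos_divide_less_eq)
      qed
      finally show ?thesis .
    qed
    then show "\<exists>N. \<forall>m\<ge>N. \<forall>n\<ge>N. pnrm (\<lambda>x. f m x - f n x) < e" by blast
  qed
  from L2_per_complete[OF fL this] obtain l where l: "l \<in> L2_per" and lim: "(\<lambda>k. pnrm (\<lambda>x. f k x - l x)) \<longlonglongrightarrow> 0"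
    by blast
  have "\<exists>g\<in>L2_per. (\<lambda>k. pnrm (\<lambda>x. wpd i (f k) x - g x)) \<longlonglongrightarrow> 0" for i
  proof (rule L2_per_complete[OF wL])
    have "pnrm (\<lambda>x. wpd i (f m) x - wpd i (f n) x) \<le> H0.nrm (\<lambda>x. f m x - f n x)" for m n
      using pnrm_wpd_le[OF H1_per0_diff[OF f f], of i m n] by (simp add: pnrm_wpd_diff fH)
    then show "L2.nrm_Cauchy cell (\<lambda>k. wpd i (f k))"
      using C unfolding L2.nrm_Cauchy_def H0.nrm_Cauchy_def by (meson le_less_trans)
  qed
  then have "\<forall>i. \<exists>g. g \<in> L2_per \<and> (\<lambda>k. pnrm (\<lambda>x. wpd i (f k) x - g x)) \<longlonglongrightarrow> 0" by blast
  from choice[OF this] obtain g where g: "\<And>i. g i \<in> L2_per"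
    and glim: "\<And>i. (\<lambda>k. pnrm (\<lambda>x. wpd i (f k) x - g i x)) \<longlonglongrightarrow> 0" by blast
  have lg: "has_weak_pderiv i l (g i)" for i
    by (rule weak_pderiv_limit[OF fL wL H1_per_weak_pderiv[OF fH] l lim g glim])
  have lH: "l \<in> H1_per" by (rule H1_perI[OF l g lg])
  have "(\<lambda>k. pip (f k) (\<lambda>x. 1)) \<longlonglongrightarrow> pip l (\<lambda>x. 1)"
    by (rule L2.tendsto_ip[OF L2_per_sqint[OF fL] L2_per_sqint[OF l] cell.sqint_const lim])
  then have "(\<lambda>k. 0) \<longlonglongrightarrow> integral\<^sup>L cell l" using H1_per0_mean[OF f] by simp
  then have "integral\<^sup>L cell l = 0" by (simp add: LIMSEQ_const_iff)
  with lH have lH0: "l \<in> H1_per0" by (simp add: H1_per0_def)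
  have eq: "(H0.nrm (\<lambda>x. f k x - l x))\<^sup>2 = (\<Sum>i\<in>UNIV. (pnrm (\<lambda>x. wpd i (f k) x - g i x))\<^sup>2)" for k
    unfolding H0_nrm_sq[OF H1_per_diff[OF fH lH]]
    by (intro sum.cong refl arg_cong[where f = "\<lambda>y. y\<^sup>2"] pnrm_wpd H1_per_diff fH lH weak_pderiv_diff H1_per_weak_pderiv lg)
  have "(\<lambda>k. (H0.nrm (\<lambda>x. f k x - l x))\<^sup>2) \<longlonglongrightarrow> (\<Sum>i\<in>(UNIV :: 'n set). 0\<^sup>2)"
    unfolding eq by (intro tendsto_intros glim)
  then have "(\<lambda>k. sqrt ((H0.nrm (\<lambda>x. f k x - l x))\<^sup>2)) \<longlonglongrightarrow> sqrt 0"
    by (intro tendsto_real_sqrt) simp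
  then have "(\<lambda>k. H0.nrm (\<lambda>x. f k x - l x)) \<longlonglongrightarrow> 0"
    using H0.nrm_nonneg[OF H1_per0_diff[OF f lH0]] by simp
  with lH0 show "\<exists>l\<in>H1_per0. (\<lambda>k. H0.nrm (\<lambda>t. f k t - l t)) \<longlonglongrightarrow> 0" by blast
qed


section \<open>Smooth periodic functions\<close>

lemma Ck_0_measurable: "Ck 0 f \<Longrightarrow> f \<in> borel_measurable lebesgue"
  by (simp add: measurable_completion borel_measurable_continuous_onI)

lemma smooth_periodic_L2_per:
  assumes "\<And>k. Ck k f" "\<And>i x. f (x + axis i 1) = f x" shows "f \<in> L2_per"
proof -
  have "set_integrable lebesgue K (\<lambda>x. f x * f x)" if "compact K" for K
    using weak_pderiv_L1_loc(1)[OF has_weak_pderiv_smooth[OF Ck_mult[OF assms(1) assms(1)]]] that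
    by (simp add: L1_loc_def)
  then show ?thesis
    using assms Ck_0_measurable[OF assms(1)]
    by (simp add: L2_per_def L2_loc_def Y_periodic_def power2_eq_square)
qed

lemma smooth_periodic_H1_per:
  assumes C: "\<And>k. Ck k f" and p: "\<And>i x. f (x + axis i 1) = f x" shows "f \<in> H1_per"
proof (rule H1_perI[OF smooth_periodic_L2_per[OF C p] _ has_weak_pderiv_smooth[OF C]])
  fix j
  show "pderiv_at j f \<in> L2_per"
  proof (rule smooth_periodic_L2_per)
    show "Ck k (pderiv_at j f)" for k using C[of "Suc k"] by simp
    show "pderiv_at j f (x + axis i 1) = pderiv_at j f x" for i x
      using pderiv_at_plus[OF Ck_differentiable[OF C], where a = "axis i 1" and i = j and x = x] by (simp add: p)
  qed
qed

text \<open>Inside the period (0, 1) the interval from a to b is the set where the cosine centred at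
  its midpoint exceeds its value at the end points. This makes membership the positivity of a smooth
  periodic function.\<close>

lemma cos_arc_iff:
  assumes ab: "0 \<le> a" "a < b" "b \<le> 1" and x: "0 < x" "x < (1 :: real)"
  shows "cos (2 * pi * (x - (a + b) / 2)) > cos (pi * (b - a)) \<longleftrightarrow> a < x \<and> x < b"
proof -
  define s where "s = \<bar>x - (a + b) / 2\<bar>"
  have s1: "s \<le> 1 - (b - a) / 2" unfolding s_def using ab x by (simp add: abs_le_iff) argo
  have iff: "a < x \<and> x < b \<longleftrightarrow> s < (b - a) / 2" unfolding s_def by (auto simp: abs_less_iff field_simps)
  have cs: "cos (2 * pi * (x - (a + b) / 2)) = cos (2 * pi * s)"
    unfolding s_def by (cases "0 \<le> x - (a + b) / 2") (simp_all add: abs_if, metis cos_minus minus_diff_eq mult_minus_right)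
  have v: "0 \<le> pi * (b - a)" "pi * (b - a) \<le> pi" using ab by (auto simp: mult_le_cancel_left1)
  show ?thesis
  proof (cases "s \<le> 1 / 2")
    case True
    have "2 * pi * s \<le> pi" using True by (simp add: mult.commute field_simps)
    then have "cos (pi * (b - a)) < cos (2 * pi * s) \<longleftrightarrow> 2 * pi * s < pi * (b - a)"
      using v by (intro cos_mono_less_eq) (auto simp: s_def)
    also have "\<dots> \<longleftrightarrow> s < (b - a) / 2"
    proof -
      have "2 * pi * s = pi * (2 * s)" by simp
      then show ?thesis by (simp only: mult_less_cancel_left_pos[OF pi_gt_zero]) auto
    qed
    finally show ?thesis using cs iff by simp
  next
    case False
    \<comment> \<open>Beyond half a period the distance to the midpoint, measured on the circle, is
      1 - s.\<close>
    have "cos (2 * pi * s) = cos (2 * pi * (1 - s))"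
    proof -
      have "2 * pi * (1 - s) = 2 * pi - 2 * pi * s" by (simp add: algebra_simps)
      then show ?thesis by (simp add: cos_diff)
    qed
    moreover have "cos (2 * pi * (1 - s)) \<le> cos (pi * (b - a))"
    proof (rule cos_monotone_0_pi_le)
      show "0 \<le> pi * (b - a)" by (rule v)
      have "pi * (b - a) \<le> pi * (2 * (1 - s))" using s1 by (intro mult_left_mono) (simp_all add: field_simps)
      then show "pi * (b - a) \<le> 2 * pi * (1 - s)" by (simp add: mult.left_commute mult.assoc)
      have "pi * (2 * (1 - s)) \<le> pi * 1" using False by (intro mult_left_mono) auto
      then show "2 * pi * (1 - s) \<le> pi" by (simp add: mult.left_commute mult.assoc)
    qed
    ultimately show ?thesis using cs iff False ab by auto
  qed
qed

text \<open>Density of H1 in periodic L2, in dual form. Test functions supported in the cell are not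
  periodic, so the box indicators are approximated by bumps built from cosines, which are admissible
  choices of \<eta>.\<close>

lemma H1_per_orthogonal_zero:
  fixes z :: "real ^ 'n \<Rightarrow> real"
  assumes z: "z \<in> L2_per" and orth: "\<And>\<eta>. \<eta> \<in> H1_per \<Longrightarrow> pip z \<eta> = 0"
  shows "AE x in lebesgue. z x = 0"
proof -
  have "AE x in lebesgue. x \<in> box 0 (\<chi> i. 1) \<longrightarrow> z x = 0"
  proof (rule AE_zero_on_box)
    show "integrable lebesgue (\<lambda>x. indicator (box 0 (\<chi> i. 1)) x * z x)"
      using cell.sqint_integrable[OF L2_per_sqint[OF z]]
      by (simp add: integrable_restrict_space Ycell_def[symmetric] set_integrable_def)
    fix a b :: "real ^ 'n" assume ne: "box a b \<noteq> {}" and sub: "box a b \<subseteq> box 0 (\<chi> i. 1)"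
    have lt: "a $ i < b $ i" for i using ne by (simp add: interval_ne_empty_cart)
    have "cbox a b \<subseteq> cbox 0 (\<chi> i. 1)"
      using closure_mono[OF sub] closure_box[OF ne] closure_subset[of "box 0 ((\<chi> i. 1) :: real ^ 'n)"]
      by (metis closure_box closure_empty ne sub subset_empty closure_mono)
    moreover have "a \<in> cbox a b" "b \<in> cbox a b" using lt by (auto simp: mem_box_cart less_imp_le)
    ultimately have ab: "0 \<le> a $ i" "b $ i \<le> 1" for i by (auto simp: mem_box_cart subset_iff)
    define u where "u i x = cos (2 * pi * x $ i + - (2 * pi * ((a $ i + b $ i) / 2))) - cos (pi * (b $ i - a $ i))"
      for i and x :: "real ^ 'n"
    have u: "0 < u i x \<longleftrightarrow> a $ i < x $ i \<and> x $ i < b $ i" if "x \<in> Ycell" for i x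
    proof -
      have "0 < x $ i" "x $ i < 1" using that by (auto simp: Ycell_iff)
      from cos_arc_iff[OF ab(1) lt ab(2) this] show ?thesis
        unfolding u_def by (simp only: right_diff_distrib diff_conv_add_uminus[symmetric]) simp
    qed
    have H: "smooth_ind u m \<in> H1_per" for m
    proof (rule smooth_periodic_H1_per)
      show "Ck k (smooth_ind u m)" for k
        unfolding u_def by (intro Ck_smooth_ind Ck_diff Ck_cos Ck_const)
      have "u j (x + axis i 1) = u j x" for j i x
      proof (cases "i = j")
        case True
        have "2 * pi * (x $ j + 1) + - (2 * pi * ((a $ j + b $ j) / 2)) = (2 * pi * x $ j + - (2 * pi * ((a $ j + b $ j) / 2))) + 2 * pi"
          by (simp add: algebra_simps)
        then have "cos (2 * pi * (x $ j + 1) + - (2 * pi * ((a $ j + b $ j) / 2))) = cos (2 * pi * x $ j + - (2 * pi * ((a $ j + b $ j) / 2)))"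
          by (simp only: cos_periodic)
        moreover have "(x + axis i 1) $ j = x $ j + 1" using True by (simp add: axis_def)
        ultimately show ?thesis unfolding u_def by (simp only:)
      qed (simp add: u_def axis_def)
      then show "smooth_ind u m (x + axis i 1) = smooth_ind u m x" for i x
        by (simp add: smooth_ind_def)
    qed
    have "(\<integral>x. indicator (box 0 (\<chi> i. 1)) x * z x * smooth_ind u m x \<partial>lebesgue) = 0" for m
    proof -
      have "(\<integral>x. indicator (box 0 (\<chi> i. 1)) x * z x * smooth_ind u m x \<partial>lebesgue) = pip z (smooth_ind u m)"
        by (subst integral_restrict_space) (simp_all add: Ycell_def[symmetric] mult.assoc)
      then show ?thesis using orth[OF H] by simp
    qed
    moreover have "\<bar>smooth_ind u m x\<bar> \<le> 1" for m x using smooth_ind_bounds[of u m x] by simp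
    moreover have "(\<lambda>m. smooth_ind u m x) \<longlonglongrightarrow> indicator (box a b) x" if "x \<in> box 0 (\<chi> i. 1)" for x
    proof -
      have "(indicator {x. \<forall>i. 0 < u i x} x :: real) = indicator (box a b) x"
        using u[of x] that by (simp add: Ycell_def indicator_def mem_box_cart)
      then show ?thesis using smooth_ind_tendsto[of u x] by simp
    qed
    ultimately show "\<exists>\<phi> :: nat \<Rightarrow> real ^ 'n \<Rightarrow> real. (\<forall>m. \<phi> m \<in> borel_measurable lebesgue) \<and> (\<forall>m x. \<bar>\<phi> m x\<bar> \<le> 1) \<and>
       (\<forall>x\<in>box 0 (\<chi> i. 1). (\<lambda>m. \<phi> m x) \<longlonglongrightarrow> indicator (box a b) x) \<and>
       (\<forall>m. (\<integral>x. indicator (box 0 (\<chi> i. 1)) x * z x * \<phi> m x \<partial>lebesgue) = 0)"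
      using L2_per_meas[OF H1_per_L2_per[OF H]] by (intro exI[of _ "smooth_ind u"]) auto
  qed
  then have "AE x in cell. z x = 0" unfolding AE_cell by (simp add: Ycell_def)
  then have "pnrm (\<lambda>x. z x - 0) = 0" using L2nrm_eq_0_iff[OF L2_per_sqint[OF z]] by simp
  from L2_per_AE_eq[OF z L2_per_const this] show ?thesis .
qed


section \<open>Regularity for the periodic Poisson equation\<close>

lemma H1_per_cong_AE:
  fixes f g :: "real ^ 'n \<Rightarrow> real"
  assumes f: "f \<in> H1_per" and g: "g \<in> borel_measurable lebesgue" and ae: "AE x in lebesgue. f x = g x"
  shows "g \<in> H1_per"
proof (rule H1_perI[OF L2_per_cong_AE[OF H1_per_L2_per[OF f] g ae]])
  fix i
  show w: "wpd i f \<in> L2_per" by (rule H1_per_wpd_L2_per[OF f])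
  show "has_weak_pderiv i g (wpd i f)"
    by (rule weak_pderiv_cong_AE[OF H1_per_weak_pderiv[OF f] g ae L2_per_meas[OF w]]) simp
qed

lemma Dq_H1_per0: "f \<in> H1_per \<Longrightarrow> Dq i h f \<in> H1_per0"
  using mean_plus[OF H1_per_L2_per[of f]] H1_per_integrable[OF H1_per_plus[of f]]
  by (simp add: H1_per0_def Dq_H1_per) (simp add: Dq_alt H1_per_integrable)

lemma grad_ip_Dq:
  assumes f: "f \<in> H1_per" and e: "e \<in> H1_per"
  shows "grad_ip (Dq j h f) e = - grad_ip f (Dq j (- h) e)"
proof -
  have "pip (wpd i (Dq j h f)) (wpd i e) = - pip (wpd i f) (wpd i (Dq j (- h) e))" for i
  proof -
    have "pip (wpd i (Dq j h f)) (wpd i e) = pip (wpd i e) (Dq j h (wpd i f))"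
      using pip_wpd_left[OF Dq_H1_per[OF f] Dq_weak_pderiv[OF H1_per_weak_pderiv[OF f]] H1_per_wpd_L2_per[OF e]]
      by (simp add: mult.commute)
    also have "\<dots> = - pip (Dq j (- h) (wpd i e)) (wpd i f)"
      by (rule pip_Dq_adjoint[OF H1_per_wpd_L2_per[OF f] H1_per_wpd_L2_per[OF e]])
    also have "pip (Dq j (- h) (wpd i e)) (wpd i f) = pip (wpd i f) (wpd i (Dq j (- h) e))"
      using pip_wpd_right[OF Dq_H1_per[OF e] Dq_weak_pderiv[OF H1_per_weak_pderiv[OF e]] H1_per_wpd_L2_per[OF f]]
      by (simp add: mult.commute)
    finally show ?thesis .
  qed
  then show ?thesis by (simp add: grad_ip_def sum_negf)
qed

text \<open>The modulus of continuity as a null sequence along \<open>step\<close>, in the form that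
  the Cauchy criterion takes.\<close>

lemma translation_sup:
  fixes d :: "real ^ 'n \<Rightarrow> real"
  assumes d: "d \<in> L2_per"
  obtains w where "w \<longlonglongrightarrow> 0" "\<And>k t. \<bar>t\<bar> \<le> step k \<Longrightarrow> pnrm (\<lambda>x. d (x + axis i t) - d x) \<le> w k"
proof -
  let ?p = "\<lambda>t. pnrm (\<lambda>x. d (x + axis i t) - d x)"
  define w where "w k = (SUP t\<in>{- step k..step k}. ?p t)" for k
  have p0: "0 \<le> ?p t" for t by (rule L2.nrm_nonneg[OF L2_per_sqint[OF L2_per_diff[OF L2_per_plus[OF d] d]]])
  have bdd: "bdd_above (?p ` X)" for X
  proof (rule bdd_aboveI2)
    show "?p t \<le> pnrm d + pnrm d" for t
      using L2.nrm_triangle_diff[OF L2_per_sqint[OF L2_per_plus[OF d]] L2_per_sqint[OF d], of "axis i t"]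
      by (simp add: pnrm_plus[OF d])
  qed
  have le: "?p t \<le> w k" if "\<bar>t\<bar> \<le> step k" for k t
    unfolding w_def by (rule cSUP_upper[OF _ bdd]) (use that in auto)
  have w0: "0 \<le> w k" for k
    using order_trans[OF p0[of 0] le[of 0 k]] by (simp add: step_def)
  have "w \<longlonglongrightarrow> 0"
  proof (rule LIMSEQ_I)
    fix e :: real assume e: "0 < e"
    obtain r where r: "r > 0" and small: "\<And>t. \<bar>t\<bar> < r \<Longrightarrow> ?p t \<le> e / 2"
      using translation_modulus[OF d half_gt_zero[OF e], of i] by blast
    have "\<forall>\<^sub>F k in sequentially. step k < r" by (rule order_tendstoD(2)[OF step_lim(1) r])
    then obtain N where N: "\<And>k. k \<ge> N \<Longrightarrow> step k < r" by (auto simp: eventually_sequentially)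
    have "w k \<le> e / 2" if "k \<ge> N" for k
      unfolding w_def
    proof (rule cSUP_least)
      show "{- step k..step k} \<noteq> {}" by (simp add: step_def)
      show "?p t \<le> e / 2" if "t \<in> {- step k..step k}" for t
        using that N[OF \<open>k \<ge> N\<close>] by (intro small) auto
    qed
    then show "\<exists>no. \<forall>k\<ge>no. norm (w k - 0) < e" using w0 e by (intro exI[of _ N]) (auto, smt (verit) field_sum_of_halves)
  qed
  with le that show thesis by blast
qed

text \<open>Regularity by difference quotients: testing the equation for \<open>Dq j h \<psi> - Dq j h' \<psi>\<close> with the
  function itself bounds its gradient by the \<open>L\<^sup>2\<close> modulus of continuity of \<open>d\<close> at \<open>h\<close> and \<open>h'\<close>,
  so that the difference quotients are a Cauchy sequence in \<open>H\<^sup>1\<close>.\<close>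

lemma poisson_H2_per:
  fixes d :: "real ^ 'n \<Rightarrow> real"
  assumes d: "d \<in> L2_per" and mean: "integral\<^sup>L cell d = 0"
  shows "\<exists>\<psi>\<in>H2_per. AE x in lebesgue. (\<Sum>i\<in>UNIV. wpd i (wpd i \<psi>) x) = d x"
proof -
  interpret Hil: semi_hilbert "H1_per0 :: (real ^ 'n \<Rightarrow> real) set" grad_ip by (rule semi_hilbert_H1_per0)
  let ?c = "sqrt (poincare_const TYPE('n))"
  note dS = L2_per_sqint[OF d]
  have S: "f \<in> H1_per0 \<Longrightarrow> f \<in> sqint cell" for f :: "real ^ 'n \<Rightarrow> real"
    by (intro L2_per_sqint H1_per_L2_per H1_per0_H1_per)
  \<comment> \<open>The weak Poisson equation; the minus sign is that of one integration by
    parts.\<close>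
  have "\<exists>p\<in>H1_per0. \<forall>s\<in>H1_per0. grad_ip p s = - pip d s"
  proof (rule Hil.riesz)
    fix s :: "real ^ 'n \<Rightarrow> real" assume s: "s \<in> H1_per0"
    show "\<bar>- pip d s\<bar> \<le> (pnrm d * ?c) * H0.nrm s"
      using L2.cauchy_schwarz[OF dS S[OF s]] mult_left_mono[OF pnrm_le_sqrt[OF s] L2.nrm_nonneg[OF dS]]
      by (simp add: mult.assoc)
    show "- pip d (\<lambda>x. c *\<^sub>R s x) = c * - pip d s" for c
      using L2.ip_scale_right[OF S[OF s] dS, of c] by simp
    fix t :: "real ^ 'n \<Rightarrow> real" assume t: "t \<in> H1_per0"
    show "- pip d (\<lambda>x. s x + t x) = - pip d s + - pip d t"
      using L2.ip_add_right[OF S[OF s] S[OF t] dS] by simp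
  qed
  then obtain \<psi> where \<psi>0: "\<psi> \<in> H1_per0" and \<psi>eq: "\<And>s. s \<in> H1_per0 \<Longrightarrow> grad_ip \<psi> s = - pip d s" by blast
  note \<psi> = H1_per0_H1_per[OF \<psi>0]
  have second: "wpd j \<psi> \<in> H1_per" for j
  proof -
    obtain w where wlim: "w \<longlonglongrightarrow> 0" and w: "\<And>k t. \<bar>t\<bar> \<le> step k \<Longrightarrow> pnrm (\<lambda>x. d (x + axis j t) - d x) \<le> w k"
      using translation_sup[OF d, of j] by blast
    define D where "D k = Dq j (step k) \<psi>" for k
    have D0: "D k \<in> H1_per0" for k unfolding D_def by (rule Dq_H1_per0[OF \<psi>])
    have test: "grad_ip (D k) e = pip d (Dq j (- step k) e)" if e: "e \<in> H1_per0" for k e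
      using grad_ip_Dq[OF \<psi> H1_per0_H1_per[OF e], of j "step k"] \<psi>eq[OF Dq_H1_per0[OF H1_per0_H1_per[OF e]]]
      by (simp add: D_def)
    \<comment> \<open>The quantity \<open>pip d (wpd j e)\<close> does not depend on
      \<open>k\<close>, so it cancels when \<open>D k\<close> and \<open>D l\<close> are compared.
      Convergence of \<open>Dq j (- step k) e\<close> would not do here, since \<open>e\<close> will
      be the difference \<open>D k - D l\<close> itself.\<close>
    have near: "\<bar>pip d (Dq j (- step k) e) - pip d (wpd j e)\<bar> \<le> w k * H0.nrm e" if e: "e \<in> H1_per0" for k e
    proof -
      note eH = H1_per0_H1_per[OF e]
      have w0: "0 \<le> w k" using order_trans[OF L2.nrm_nonneg[OF L2_per_sqint[OF L2_per_diff[OF L2_per_plus[OF d] d]]] w[of 0 k]]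
        by (simp add: step_def)
      have "\<bar>pip d (Dq j (- step k) e) - pip d (wpd j e)\<bar> \<le> w k * pnrm (wpd j e)"
        by (rule pip_Dq_near_derivative[OF d H1_per_L2_per[OF eH] H1_per_wpd_L2_per[OF eH] H1_per_weak_pderiv[OF eH] step_nz(2)])
           (rule w, simp add: step_def)
      also have "\<dots> \<le> w k * H0.nrm e" using w0 pnrm_wpd_le[OF e] by (intro mult_left_mono)
      finally show ?thesis .
    qed
    have "H0.nrm (\<lambda>x. D k x - D l x) \<le> w k + w l" for k l
    proof -
      let ?e = "\<lambda>x. D k x - D l x"
      have e: "?e \<in> H1_per0" by (rule H1_per0_diff[OF D0 D0])
      have "(H0.nrm ?e)\<^sup>2 = grad_ip (D k) ?e - grad_ip (D l) ?e"
        unfolding H0.nrm_sq[OF e] by (rule H0.ip_diff[OF D0 D0 e])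
      also have "\<dots> \<le> w k * H0.nrm ?e + w l * H0.nrm ?e"
        using near[OF e, of k] near[OF e, of l] unfolding test[OF e] by linarith
      finally have "H0.nrm ?e * H0.nrm ?e \<le> H0.nrm ?e * (w k + w l)" by (simp add: power2_eq_square algebra_simps)
      moreover have "0 \<le> w k" for k
        using order_trans[OF L2.nrm_nonneg[OF L2_per_sqint[OF L2_per_diff[OF L2_per_plus[OF d] d]]] w[of 0 k]]
        by (simp add: step_def)
      ultimately show ?thesis by (rule_tac le_if_square_le[OF _ H0.nrm_nonneg[OF e] add_nonneg_nonneg])
    qed
    then have "H0.nrm_Cauchy D" by (rule H0.nrm_CauchyI[OF _ wlim])
    from Hil.complete[OF D0 this] obtain p where p: "p \<in> H1_per0" and lim: "(\<lambda>k. H0.nrm (\<lambda>x. D k x - p x)) \<longlonglongrightarrow> 0"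
      by blast
    have lim1: "(\<lambda>k. pnrm (\<lambda>x. D k x - p x)) \<longlonglongrightarrow> 0"
      by (rule pnrm_tendsto_0_if_H0[OF H1_per0_diff[OF D0 p] lim])
    have lim2: "(\<lambda>k. pnrm (\<lambda>x. D k x - wpd j \<psi> x)) \<longlonglongrightarrow> 0"
      unfolding D_def by (rule Dq_seq_tendsto[OF \<psi> step_nz(1) step_lim(1)])
    note wS = L2_per_sqint[OF H1_per_wpd_L2_per[OF \<psi>]]
    \<comment> \<open>The quotients converge to \<open>p\<close> in H1 and to
      \<open>wpd j \<psi>\<close> in L2, so the two limits coincide and the derivative inherits
      membership in H1.\<close>
    have "pnrm (\<lambda>x. p x - wpd j \<psi> x) \<le> 0"
    proof (rule LIMSEQ_le_const)
      show "(\<lambda>k. pnrm (\<lambda>x. D k x - p x) + pnrm (\<lambda>x. D k x - wpd j \<psi> x)) \<longlonglongrightarrow> 0"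
        using tendsto_add[OF lim1 lim2] by simp
      show "\<exists>N. \<forall>k\<ge>N. pnrm (\<lambda>x. p x - wpd j \<psi> x) \<le> pnrm (\<lambda>x. D k x - p x) + pnrm (\<lambda>x. D k x - wpd j \<psi> x)"
        using L2.nrm_triangle3[OF S[OF p] S[OF D0] wS] L2.nrm_minus[OF S[OF p] S[OF D0]] by simp
    qed
    then have "pnrm (\<lambda>x. p x - wpd j \<psi> x) = 0"
      using L2.nrm_nonneg[OF L2.diff_mem[OF S[OF p] wS]] by (rule antisym)
    from L2_per_AE_eq[OF H1_per_L2_per[OF H1_per0_H1_per[OF p]] H1_per_wpd_L2_per[OF \<psi>] this]
    show ?thesis by (rule H1_per_cong_AE[OF H1_per0_H1_per[OF p] L2_per_meas[OF H1_per_wpd_L2_per[OF \<psi>]]])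
  qed
  let ?L = "\<lambda>x. \<Sum>i\<in>UNIV. wpd i (wpd i \<psi>) x"
  have LL: "?L \<in> L2_per" by (intro L2_per_sum H1_per_wpd_L2_per second)
  have "AE x in lebesgue. ?L x - d x = 0"
  proof (rule H1_per_orthogonal_zero[OF L2_per_diff[OF LL d]])
    fix \<eta> :: "real ^ 'n \<Rightarrow> real" assume \<eta>: "\<eta> \<in> H1_per"
    note \<eta>L = H1_per_L2_per[OF \<eta>]
    let ?m = "integral\<^sup>L cell \<eta>"
    \<comment> \<open>The equation is known for mean zero test functions only. Subtracting the mean
      is harmless since \<open>d\<close> has mean zero and constants have zero gradient.\<close>
    have \<eta>0: "(\<lambda>x. \<eta> x - ?m) \<in> H1_per0"
      using \<eta> by (simp add: H1_per0_def H1_per_diff H1_per_const H1_per_integrable space_cell)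
    have "pip d \<eta> = pip d (\<lambda>x. \<eta> x - ?m)"
      using L2.ip_diff_right[OF L2_per_sqint[OF \<eta>L] cell.sqint_const[of ?m] dS] mean by simp
    also have "\<dots> = - grad_ip \<psi> (\<lambda>x. \<eta> x - ?m)" using \<psi>eq[OF \<eta>0] by simp
    also have "\<dots> = - (\<Sum>i\<in>UNIV. pip (wpd i \<psi>) (wpd i \<eta>))"
    proof -
      have "has_weak_pderiv i (\<lambda>x. \<eta> x - ?m) (wpd i \<eta>)" for i
        using weak_pderiv_diff[OF H1_per_weak_pderiv[OF \<eta>] weak_pderiv_const, of i ?m] by simp
      from pip_wpd_right[OF H1_per0_H1_per[OF \<eta>0] this H1_per_wpd_L2_per[OF \<psi>]]
      show ?thesis unfolding grad_ip_def by simp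
    qed
    also have "\<dots> = (\<Sum>i\<in>UNIV. pip (wpd i (wpd i \<psi>)) \<eta>)"
      by (simp add: integration_by_parts[OF second \<eta>] sum_negf)
    also have "\<dots> = pip ?L \<eta>"
      using sqint_mult[OF L2_per_sqint[OF H1_per_wpd_L2_per[OF second]] L2_per_sqint[OF \<eta>L]]
      by (simp add: sum_distrib_right)
    finally show "pip (\<lambda>x. ?L x - d x) \<eta> = 0"
      using L2.ip_diff[OF L2_per_sqint[OF LL] dS L2_per_sqint[OF \<eta>L]] by simp
  qed
  then have "AE x in lebesgue. ?L x = d x" by eventually_elim simp
  moreover have "\<psi> \<in> H2_per" using \<psi> second by (simp add: H2_per_def)
  ultimately show ?thesis by blast
qed

section \<open>Vector fields\<close>

lemma inner_mat: "A \<bullet> B = (\<Sum>i\<in>UNIV. \<Sum>j\<in>UNIV. A $ i $ j * B $ i $ j)" for A B :: "real ^ 'n ^ 'm"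
  by (simp add: inner_vec_def)

lemma inner_transpose: "transpose A \<bullet> transpose B = A \<bullet> B" for A B :: "real ^ 'n ^ 'n"
  unfolding inner_mat transpose_def by (simp, rule sum.swap)

lemma inner_mat_1: "mat 1 \<bullet> A = trace A" for A :: "real ^ 'n ^ 'n"
  unfolding inner_mat trace_def mat_def by (simp add: if_distrib[of "\<lambda>a. a * _"] cong: if_cong)

definition jac_ip :: "(real ^ 'n \<Rightarrow> real ^ 'n) \<Rightarrow> (real ^ 'n \<Rightarrow> real ^ 'n) \<Rightarrow> real" where
  "jac_ip v w = (\<Sum>i\<in>UNIV. grad_ip (\<lambda>x. v x $ i) (\<lambda>x. w x $ i))"

lemma H1_per0_vec_iff: "v \<in> H1_per0_vec \<longleftrightarrow> (\<forall>i. (\<lambda>x. v x $ i) \<in> H1_per0)"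
  by (simp add: H1_per0_vec_def H1_per0_def set_integral_cell)

lemma H1_per0_vec_comp: "v \<in> H1_per0_vec \<Longrightarrow> (\<lambda>x. v x $ i) \<in> H1_per0"
  by (simp add: H1_per0_vec_iff)

lemma H1_vec_comp: "v \<in> H1_per0_vec \<Longrightarrow> (\<lambda>x. v x $ i) \<in> H1_per"
  by (rule H1_per0_H1_per[OF H1_per0_vec_comp])

lemma H1_vec_L2: "v \<in> H1_per0_vec \<Longrightarrow> (\<lambda>x. v x $ i) \<in> L2_per"
  by (rule H1_per_L2_per[OF H1_vec_comp])

lemma H1_vec_wpd_L2: "v \<in> H1_per0_vec \<Longrightarrow> wpd j (\<lambda>x. v x $ i) \<in> L2_per"
  by (rule H1_per_wpd_L2_per[OF H1_vec_comp])

lemma semi_inner_H1_per0_vec: "semi_inner (H1_per0_vec :: (real ^ 'n \<Rightarrow> real ^ 'n) set) jac_ip"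
proof
  fix v w z :: "real ^ 'n \<Rightarrow> real ^ 'n" and c :: real
  show "(\<lambda>t. 0) \<in> H1_per0_vec" by (simp add: H1_per0_vec_iff H1_per0_zero)
  assume v: "v \<in> H1_per0_vec"
  show "(\<lambda>t. c *\<^sub>R v t) \<in> H1_per0_vec" using v by (simp add: H1_per0_vec_iff H1_per0_cmult)
  show "0 \<le> jac_ip v v" unfolding jac_ip_def by (intro sum_nonneg H0.ip_nonneg H1_per0_vec_comp v)
  assume w: "w \<in> H1_per0_vec"
  show "(\<lambda>t. v t + w t) \<in> H1_per0_vec" using v w by (simp add: H1_per0_vec_iff H1_per0_add)
  show "jac_ip v w = jac_ip w v"
    unfolding jac_ip_def by (intro sum.cong refl H0.ip_sym H1_per0_vec_comp v w)
  have "jac_ip (\<lambda>t. c *\<^sub>R v t) w = (\<Sum>i\<in>UNIV. grad_ip (\<lambda>x. c *\<^sub>R (v x $ i)) (\<lambda>x. w x $ i))"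
    by (simp add: jac_ip_def)
  also have "\<dots> = (\<Sum>i\<in>UNIV. c * grad_ip (\<lambda>x. v x $ i) (\<lambda>x. w x $ i))"
    by (intro sum.cong refl H0.ip_scale H1_per0_vec_comp v w)
  finally show "jac_ip (\<lambda>t. c *\<^sub>R v t) w = c * jac_ip v w"
    by (simp add: jac_ip_def sum_distrib_left)
  assume z: "z \<in> H1_per0_vec"
  have "jac_ip (\<lambda>t. v t + w t) z = (\<Sum>i\<in>UNIV. grad_ip (\<lambda>x. v x $ i + w x $ i) (\<lambda>x. z x $ i))"
    by (simp add: jac_ip_def)
  also have "\<dots> = (\<Sum>i\<in>UNIV. grad_ip (\<lambda>x. v x $ i) (\<lambda>x. z x $ i) + grad_ip (\<lambda>x. w x $ i) (\<lambda>x. z x $ i))"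
    by (intro sum.cong refl H0.ip_add H1_per0_vec_comp v w z)
  finally show "jac_ip (\<lambda>t. v t + w t) z = jac_ip v z + jac_ip w z"
    by (simp add: jac_ip_def sum.distrib)
qed

interpretation HV: semi_inner "H1_per0_vec :: (real ^ 'n \<Rightarrow> real ^ 'n) set" jac_ip
  by (rule semi_inner_H1_per0_vec)

lemma HV_nrm_sq: "v \<in> H1_per0_vec \<Longrightarrow> (HV.nrm v)\<^sup>2 = (\<Sum>i\<in>UNIV. (H0.nrm (\<lambda>x. v x $ i))\<^sup>2)"
  unfolding HV.nrm_sq jac_ip_def by (intro sum.cong refl H0.nrm_sq[symmetric] H1_per0_vec_comp)

lemma H0_nrm_comp_le:
  assumes "v \<in> H1_per0_vec" shows "H0.nrm (\<lambda>x. v x $ i) \<le> HV.nrm v"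
proof (rule power2_le_imp_le)
  show "(H0.nrm (\<lambda>x. v x $ i))\<^sup>2 \<le> (HV.nrm v)\<^sup>2"
    unfolding HV_nrm_sq[OF assms] by (rule member_le_sum) auto
qed (rule HV.nrm_nonneg[OF assms])

lemma semi_hilbert_H1_per0_vec: "semi_hilbert (H1_per0_vec :: (real ^ 'n \<Rightarrow> real ^ 'n) set) jac_ip"
proof
  interpret Hil: semi_hilbert "H1_per0 :: (real ^ 'n \<Rightarrow> real) set" grad_ip by (rule semi_hilbert_H1_per0)
  fix f :: "nat \<Rightarrow> real ^ 'n \<Rightarrow> real ^ 'n"
  assume f: "\<And>k. f k \<in> H1_per0_vec" and C: "HV.nrm_Cauchy f"
  have "\<exists>l\<in>H1_per0. (\<lambda>k. H0.nrm (\<lambda>x. f k x $ i - l x)) \<longlonglongrightarrow> 0" for i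
  proof (rule Hil.complete)
    show "(\<lambda>x. f k x $ i) \<in> H1_per0" for k by (rule H1_per0_vec_comp[OF f])
    have "H0.nrm (\<lambda>x. f m x $ i - f n x $ i) \<le> HV.nrm (\<lambda>x. f m x - f n x)" for m n
      using H0_nrm_comp_le[OF HV.diff_mem[OF f f], of m n i] by simp
    then show "H0.nrm_Cauchy (\<lambda>k x. f k x $ i)"
      using C unfolding H0.nrm_Cauchy_def HV.nrm_Cauchy_def by (meson le_less_trans)
  qed
  then have "\<forall>i. \<exists>l. l \<in> H1_per0 \<and> (\<lambda>k. H0.nrm (\<lambda>x. f k x $ i - l x)) \<longlonglongrightarrow> 0" by blast
  from choice[OF this] obtain l where l: "\<And>i. l i \<in> H1_per0"
    and lim: "\<And>i. (\<lambda>k. H0.nrm (\<lambda>x. f k x $ i - l i x)) \<longlonglongrightarrow> 0" by blast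
  define u :: "real ^ 'n \<Rightarrow> real ^ 'n" where "u x = (\<chi> i. l i x)" for x
  have u: "u \<in> H1_per0_vec" using l by (simp add: H1_per0_vec_iff u_def)
  have "(\<lambda>k. (HV.nrm (\<lambda>x. f k x - u x))\<^sup>2) \<longlonglongrightarrow> (\<Sum>i\<in>(UNIV :: 'n set). 0\<^sup>2)"
    unfolding HV_nrm_sq[OF HV.diff_mem[OF f u]] vector_minus_component
    unfolding u_def vec_lambda_beta by (intro tendsto_intros lim)
  then have "(\<lambda>k. sqrt ((HV.nrm (\<lambda>x. f k x - u x))\<^sup>2)) \<longlonglongrightarrow> sqrt 0"
    by (intro tendsto_real_sqrt) simp
  then have "(\<lambda>k. HV.nrm (\<lambda>x. f k x - u x)) \<longlonglongrightarrow> 0"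
    using HV.nrm_nonneg[OF HV.diff_mem[OF f u]] by simp
  with u show "\<exists>l\<in>H1_per0_vec. (\<lambda>k. HV.nrm (\<lambda>t. f k t - l t)) \<longlonglongrightarrow> 0" by blast
qed

lemma integrable_pip: "f \<in> L2_per \<Longrightarrow> g \<in> L2_per \<Longrightarrow> integrable cell (\<lambda>x. f x * g x :: real)"
  by (intro sqint_mult L2_per_sqint)

lemma
  assumes v: "v \<in> H1_per0_vec" and w: "w \<in> H1_per0_vec"
  shows integrable_jac: "integrable cell (\<lambda>x. Jac v x \<bullet> Jac w x)"
    and integral_jac: "(\<integral>x. Jac v x \<bullet> Jac w x \<partial>cell) = jac_ip v w"
proof -
  have eq: "Jac v x \<bullet> Jac w x = (\<Sum>i\<in>UNIV. \<Sum>j\<in>UNIV. wpd j (\<lambda>x. v x $ i) x * wpd j (\<lambda>x. w x $ i) x)" for x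
    by (simp add: inner_mat Jac_def)
  note int = integrable_pip[OF H1_vec_wpd_L2[OF v] H1_vec_wpd_L2[OF w]]
  show "integrable cell (\<lambda>x. Jac v x \<bullet> Jac w x)"
    unfolding eq by (intro Bochner_Integration.integrable_sum int)
  show "(\<integral>x. Jac v x \<bullet> Jac w x \<partial>cell) = jac_ip v w"
    unfolding eq jac_ip_def grad_ip_def
    by (subst Bochner_Integration.integral_sum, intro Bochner_Integration.integrable_sum int)
       (intro sum.cong refl Bochner_Integration.integral_sum int)
qed

lemma L2norm_Jac: "v \<in> H1_per0_vec \<Longrightarrow> L2norm (Jac v) = HV.nrm v"
  by (simp add: L2norm_def set_integral_cell power2_norm_eq_inner integral_jac HV.nrm_def)

lemma Div_L2_per: "v \<in> H1_per0_vec \<Longrightarrow> Div v \<in> L2_per"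
  unfolding Div_def[abs_def] by (intro L2_per_sum H1_vec_wpd_L2)

lemma Div_mean: "v \<in> H1_per0_vec \<Longrightarrow> integral\<^sup>L cell (Div v) = 0"
  unfolding Div_def[abs_def]
  by (subst Bochner_Integration.integral_sum)
     (auto intro!: cell.sqint_integrable L2_per_sqint H1_vec_wpd_L2 sum.neutral mean_wpd H1_vec_comp)

lemma
  \<comment> \<open>Transposing the Jacobian exchanges the two differentiation indices, and
    periodicity allows them to be swapped back between the factors under the integral.\<close>
  assumes v: "v \<in> H1_per0_vec" and w: "w \<in> H1_per0_vec"
  shows integrable_jac_transpose: "integrable cell (\<lambda>x. Jac v x \<bullet> transpose (Jac w x))"
    and integral_jac_transpose: "(\<integral>x. Jac v x \<bullet> transpose (Jac w x) \<partial>cell) = pip (Div v) (Div w)"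
proof -
  have eq: "Jac v x \<bullet> transpose (Jac w x) = (\<Sum>i\<in>UNIV. \<Sum>j\<in>UNIV. wpd j (\<lambda>x. v x $ i) x * wpd i (\<lambda>x. w x $ j) x)" for x
    by (simp add: inner_mat Jac_def transpose_def)
  have div: "Div v x * Div w x = (\<Sum>i\<in>UNIV. \<Sum>j\<in>UNIV. wpd i (\<lambda>x. v x $ i) x * wpd j (\<lambda>x. w x $ j) x)" for x
    by (simp add: Div_def sum_product)
  note int = integrable_pip[OF H1_vec_wpd_L2[OF v] H1_vec_wpd_L2[OF w]]
  show "integrable cell (\<lambda>x. Jac v x \<bullet> transpose (Jac w x))"
    unfolding eq by (intro Bochner_Integration.integrable_sum int)
  have "(\<integral>x. Jac v x \<bullet> transpose (Jac w x) \<partial>cell)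
      = (\<Sum>i\<in>UNIV. \<Sum>j\<in>UNIV. pip (wpd j (\<lambda>x. v x $ i)) (wpd i (\<lambda>x. w x $ j)))"
    unfolding eq
    by (subst Bochner_Integration.integral_sum, intro Bochner_Integration.integrable_sum int)
       (intro sum.cong refl Bochner_Integration.integral_sum int)
  also have "\<dots> = (\<Sum>i\<in>UNIV. \<Sum>j\<in>UNIV. pip (wpd i (\<lambda>x. v x $ i)) (wpd j (\<lambda>x. w x $ j)))"
    by (intro sum.cong refl pip_wpd_swap H1_vec_comp v w)
  also have "\<dots> = pip (Div v) (Div w)"
    unfolding div
    by (subst Bochner_Integration.integral_sum, intro Bochner_Integration.integrable_sum int)
       (intro sum.cong refl Bochner_Integration.integral_sum[symmetric] int)
  finally show "(\<integral>x. Jac v x \<bullet> transpose (Jac w x) \<partial>cell) = pip (Div v) (Div w)" .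
qed

lemma div_curl_identity:
  assumes v: "v \<in> H1_per0_vec" and w: "w \<in> H1_per0_vec"
  shows "1 / 2 * (\<integral>x. (Jac v x - transpose (Jac v x)) \<bullet> (Jac w x - transpose (Jac w x)) \<partial>cell)
    = jac_ip v w - pip (Div v) (Div w)"
proof -
  have "(Jac v x - transpose (Jac v x)) \<bullet> (Jac w x - transpose (Jac w x))
      = 2 * (Jac v x \<bullet> Jac w x - Jac v x \<bullet> transpose (Jac w x))" for x
    using inner_transpose[of "Jac v x" "Jac w x"] inner_transpose[of "Jac v x" "transpose (Jac w x)"]
    by (simp add: inner_diff_left inner_diff_right transpose_transpose)
  then show ?thesis
    using integrable_jac[OF v w] integrable_jac_transpose[OF v w]
    by (simp add: integral_jac[OF v w] integral_jac_transpose[OF v w])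
qed

text \<open>The two squares differ by half the squared norm of the antisymmetric part Dv - (Dv)^T.
  The constant 1 is essential: the pointwise inequality would bring in sqrt n and spoil \<kappa> <
  1.\<close>

lemma pnrm_Div_le:
  assumes v: "v \<in> H1_per0_vec" shows "pnrm (Div v) \<le> HV.nrm v"
proof (rule power2_le_imp_le)
  have "0 \<le> 1 / 2 * (\<integral>x. (Jac v x - transpose (Jac v x)) \<bullet> (Jac v x - transpose (Jac v x)) \<partial>cell)"
    by simp
  then show "(pnrm (Div v))\<^sup>2 \<le> (HV.nrm v)\<^sup>2"
    unfolding div_curl_identity[OF v v] HV.nrm_sq[OF v] L2.nrm_sq[OF L2_per_sqint[OF Div_L2_per[OF v]]] by simp
qed (rule HV.nrm_nonneg[OF v])

lemma HV_nrm_eq_0_AE: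
  assumes v: "v \<in> H1_per0_vec" "HV.nrm v = 0" shows "AE x in lebesgue. v x = 0"
proof -
  have "AE x in lebesgue. v x $ i = 0" for i
  proof -
    note c = H1_per0_vec_comp[OF v(1), of i]
    have "H0.nrm (\<lambda>x. v x $ i) = 0"
      using H0_nrm_comp_le[OF v(1), of i] H0.nrm_nonneg[OF c] v(2) by simp
    then have "pnrm (\<lambda>x. v x $ i) = 0"
      using pnrm_le_sqrt[OF c] L2.nrm_nonneg[OF L2_per_sqint[OF H1_vec_L2[OF v(1)]], of i] by simp
    then have "pnrm (\<lambda>x. v x $ i - 0) = 0" by simp
    from L2_per_AE_eq[OF H1_vec_L2[OF v(1)] L2_per_const this] show ?thesis .
  qed
  then have "AE x in lebesgue. \<forall>i. v x $ i = 0" by (simp add: AE_all_countable)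
  then show ?thesis by eventually_elim (simp add: vec_eq_iff)
qed

text \<open>Since \<open>wpd\<close> is a choice, linearity of the Jacobian holds only almost
  everywhere; every use under an integral passes through these three facts.\<close>

lemma
  assumes v: "v \<in> H1_per0_vec" and w: "w \<in> H1_per0_vec"
  shows Jac_add_AE: "AE x in lebesgue. Jac (\<lambda>t. v t + w t) x = Jac v x + Jac w x"
    and Jac_scale_AE: "AE x in lebesgue. Jac (\<lambda>t. c *\<^sub>R v t) x = c *\<^sub>R Jac v x"
    and Jac_diff_AE: "AE x in lebesgue. Jac (\<lambda>t. v t - w t) x = Jac v x - Jac w x"
proof -
  note W = H1_per_weak_pderiv[OF H1_vec_comp[OF v]] H1_per_weak_pderiv[OF H1_vec_comp[OF w]]
  have "AE x in lebesgue. \<forall>i j. wpd j (\<lambda>x. v x $ i + w x $ i) x = wpd j (\<lambda>x. v x $ i) x + wpd j (\<lambda>x. w x $ i) x"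
    unfolding AE_all_countable by (intro allI wpd_eq_AE weak_pderiv_add W)
  then show "AE x in lebesgue. Jac (\<lambda>t. v t + w t) x = Jac v x + Jac w x"
    by eventually_elim (simp add: Jac_def vec_eq_iff)
  have "AE x in lebesgue. \<forall>i j. wpd j (\<lambda>x. c * v x $ i) x = c * wpd j (\<lambda>x. v x $ i) x"
    unfolding AE_all_countable by (intro allI wpd_eq_AE weak_pderiv_cmult W)
  then show "AE x in lebesgue. Jac (\<lambda>t. c *\<^sub>R v t) x = c *\<^sub>R Jac v x"
    by eventually_elim (simp add: Jac_def vec_eq_iff)
  have "AE x in lebesgue. \<forall>i j. wpd j (\<lambda>x. v x $ i - w x $ i) x = wpd j (\<lambda>x. v x $ i) x - wpd j (\<lambda>x. w x $ i) x"
    unfolding AE_all_countable by (intro allI wpd_eq_AE weak_pderiv_diff W)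
  then show "AE x in lebesgue. Jac (\<lambda>t. v t - w t) x = Jac v x - Jac w x"
    by eventually_elim (simp add: Jac_def vec_eq_iff)
qed

lemma trace_Jac: "trace (Jac v x) = Div v x"
  by (simp add: trace_def Jac_def Div_def)

lemma Div_diff_AE:
  assumes v: "v \<in> H1_per0_vec" and w: "w \<in> H1_per0_vec"
  shows "AE x in lebesgue. Div (\<lambda>t. v t - w t) x = Div v x - Div w x"
  using Jac_diff_AE[OF v w] by eventually_elim (metis trace_Jac trace_sub)

lemma pip_Div_diff:
  assumes v: "v \<in> H1_per0_vec" and w: "w \<in> H1_per0_vec" and r: "r \<in> sqint cell"
  shows "pip (Div (\<lambda>t. v t - w t)) r = pip (Div v) r - pip (Div w) r"
proof -
  have "pip (Div (\<lambda>t. v t - w t)) r = pip (\<lambda>x. Div v x - Div w x) r"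
  proof (rule integral_cong_AE)
    note S = sqint_meas[OF L2_per_sqint[OF Div_L2_per]]
    show "(\<lambda>x. Div (\<lambda>t. v t - w t) x * r x) \<in> borel_measurable cell"
      by (intro borel_measurable_times S HV.diff_mem v w sqint_meas[OF r])
    show "(\<lambda>x. (Div v x - Div w x) * r x) \<in> borel_measurable cell"
      by (intro borel_measurable_times borel_measurable_diff S v w sqint_meas[OF r])
    show "AE x in cell. Div (\<lambda>t. v t - w t) x * r x = (Div v x - Div w x) * r x"
      using AE_cellI[OF Div_diff_AE[OF v w]] by eventually_elim simp
  qed
  then show ?thesis using L2.ip_diff[OF L2_per_sqint[OF Div_L2_per[OF v]] L2_per_sqint[OF Div_L2_per[OF w]] r] by simp
qed

text \<open>Closedness of \<open>P\<close> refers to the full H1 norm, completeness to the gradient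
  norm. By the Poincare inequality the former is at most \<open>sqrt (?K + 1)\<close> times the
  latter.\<close>

lemma semi_hilbert_closed_subspace:
  fixes P :: "(real ^ 'n \<Rightarrow> real ^ 'n) set"
  assumes P: "closed_subspace_H1_per0 P"
  shows "semi_hilbert P jac_ip"
proof
  interpret Hil: semi_hilbert "H1_per0_vec :: (real ^ 'n \<Rightarrow> real ^ 'n) set" jac_ip by (rule semi_hilbert_H1_per0_vec)
  have sub: "v \<in> H1_per0_vec" if "v \<in> P" for v using P that by (auto simp: closed_subspace_H1_per0_def)
  fix v w z :: "real ^ 'n \<Rightarrow> real ^ 'n" and c :: real and f :: "nat \<Rightarrow> real ^ 'n \<Rightarrow> real ^ 'n"
  show "(\<lambda>t. 0) \<in> P" using P by (simp add: closed_subspace_H1_per0_def)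
  show "(\<lambda>t. v t + w t) \<in> P" if "v \<in> P" "w \<in> P" using P that by (simp add: closed_subspace_H1_per0_def)
  show "(\<lambda>t. c *\<^sub>R v t) \<in> P" if "v \<in> P" using P that by (simp add: closed_subspace_H1_per0_def)
  show "jac_ip v w = jac_ip w v" if "v \<in> P" "w \<in> P" by (intro HV.ip_sym sub that)
  show "jac_ip (\<lambda>t. v t + w t) z = jac_ip v z + jac_ip w z" if "v \<in> P" "w \<in> P" "z \<in> P"
    by (intro HV.ip_add sub that)
  show "jac_ip (\<lambda>t. c *\<^sub>R v t) z = c * jac_ip v z" if "v \<in> P" "z \<in> P" by (intro HV.ip_scale sub that)
  show "0 \<le> jac_ip v v" if "v \<in> P" by (intro HV.ip_nonneg sub that)
  assume f: "\<And>k. f k \<in> P" and C: "HV.nrm_Cauchy f"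
  obtain l where l: "l \<in> H1_per0_vec" and lim: "(\<lambda>k. HV.nrm (\<lambda>x. f k x - l x)) \<longlonglongrightarrow> 0"
    using Hil.complete[OF sub[OF f] C] by blast
  have d: "(\<lambda>x. f k x - l x) \<in> H1_per0_vec" for k by (rule HV.diff_mem[OF sub[OF f] l])
  let ?K = "poincare_const TYPE('n)"
  have "(\<lambda>k. H1norm (\<lambda>x. f k x - l x)) \<longlonglongrightarrow> 0"
  proof (rule tendsto_sandwich[OF _ _ tendsto_const])
    show "\<forall>\<^sub>F k in sequentially. 0 \<le> H1norm (\<lambda>x. f k x - l x)" by (simp add: H1norm_def)
    show "(\<lambda>k. sqrt (?K + 1) * HV.nrm (\<lambda>x. f k x - l x)) \<longlonglongrightarrow> 0"
      using tendsto_mult_left[OF lim, of "sqrt (?K + 1)"] by simp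
    have "H1norm v \<le> sqrt (?K + 1) * HV.nrm v" if v: "v \<in> H1_per0_vec" for v :: "real ^ 'n \<Rightarrow> real ^ 'n"
    proof -
      have "(L2norm v)\<^sup>2 = (\<Sum>i\<in>UNIV. (pnrm (\<lambda>x. v x $ i))\<^sup>2)"
      proof -
        have "(L2norm v)\<^sup>2 = (\<integral>x. (norm (v x))\<^sup>2 \<partial>cell)" by (simp add: L2norm_def set_integral_cell)
        also have "\<dots> = (\<integral>x. (\<Sum>i\<in>UNIV. v x $ i * v x $ i) \<partial>cell)" by (simp add: power2_norm_eq_inner inner_vec_def)
        also have "\<dots> = (\<Sum>i\<in>UNIV. pip (\<lambda>x. v x $ i) (\<lambda>x. v x $ i))"
          by (rule Bochner_Integration.integral_sum) (intro integrable_pip H1_vec_L2 v)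
        also have "\<dots> = (\<Sum>i\<in>UNIV. (pnrm (\<lambda>x. v x $ i))\<^sup>2)"
          by (intro sum.cong refl L2.nrm_sq[symmetric] L2_per_sqint H1_vec_L2 v)
        finally show ?thesis .
      qed
      also have "\<dots> \<le> ?K * (HV.nrm v)\<^sup>2"
        unfolding HV_nrm_sq[OF v] sum_distrib_left by (intro sum_mono pnrm_le_H0_nrm H1_per0_vec_comp v)
      finally have "(L2norm v)\<^sup>2 + (L2norm (Jac v))\<^sup>2 \<le> (?K + 1) * (HV.nrm v)\<^sup>2"
        by (simp add: L2norm_Jac[OF v] distrib_right)
      then have "H1norm v \<le> sqrt ((?K + 1) * (HV.nrm v)\<^sup>2)" unfolding H1norm_def by (rule real_sqrt_le_mono)
      then show ?thesis using HV.nrm_nonneg[OF v] by (simp add: real_sqrt_mult)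
    qed
    then show "\<forall>\<^sub>F k in sequentially. H1norm (\<lambda>x. f k x - l x) \<le> sqrt (?K + 1) * HV.nrm (\<lambda>x. f k x - l x)"
      using d by simp
  qed
  then have "l \<in> P" using P f l unfolding closed_subspace_H1_per0_def by blast
  with lim show "\<exists>l\<in>P. (\<lambda>k. HV.nrm (\<lambda>t. f k t - l t)) \<longlonglongrightarrow> 0" by blast
qed

section \<open>Cordes coefficients\<close>

text \<open>Cauchy-Schwarz in the product space, so that the matrix and the drift share the single
  bound 1 - \<delta> and no cross term arises.\<close>

lemma cauchy_schwarz_sum:
  "(a \<bullet> x + b \<bullet> y)\<^sup>2 \<le> ((norm a)\<^sup>2 + (norm b)\<^sup>2) * ((norm x)\<^sup>2 + (norm y)\<^sup>2)"
  for a x :: "'a::real_inner" and b y :: "'b::real_inner"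
  using Cauchy_Schwarz_ineq[of "(a, b)" "(x, y)"] by (simp add: inner_Pair power2_norm_eq_inner)

text \<open>The coefficients lie within sqrt (1 - \<delta>) of (I, 0), those of the Laplacian, in
  the joint norm; \<open>small\<close> is what makes the perturbation a contraction.\<close>

locale cordes =
  fixes At :: "real ^ 'n \<Rightarrow> real ^ 'n ^ 'n" and bt :: "real ^ 'n \<Rightarrow> real ^ 'n" and \<delta> :: real
  assumes At_meas: "\<And>i j. (\<lambda>x. At x $ i $ j) \<in> borel_measurable lebesgue"
    and bt_meas: "\<And>i. (\<lambda>x. bt x $ i) \<in> borel_measurable lebesgue"
    and close: "AE x in lebesgue. (norm (At x - mat 1))\<^sup>2 + (norm (bt x))\<^sup>2 \<le> 1 - \<delta>"
    and delta_le: "\<delta> \<le> 1"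
    and small: "(1 - \<delta>) * (1 + poincare_const TYPE('n)) < 1"
begin

definition \<kappa> :: real where "\<kappa> = sqrt ((1 - \<delta>) * (1 + poincare_const TYPE('n)))"

lemma kappa: "0 \<le> \<kappa>" "\<kappa> < 1"
  using small delta_le by (auto simp: \<kappa>_def poincare_const_def)

definition rem :: "(real ^ 'n \<Rightarrow> real ^ 'n) \<Rightarrow> real ^ 'n \<Rightarrow> real" where
  "rem w x = (At x - mat 1) \<bullet> Jac w x + bt x \<bullet> w x"

lemma At_bt_split: "At x \<bullet> Jac w x + bt x \<bullet> w x = Div w x + rem w x"
  by (simp add: rem_def inner_diff_left inner_mat_1 trace_Jac)

lemma rem_measurable:
  assumes w: "w \<in> H1_per0_vec" shows "rem w \<in> borel_measurable lebesgue"
proof -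
  have "rem w = (\<lambda>x. (\<Sum>i\<in>UNIV. \<Sum>j\<in>UNIV. (At x $ i $ j - mat 1 $ i $ j) * wpd j (\<lambda>x. w x $ i) x)
      + (\<Sum>i\<in>UNIV. bt x $ i * w x $ i))"
    by (simp add: rem_def fun_eq_iff inner_mat Jac_def inner_vec_def)
  then show ?thesis
    by (simp only:) (intro borel_measurable_add borel_measurable_sum borel_measurable_times borel_measurable_diff
        borel_measurable_const At_meas bt_meas L2_per_meas[OF H1_vec_wpd_L2[OF w]] L2_per_meas[OF H1_vec_L2[OF w]])
qed

text \<open>Pointwise Cauchy-Schwarz leaves (1 - \<delta>) (|Dw|^2 + |w|^2); the Poincare inequality
  for the components absorbs the second term, which produces \<kappa>.\<close>

lemma
  assumes w: "w \<in> H1_per0_vec"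
  shows rem_sqint: "rem w \<in> sqint cell" and rem_bound: "pnrm (rem w) \<le> \<kappa> * HV.nrm w"
proof -
  let ?K = "poincare_const TYPE('n)"
  let ?g = "\<lambda>x. (1 - \<delta>) * (Jac w x \<bullet> Jac w x + (\<Sum>i\<in>UNIV. w x $ i * w x $ i))"
  have K: "0 \<le> ?K" by (simp add: poincare_const_def)
  have intw: "integrable cell (\<lambda>x. w x $ i * w x $ i)" for i by (intro integrable_pip H1_vec_L2 w)
  have int: "integrable cell ?g"
    by (intro integrable_mult_right Bochner_Integration.integrable_add integrable_jac w Bochner_Integration.integrable_sum intw)
  have le: "AE x in cell. (rem w x)\<^sup>2 \<le> ?g x"
    using AE_cellI[OF close]
  proof eventually_elim
    case (elim x)
    have "(rem w x)\<^sup>2 \<le> ((norm (At x - mat 1))\<^sup>2 + (norm (bt x))\<^sup>2) * ((norm (Jac w x))\<^sup>2 + (norm (w x))\<^sup>2)"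
      unfolding rem_def by (rule cauchy_schwarz_sum)
    also have "\<dots> \<le> (1 - \<delta>) * ((norm (Jac w x))\<^sup>2 + (norm (w x))\<^sup>2)"
      using elim by (intro mult_right_mono) auto
    finally show ?case by (simp add: power2_norm_eq_inner inner_vec_def[of "w x"])
  qed
  have m: "rem w \<in> borel_measurable cell" by (rule cell_measurable[OF rem_measurable[OF w]])
  have "integrable cell (\<lambda>x. (rem w x)\<^sup>2)"
  proof (rule Bochner_Integration.integrable_bound[OF int])
    show "(\<lambda>x. (rem w x)\<^sup>2) \<in> borel_measurable cell" using m by measurable
    show "AE x in cell. norm ((rem w x)\<^sup>2) \<le> norm (?g x)"
      using le by eventually_elim auto
  qed
  with m show S: "rem w \<in> sqint cell" by (simp add: sqint_def)
  have "(pnrm (rem w))\<^sup>2 = (\<integral>x. (rem w x)\<^sup>2 \<partial>cell)" by (simp add: L2nrm_eq)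
  also have "\<dots> \<le> integral\<^sup>L cell ?g" by (rule integral_mono_AE[OF sqint_sq[OF S] int le])
  also have "\<dots> = (1 - \<delta>) * ((HV.nrm w)\<^sup>2 + (\<Sum>i\<in>UNIV. (pnrm (\<lambda>x. w x $ i))\<^sup>2))"
    by (simp add: integrable_jac[OF w w] intw integral_jac[OF w w] HV.nrm_sq[OF w] L2.nrm_sq[OF L2_per_sqint[OF H1_vec_L2[OF w]]])
  also have "\<dots> \<le> (1 - \<delta>) * ((HV.nrm w)\<^sup>2 + ?K * (HV.nrm w)\<^sup>2)"
  proof (intro mult_left_mono add_left_mono)
    show "(\<Sum>i\<in>UNIV. (pnrm (\<lambda>x. w x $ i))\<^sup>2) \<le> ?K * (HV.nrm w)\<^sup>2"
      unfolding HV_nrm_sq[OF w] sum_distrib_left by (intro sum_mono pnrm_le_H0_nrm H1_per0_vec_comp w)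
  qed (use delta_le in simp)
  also have "\<dots> = (\<kappa> * HV.nrm w)\<^sup>2"
  proof -
    have "\<kappa>\<^sup>2 = (1 - \<delta>) * (1 + ?K)" using delta_le K by (simp add: \<kappa>_def)
    then show ?thesis by (simp add: power_mult_distrib distrib_right distrib_left)
  qed
  finally show "pnrm (rem w) \<le> \<kappa> * HV.nrm w"
    by (rule power2_le_imp_le) (intro mult_nonneg_nonneg kappa HV.nrm_nonneg w)
qed

section \<open>The bilinear form, its solutions and Galerkin approximation\<close>

definition pert :: "(real ^ 'n \<Rightarrow> real ^ 'n) \<Rightarrow> (real ^ 'n \<Rightarrow> real ^ 'n) \<Rightarrow> real" where
  "pert v w = pip (Div v) (rem w)"

lemma B2_eq:
  assumes v: "v \<in> H1_per0_vec" and w: "w \<in> H1_per0_vec"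
  shows "B2 At bt v w = jac_ip v w + pert v w"
proof -
  have "(\<integral>x. Div v x * (At x \<bullet> Jac w x + bt x \<bullet> w x) \<partial>cell) = pip (Div v) (\<lambda>x. Div w x + rem w x)"
    by (simp only: At_bt_split)
  also have "\<dots> = pip (Div v) (Div w) + pip (Div v) (rem w)"
    by (rule L2.ip_add_right) (intro L2_per_sqint Div_L2_per v w rem_sqint)+
  finally show ?thesis
    unfolding B2_def set_integral_cell pert_def div_curl_identity[OF v w] by simp
qed

lemma pert_bound:
  assumes v: "v \<in> H1_per0_vec" and w: "w \<in> H1_per0_vec"
  shows "\<bar>pert v w\<bar> \<le> \<kappa> * HV.nrm v * HV.nrm w"
proof -
  have "\<bar>pert v w\<bar> \<le> pnrm (Div v) * pnrm (rem w)"
    unfolding pert_def by (rule L2.cauchy_schwarz[OF L2_per_sqint[OF Div_L2_per[OF v]] rem_sqint[OF w]])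
  also have "\<dots> \<le> HV.nrm v * (\<kappa> * HV.nrm w)"
    by (intro mult_mono pnrm_Div_le rem_bound v w HV.nrm_nonneg L2.nrm_nonneg rem_sqint)
  finally show ?thesis by (simp add: mult_ac)
qed

lemma pert_diff_left:
  assumes "v \<in> H1_per0_vec" "w \<in> H1_per0_vec" "s \<in> H1_per0_vec"
  shows "pert (\<lambda>x. v x - w x) s = pert v s - pert w s"
  unfolding pert_def by (rule pip_Div_diff[OF assms(1,2) rem_sqint[OF assms(3)]])

lemma pip_rem_cong:
  assumes "f \<in> sqint cell" "r \<in> sqint cell" "r' \<in> sqint cell" "AE x in lebesgue. r x = r' x"
  shows "pip f r = pip f r'"
proof (rule integral_cong_AE)
  show "AE x in cell. f x * r x = f x * r' x" using AE_cellI[OF assms(4)] by eventually_elim simp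
qed (intro borel_measurable_times sqint_meas assms)+

lemma pert_add_right:
  assumes v: "v \<in> H1_per0_vec" and s: "s \<in> H1_per0_vec" and t: "t \<in> H1_per0_vec"
  shows "pert v (\<lambda>x. s x + t x) = pert v s + pert v t"
proof -
  note V = L2_per_sqint[OF Div_L2_per[OF v]]
  have "pert v (\<lambda>x. s x + t x) = pip (Div v) (\<lambda>x. rem s x + rem t x)"
    unfolding pert_def
  proof (rule pip_rem_cong[OF V rem_sqint[OF HV.add_mem[OF s t]] sqint_add[OF rem_sqint[OF s] rem_sqint[OF t]]])
    show "AE x in lebesgue. rem (\<lambda>x. s x + t x) x = rem s x + rem t x"
      using Jac_add_AE[OF s t] by eventually_elim (simp add: rem_def inner_add_right)
  qed
  also have "\<dots> = pert v s + pert v t"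
    unfolding pert_def by (rule L2.ip_add_right[OF rem_sqint[OF s] rem_sqint[OF t] V])
  finally show ?thesis .
qed

lemma pert_scale_right:
  assumes v: "v \<in> H1_per0_vec" and s: "s \<in> H1_per0_vec"
  shows "pert v (\<lambda>x. c *\<^sub>R s x) = c * pert v s"
proof -
  note V = L2_per_sqint[OF Div_L2_per[OF v]]
  have "pert v (\<lambda>x. c *\<^sub>R s x) = pip (Div v) (\<lambda>x. c * rem s x)"
    unfolding pert_def
  proof (rule pip_rem_cong[OF V rem_sqint[OF HV.scale_mem[OF s]] sqint_cmult[OF rem_sqint[OF s]]])
    show "AE x in lebesgue. rem (\<lambda>x. c *\<^sub>R s x) x = c * rem s x"
      using Jac_scale_AE[OF s s, of c] by eventually_elim (simp add: rem_def distrib_left)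
  qed
  also have "\<dots> = c * pert v s"
    unfolding pert_def using L2.ip_scale_right[OF rem_sqint[OF s] V, of c] by simp
  finally show ?thesis .
qed

lemma B2_diff_left:
  assumes "v \<in> H1_per0_vec" "w \<in> H1_per0_vec" "s \<in> H1_per0_vec"
  shows "B2 At bt (\<lambda>x. v x - w x) s = B2 At bt v s - B2 At bt w s"
  using assms by (simp add: B2_eq HV.diff_mem HV.ip_diff pert_diff_left)

lemma B2_coercive:
  assumes v: "v \<in> H1_per0_vec" shows "(1 - \<kappa>) * (HV.nrm v)\<^sup>2 \<le> B2 At bt v v"
  using pert_bound[OF v v] by (simp add: B2_eq[OF v v] HV.nrm_sq[OF v, symmetric] power2_eq_square algebra_simps)

lemma B2_bounded:
  assumes v: "v \<in> H1_per0_vec" and w: "w \<in> H1_per0_vec"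
  shows "\<bar>B2 At bt v w\<bar> \<le> (1 + \<kappa>) * HV.nrm v * HV.nrm w"
  using pert_bound[OF v w] HV.cauchy_schwarz[OF v w] by (simp add: B2_eq[OF v w] algebra_simps)

definition load :: "(real ^ 'n \<Rightarrow> real ^ 'n) \<Rightarrow> (real ^ 'n \<Rightarrow> real ^ 'n) \<Rightarrow> real" where
  "load F w = - (LINT x:Ycell|lebesgue. F x \<bullet> w x)"

lemma load_eq:
  assumes F: "\<And>i. (\<lambda>x. F x $ i) \<in> L2_per" and w: "\<And>i. (\<lambda>x. w x $ i) \<in> L2_per"
  shows "load F w = - (\<Sum>i\<in>UNIV. pip (\<lambda>x. F x $ i) (\<lambda>x. w x $ i))"
  unfolding load_def set_integral_cell inner_vec_def
  by (subst Bochner_Integration.integral_sum) (auto intro!: integrable_pip F w)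

text \<open>Stated for every complete subspace, so that one argument gives both the exact solution
  and the discrete one.\<close>

lemma solution_exists:
  assumes P: "semi_hilbert P jac_ip" "P \<subseteq> H1_per0_vec" and F: "\<And>i. (\<lambda>x. F x $ i) \<in> L2_per"
  shows "\<exists>\<rho>. solves_in P At bt F \<rho>"
proof -
  interpret P: semi_hilbert P jac_ip by fact
  have sub: "v \<in> H1_per0_vec" if "v \<in> P" for v using P(2) that by blast
  let ?c = "sqrt (poincare_const TYPE('n))"
  have "\<exists>v\<in>P. \<forall>s\<in>P. jac_ip v s + pert v s = load F s"
  proof (rule P.perturbed_riesz[where \<kappa> = \<kappa> and C = "\<Sum>i\<in>UNIV. pnrm (\<lambda>x. F x $ i) * ?c"])
    fix s assume "s \<in> P"
    then have s: "s \<in> H1_per0_vec" by (rule sub)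
    note sL = H1_vec_L2[OF s] and FS = L2_per_sqint[OF F]
    have "\<bar>load F s\<bar> \<le> (\<Sum>i\<in>UNIV. \<bar>pip (\<lambda>x. F x $ i) (\<lambda>x. s x $ i)\<bar>)"
      unfolding load_eq[OF F sL] abs_minus_cancel by (rule sum_abs)
    also have "\<dots> \<le> (\<Sum>i\<in>UNIV. pnrm (\<lambda>x. F x $ i) * (?c * HV.nrm s))"
    proof (rule sum_mono)
      fix i
      have "\<bar>pip (\<lambda>x. F x $ i) (\<lambda>x. s x $ i)\<bar> \<le> pnrm (\<lambda>x. F x $ i) * pnrm (\<lambda>x. s x $ i)"
        by (rule L2.cauchy_schwarz[OF FS L2_per_sqint[OF sL]])
      also have "pnrm (\<lambda>x. s x $ i) \<le> ?c * HV.nrm s"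
        using order_trans[OF pnrm_le_sqrt[OF H1_per0_vec_comp[OF s]] mult_left_mono[OF H0_nrm_comp_le[OF s]]]
        by (simp add: poincare_const_def)
      finally show "\<bar>pip (\<lambda>x. F x $ i) (\<lambda>x. s x $ i)\<bar> \<le> pnrm (\<lambda>x. F x $ i) * (?c * HV.nrm s)"
        using L2.nrm_nonneg[OF FS] by (simp add: mult_left_mono)
    qed
    finally show "\<bar>load F s\<bar> \<le> (\<Sum>i\<in>UNIV. pnrm (\<lambda>x. F x $ i) * ?c) * HV.nrm s"
      by (simp add: sum_distrib_right mult.assoc)
    show "load F (\<lambda>x. c *\<^sub>R s x) = c * load F s" for c
    proof -
      have "load F (\<lambda>x. c *\<^sub>R s x) = - (\<Sum>i\<in>UNIV. pip (\<lambda>x. F x $ i) (\<lambda>x. (c *\<^sub>R s x) $ i))"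
        by (rule load_eq[OF F]) (rule H1_vec_L2[OF HV.scale_mem[OF s]])
      also have "\<dots> = - (\<Sum>i\<in>UNIV. c * pip (\<lambda>x. F x $ i) (\<lambda>x. s x $ i))"
        using L2.ip_scale_right[OF L2_per_sqint[OF sL] FS, where c = c] by simp
      finally show ?thesis unfolding load_eq[OF F sL] by (simp add: sum_distrib_left)
    qed
    fix t assume "t \<in> P"
    then have t: "t \<in> H1_per0_vec" by (rule sub)
    note tL = H1_vec_L2[OF t]
    have "load F (\<lambda>x. s x + t x) = - (\<Sum>i\<in>UNIV. pip (\<lambda>x. F x $ i) (\<lambda>x. (s x + t x) $ i))"
      by (rule load_eq[OF F]) (rule H1_vec_L2[OF HV.add_mem[OF s t]])
    also have "\<dots> = - (\<Sum>i\<in>UNIV. pip (\<lambda>x. F x $ i) (\<lambda>x. s x $ i) + pip (\<lambda>x. F x $ i) (\<lambda>x. t x $ i))"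
      using L2.ip_add_right[OF L2_per_sqint[OF sL] L2_per_sqint[OF tL] FS] by simp
    finally show "load F (\<lambda>x. s x + t x) = load F s + load F t"
      unfolding load_eq[OF F sL] load_eq[OF F tL] by (simp add: sum.distrib)
  qed (simp_all add: kappa sub pert_add_right pert_scale_right pert_diff_left pert_bound)
  then obtain v where v: "v \<in> P" and eq: "\<And>s. s \<in> P \<Longrightarrow> jac_ip v s + pert v s = load F s" by blast
  then have "solves_in P At bt F v"
    unfolding solves_in_def using B2_eq[OF sub[OF v] sub] by (simp add: load_def)
  then show ?thesis by blast
qed

text \<open>With \<open>P = Q\<close> this is the uniqueness argument, with the full space for
  \<open>Q\<close> it is orthogonality of the discretisation error.\<close>

lemma galerkin_orthogonality:
  assumes P: "P \<subseteq> Q" "Q \<subseteq> H1_per0_vec" and u: "solves_in Q At bt F u" and v: "solves_in P At bt F v" and w: "w \<in> P"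
  shows "B2 At bt (\<lambda>x. u x - v x) w = 0"
proof -
  have mem: "u \<in> H1_per0_vec" "v \<in> H1_per0_vec" "w \<in> H1_per0_vec"
    using assms by (auto simp: solves_in_def)
  show ?thesis
    unfolding B2_diff_left[OF mem] using u v w P by (auto simp: solves_in_def)
qed

lemma nrm_0_if_B2_0:
  assumes v: "v \<in> H1_per0_vec" and B: "B2 At bt v v = 0" shows "HV.nrm v = 0"
proof -
  have "(1 - \<kappa>) * (HV.nrm v)\<^sup>2 \<le> 0" using B2_coercive[OF v] B by simp
  then have "(HV.nrm v)\<^sup>2 \<le> 0" using kappa by (simp add: mult_le_0_iff)
  then show ?thesis by simp
qed

lemma solution_ex1_ae:
  assumes P: "semi_hilbert P jac_ip" "P \<subseteq> H1_per0_vec" and F: "\<And>i. (\<lambda>x. F x $ i) \<in> L2_per"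
  shows "ex1_ae (solves_in P At bt F)"
proof -
  interpret P: semi_hilbert P jac_ip by fact
  obtain \<rho> where \<rho>: "solves_in P At bt F \<rho>" using solution_exists[OF P F] by blast
  have "AE x in lebesgue. g x = \<rho> x" if g: "solves_in P At bt F g" for g
  proof -
    have mem: "g \<in> P" "\<rho> \<in> P" using g \<rho> by (auto simp: solves_in_def)
    have d: "(\<lambda>x. g x - \<rho> x) \<in> P" by (rule P.diff_mem[OF mem])
    have dH: "(\<lambda>x. g x - \<rho> x) \<in> H1_per0_vec" using d P(2) by blast
    have "HV.nrm (\<lambda>x. g x - \<rho> x) = 0"
      by (rule nrm_0_if_B2_0[OF dH galerkin_orthogonality[OF order_refl P(2) g \<rho> d]])
    from HV_nrm_eq_0_AE[OF dH this] show ?thesis by eventually_elim simp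
  qed
  with \<rho> show ?thesis unfolding ex1_ae_def by blast
qed

text \<open>Cea's argument: the error splits into \<open>u - w\<close> and \<open>w - v\<close>, the
  latter lies in \<open>P\<close> and is annihilated, and what remains compares coercivity constant
  1 - \<kappa> with continuity constant 1 + \<kappa>.\<close>

lemma quasi_optimality:
  assumes P: "semi_hilbert P jac_ip" "P \<subseteq> H1_per0_vec"
    and u: "solves_in H1_per0_vec At bt F u" and v: "solves_in P At bt F v" and w: "w \<in> P"
  shows "HV.nrm (\<lambda>x. u x - v x) \<le> (1 + \<kappa>) / (1 - \<kappa>) * HV.nrm (\<lambda>x. u x - w x)"
proof -
  interpret P: semi_hilbert P jac_ip by fact
  have mem: "u \<in> H1_per0_vec" "v \<in> P" using u v by (auto simp: solves_in_def)
  then have vH: "v \<in> H1_per0_vec" and wH: "w \<in> H1_per0_vec" using P(2) w by auto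
  let ?e = "\<lambda>x. u x - v x" and ?d = "\<lambda>x. u x - w x" and ?z = "\<lambda>x. w x - v x"
  have e: "?e \<in> H1_per0_vec" and d: "?d \<in> H1_per0_vec" and z: "?z \<in> H1_per0_vec"
    using HV.diff_mem mem(1) vH wH by auto
  have orth: "B2 At bt ?e ?z = 0"
    by (rule galerkin_orthogonality[OF P(2) order_refl u v P.diff_mem[OF w mem(2)]])
  have "B2 At bt ?e (\<lambda>x. ?d x + ?z x) = B2 At bt ?e ?d + B2 At bt ?e ?z"
    using B2_eq[OF e HV.add_mem[OF d z]] B2_eq[OF e d] B2_eq[OF e z] HV.ip_add_right[OF d z e] pert_add_right[OF e d z]
    by simp
  then have "B2 At bt ?e ?e = B2 At bt ?e ?d" using orth by simp
  then have "(1 - \<kappa>) * (HV.nrm ?e)\<^sup>2 \<le> (1 + \<kappa>) * HV.nrm ?e * HV.nrm ?d"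
    using B2_coercive[OF e] B2_bounded[OF e d] by linarith
  then have "HV.nrm ?e * ((1 - \<kappa>) * HV.nrm ?e) \<le> HV.nrm ?e * ((1 + \<kappa>) * HV.nrm ?d)"
    by (simp add: power2_eq_square mult_ac)
  then have "(1 - \<kappa>) * HV.nrm ?e \<le> (1 + \<kappa>) * HV.nrm ?d"
    using HV.nrm_nonneg[OF e] HV.nrm_nonneg[OF d] kappa
    by (cases "HV.nrm ?e = 0") (auto simp: mult_le_cancel_left)
  then show ?thesis using kappa by (simp add: field_simps)
qed

end

section \<open>Very weak solutions\<close>

lemma H2_per_H1_per: "\<phi> \<in> H2_per \<Longrightarrow> \<phi> \<in> H1_per" "\<phi> \<in> H2_per \<Longrightarrow> wpd i \<phi> \<in> H1_per"
  by (auto simp: H2_per_def)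

text \<open>Both sides have the same products with every H1 function, by parts and
  \<open>pip_wpd_swap\<close>. It reconciles \<open>Hess\<close>, whose entry i j differentiates
  first in j, with the Jacobian of \<open>Grad\<close>, which has the opposite order.\<close>

lemma wpd_wpd_swap:
  assumes \<phi>: "\<phi> \<in> H2_per"
  shows "AE x in lebesgue. wpd j (wpd i \<phi>) x = wpd i (wpd j \<phi>) x"
proof -
  note H = H2_per_H1_per[OF \<phi>] and L = H1_per_wpd_L2_per[OF H2_per_H1_per(2)[OF \<phi>]]
  have "AE x in lebesgue. wpd j (wpd i \<phi>) x - wpd i (wpd j \<phi>) x = 0"
  proof (rule H1_per_orthogonal_zero[OF L2_per_diff[OF L L]])
    fix \<eta> :: "real ^ 'a \<Rightarrow> real" assume \<eta>: "\<eta> \<in> H1_per"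
    have "pip (wpd j (wpd i \<phi>)) \<eta> = - pip (wpd i \<phi>) (wpd j \<eta>)" by (rule integration_by_parts[OF H(2) \<eta>])
    also have "\<dots> = - pip (wpd j \<phi>) (wpd i \<eta>)" by (simp add: pip_wpd_swap[OF H(1) \<eta>, of i j])
    also have "\<dots> = pip (wpd i (wpd j \<phi>)) \<eta>" by (simp add: integration_by_parts[OF H(2) \<eta>])
    finally show "pip (\<lambda>x. wpd j (wpd i \<phi>) x - wpd i (wpd j \<phi>) x) \<eta> = 0"
      using L2.ip_diff[OF L2_per_sqint[OF L] L2_per_sqint[OF L] L2_per_sqint[OF H1_per_L2_per[OF \<eta>]], of j i i j] by simp
  qed
  then show ?thesis by eventually_elim simp
qed

lemma Grad_H1_per0_vec:
  assumes \<phi>: "\<phi> \<in> H2_per" shows "Grad \<phi> \<in> H1_per0_vec"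
  using H2_per_H1_per[OF \<phi>] mean_wpd[OF H2_per_H1_per(1)[OF \<phi>]]
  by (simp add: H1_per0_vec_iff Grad_def H1_per0_def)

lemma Jac_Grad: "Jac (Grad \<phi>) x = (\<chi> i j. wpd j (wpd i \<phi>) x)"
  by (simp add: Jac_def Grad_def)

lemma Jac_Grad_AE:
  assumes \<phi>: "\<phi> \<in> H2_per"
  shows "AE x in lebesgue. Jac (Grad \<phi>) x = Hess \<phi> x \<and> transpose (Jac (Grad \<phi>) x) = Jac (Grad \<phi>) x"
proof -
  have "AE x in lebesgue. \<forall>i j. wpd j (wpd i \<phi>) x = wpd i (wpd j \<phi>) x"
    unfolding AE_all_countable by (intro allI wpd_wpd_swap \<phi>)
  then show ?thesis by eventually_elim (simp add: Jac_Grad Hess_def vec_eq_iff transpose_def)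
qed

context cordes begin

lemma Hess_term_AE:
  assumes \<phi>: "\<phi> \<in> H2_per"
  shows "AE x in lebesgue. At x \<bullet> Hess \<phi> x + bt x \<bullet> Grad \<phi> x = Div (Grad \<phi>) x + rem (Grad \<phi>) x"
  using Jac_Grad_AE[OF \<phi>] by eventually_elim (simp add: At_bt_split[symmetric])

lemma Hess_term_pip:
  assumes \<phi>: "\<phi> \<in> H2_per" and u: "u \<in> L2_per"
  shows "(LINT x:Ycell|lebesgue. u x * (At x \<bullet> Hess \<phi> x + bt x \<bullet> Grad \<phi> x)) = pip u (Div (Grad \<phi>)) + pip u (rem (Grad \<phi>))"
proof -
  note G = Grad_H1_per0_vec[OF \<phi>]
  note S = L2_per_sqint[OF Div_L2_per[OF G]] rem_sqint[OF G]
  let ?h = "\<lambda>x. At x \<bullet> Hess \<phi> x + bt x \<bullet> Grad \<phi> x"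
  have m: "?h \<in> borel_measurable lebesgue"
  proof -
    have "?h = (\<lambda>x. (\<Sum>i\<in>UNIV. \<Sum>j\<in>UNIV. At x $ i $ j * wpd i (wpd j \<phi>) x) + (\<Sum>i\<in>UNIV. bt x $ i * wpd i \<phi> x))"
      by (simp add: fun_eq_iff inner_mat Hess_def inner_vec_def[of "bt _"] Grad_def)
    then show ?thesis
      by (simp only:) (intro borel_measurable_add borel_measurable_sum borel_measurable_times At_meas bt_meas
          L2_per_meas H1_per_wpd_L2_per H2_per_H1_per \<phi>)
  qed
  have "(LINT x:Ycell|lebesgue. u x * ?h x) = pip u (\<lambda>x. Div (Grad \<phi>) x + rem (Grad \<phi>) x)"
    unfolding set_integral_cell
  proof (rule integral_cong_AE)
    show "AE x in cell. u x * ?h x = u x * (Div (Grad \<phi>) x + rem (Grad \<phi>) x)"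
      using AE_cellI[OF Hess_term_AE[OF \<phi>]] by eventually_elim simp
    show "(\<lambda>x. u x * ?h x) \<in> borel_measurable cell"
      by (intro borel_measurable_times cell_measurable m L2_per_meas u)
    show "(\<lambda>x. u x * (Div (Grad \<phi>) x + rem (Grad \<phi>) x)) \<in> borel_measurable cell"
      by (intro borel_measurable_times borel_measurable_add sqint_meas[OF S(1)] sqint_meas[OF S(2)] cell_measurable L2_per_meas u)
  qed
  also have "\<dots> = pip u (Div (Grad \<phi>)) + pip u (rem (Grad \<phi>))"
    by (rule L2.ip_add_right[OF S L2_per_sqint[OF u]])
  finally show ?thesis .
qed

text \<open>The Jacobian of a gradient is symmetric, so the antisymmetric term of the div-curl
  identity vanishes.\<close>

lemma curl_Grad:
  assumes \<phi>: "\<phi> \<in> H2_per" and v: "v \<in> H1_per0_vec"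
  shows "jac_ip v (Grad \<phi>) = pip (Div v) (Div (Grad \<phi>))"
proof -
  have "(\<integral>x. (Jac v x - transpose (Jac v x)) \<bullet> (Jac (Grad \<phi>) x - transpose (Jac (Grad \<phi>) x)) \<partial>cell) = 0"
    by (rule integral_eq_zero_AE) (use AE_cellI[OF Jac_Grad_AE[OF \<phi>]] in \<open>auto elim: eventually_mono\<close>)
  then show ?thesis using div_curl_identity[OF v Grad_H1_per0_vec[OF \<phi>]] by simp
qed

lemma very_weak_solution_Div:
  assumes u: "solves_in H1_per0_vec At bt F \<rho>"
  shows "very_weak_solution At bt F (\<lambda>x. - Div \<rho> x)"
proof -
  have \<rho>: "\<rho> \<in> H1_per0_vec" using u by (simp add: solves_in_def)
  have L: "(\<lambda>x. - Div \<rho> x) \<in> L2_per" using L2_per_cmult[OF Div_L2_per[OF \<rho>], of "- 1"] by simp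
  have "(LINT x:Ycell|lebesgue. - Div \<rho> x * (At x \<bullet> Hess \<phi> x + bt x \<bullet> Grad \<phi> x)) = (LINT x:Ycell|lebesgue. F x \<bullet> Grad \<phi> x)"
    if \<phi>: "\<phi> \<in> H2_per" for \<phi>
  proof -
    note G = Grad_H1_per0_vec[OF \<phi>]
    have "pip (Div \<rho>) (Div (Grad \<phi>)) + pip (Div \<rho>) (rem (Grad \<phi>)) = B2 At bt \<rho> (Grad \<phi>)"
      by (simp add: B2_eq[OF \<rho> G] curl_Grad[OF \<phi> \<rho>] pert_def)
    also have "\<dots> = - (LINT x:Ycell|lebesgue. F x \<bullet> Grad \<phi> x)" using u G by (simp add: solves_in_def)
    finally show ?thesis unfolding Hess_term_pip[OF \<phi> L] by simp
  qed
  then show ?thesis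
    using L Div_mean[OF \<rho>] by (simp add: very_weak_solution_def set_integral_cell)
qed

lemma very_weak_solution_unique:
  assumes u: "very_weak_solution At bt F u" and v: "very_weak_solution At bt F v"
  shows "AE x in lebesgue. u x = v x"
proof -
  have uL: "u \<in> L2_per" and vL: "v \<in> L2_per" using u v by (auto simp: very_weak_solution_def)
  note S = L2_per_sqint[OF uL] L2_per_sqint[OF vL]
  let ?d = "\<lambda>x. u x - v x"
  have d: "?d \<in> L2_per" by (rule L2_per_diff[OF uL vL])
  have "integral\<^sup>L cell ?d = 0"
    using u v cell.sqint_integrable[OF S(1)] cell.sqint_integrable[OF S(2)]
    by (simp add: very_weak_solution_def set_integral_cell)
  then obtain \<psi> where \<psi>: "\<psi> \<in> H2_per" and lap: "AE x in lebesgue. (\<Sum>i\<in>UNIV. wpd i (wpd i \<psi>) x) = ?d x"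
    using poisson_H2_per[OF d] by blast
  note G = Grad_H1_per0_vec[OF \<psi>]
  note GS = L2_per_sqint[OF Div_L2_per[OF G]] rem_sqint[OF G]
  have Div: "AE x in lebesgue. Div (Grad \<psi>) x = ?d x"
    using lap by (simp add: Div_def Grad_def)
  have dS: "?d \<in> sqint cell" by (rule L2_per_sqint[OF d])
  have 1: "pip ?d (Div (Grad \<psi>)) = pip ?d ?d" by (rule pip_rem_cong[OF dS GS(1) dS Div])
  \<comment> \<open>For periodic functions the L2 norms of the Hessian and of the Laplacian are
    equal, the equality case of the Miranda-Talenti estimate. It lets \<open>rem_bound\<close> be
    expressed through \<open>?d\<close>.\<close>
  have 2: "HV.nrm (Grad \<psi>) = pnrm ?d"
  proof -
    have "HV.nrm (Grad \<psi>) = pnrm (Div (Grad \<psi>))" by (simp add: HV.nrm_def curl_Grad[OF \<psi> G] L2.nrm_def)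
    also have "\<dots> = pnrm ?d" by (rule L2nrm_cong_AE[OF sqint_meas[OF GS(1)] sqint_meas[OF dS] AE_cellI[OF Div]])
    finally show ?thesis .
  qed
  have "pip u (Div (Grad \<psi>)) + pip u (rem (Grad \<psi>)) = pip v (Div (Grad \<psi>)) + pip v (rem (Grad \<psi>))"
    using u v \<psi> unfolding very_weak_solution_def Hess_term_pip[OF \<psi> uL, symmetric] Hess_term_pip[OF \<psi> vL, symmetric] by simp
  then have "pip ?d ?d + pip ?d (rem (Grad \<psi>)) = 0"
    unfolding 1[symmetric] L2.ip_diff[OF S GS(1)] L2.ip_diff[OF S GS(2)] by simp
  moreover have "\<bar>pip ?d (rem (Grad \<psi>))\<bar> \<le> pnrm ?d * (\<kappa> * pnrm ?d)"
    using order_trans[OF L2.cauchy_schwarz[OF dS GS(2)] mult_left_mono[OF rem_bound[OF G] L2.nrm_nonneg[OF dS]]]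
    unfolding 2 .
  ultimately have "(pnrm ?d)\<^sup>2 \<le> \<kappa> * (pnrm ?d)\<^sup>2"
    unfolding L2.nrm_sq[OF dS, symmetric] power2_eq_square by (simp only: mult_ac)
  then have "(1 - \<kappa>) * (pnrm ?d)\<^sup>2 \<le> 0" by (simp add: algebra_simps)
  then have "(pnrm ?d)\<^sup>2 \<le> 0" using kappa by (simp add: mult_le_0_iff)
  then have "pnrm ?d = 0" by simp
  from L2_per_AE_eq[OF uL vL this] show ?thesis .
qed

lemma error_estimate:
  assumes P: "semi_hilbert P jac_ip" "P \<subseteq> H1_per0_vec"
    and u: "solves_in H1_per0_vec At bt F u" and v: "solves_in P At bt F v"
  shows "L2norm (\<lambda>x. - Div u x - - Div v x) \<le> (1 + \<kappa>) / (1 - \<kappa>) * (INF w\<in>P. L2norm (Jac (\<lambda>x. u x - w x)))"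
proof -
  interpret P: semi_hilbert P jac_ip by fact
  let ?C = "(1 + \<kappa>) / (1 - \<kappa>)"
  have C: "0 < ?C" using kappa by simp
  have mem: "u \<in> H1_per0_vec" "v \<in> H1_per0_vec" using u v P(2) by (auto simp: solves_in_def)
  note e = HV.diff_mem[OF mem]
  have "L2norm (\<lambda>x. - Div u x - - Div v x) = pnrm (Div (\<lambda>x. u x - v x))"
  proof -
    have "L2norm (\<lambda>x. - Div u x - - Div v x) = pnrm (\<lambda>x. Div v x - Div u x)"
      by (simp add: L2norm_eq add.commute[of "- _"])
    also have "\<dots> = pnrm (\<lambda>x. Div u x - Div v x)"
      by (rule L2.nrm_minus) (intro L2_per_sqint Div_L2_per mem)+
    also have "\<dots> = pnrm (Div (\<lambda>x. u x - v x))"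
      by (rule L2nrm_cong_AE)
         (use AE_cellI[OF Div_diff_AE[OF mem]] in \<open>auto elim: eventually_mono
           intro!: sqint_meas[OF L2_per_sqint[OF Div_L2_per[OF e]]] sqint_meas[OF L2_per_sqint[OF L2_per_diff[OF Div_L2_per[OF mem(1)] Div_L2_per[OF mem(2)]]]]\<close>)
    finally show ?thesis .
  qed
  also have "\<dots> \<le> HV.nrm (\<lambda>x. u x - v x)" by (rule pnrm_Div_le[OF e])
  finally have le: "L2norm (\<lambda>x. - Div u x - - Div v x) \<le> HV.nrm (\<lambda>x. u x - v x)" .
  \<comment> \<open>Division by the constant turns quasi-optimality into a lower bound common to all
    w, which therefore passes to the infimum.\<close>
  have "HV.nrm (\<lambda>x. u x - v x) / ?C \<le> (INF w\<in>P. L2norm (Jac (\<lambda>x. u x - w x)))"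
  proof (rule cINF_greatest)
    show "P \<noteq> {}" using P.zero_mem by blast
    fix w assume w: "w \<in> P"
    then have "L2norm (Jac (\<lambda>x. u x - w x)) = HV.nrm (\<lambda>x. u x - w x)"
      using P(2) mem by (intro L2norm_Jac HV.diff_mem) auto
    then show "HV.nrm (\<lambda>x. u x - v x) / ?C \<le> L2norm (Jac (\<lambda>x. u x - w x))"
      using quasi_optimality[OF P u v w] C by (simp only: pos_divide_le_eq mult.commute)
  qed
  then have "HV.nrm (\<lambda>x. u x - v x) \<le> ?C * (INF w\<in>P. L2norm (Jac (\<lambda>x. u x - w x)))"
    using C by (simp only: pos_divide_le_eq mult.commute)
  with le show ?thesis by (rule order_trans)
qed

end

section \<open>From the Cordes condition to the perturbation bound\<close>

text \<open>The factor tr M / s minimises g^2 s - 2 g tr M + n over g, which is the squared distance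
  of (g M, g v) from (I, 0). The minimum n - (tr M)^2 / s is at most 1 - \<delta> precisely by the
  Cordes condition.\<close>

lemma cordes_pointwise:
  fixes M :: "real ^ 'n ^ 'n" and v :: "real ^ 'n"
  defines "s \<equiv> (norm M)\<^sup>2 + (norm v)\<^sup>2"
  assumes t: "0 < trace M" and cond: "s / (trace M)\<^sup>2 \<le> 1 / (real CARD('n) - 1 + \<delta>)"
    and pos: "0 < real CARD('n) - 1 + \<delta>"
  shows "(norm ((trace M / s) *\<^sub>R M - mat 1))\<^sup>2 + (norm ((trace M / s) *\<^sub>R v))\<^sup>2 \<le> 1 - \<delta>"
proof -
  let ?t = "trace M" and ?g = "trace M / s"
  have "M \<noteq> 0" using t by (auto simp: trace_def)
  then have s: "0 < s" unfolding s_def by (intro add_pos_nonneg) auto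
  have "(norm (?g *\<^sub>R M - mat 1))\<^sup>2 = ?g\<^sup>2 * (norm M)\<^sup>2 - 2 * ?g * ?t + real CARD('n)"
  proof -
    have "mat 1 \<bullet> (mat 1 :: real ^ 'n ^ 'n) = real CARD('n)" by (simp add: inner_mat_1 trace_I)
    then show ?thesis
      unfolding power2_norm_eq_inner using s
      by (simp add: inner_diff_left inner_diff_right inner_mat_1 inner_commute[of M "mat 1"] power2_eq_square field_simps)
  qed
  moreover have "(norm (?g *\<^sub>R v))\<^sup>2 = ?g\<^sup>2 * (norm v)\<^sup>2" by (simp add: power_mult_distrib power_divide)
  ultimately have "(norm (?g *\<^sub>R M - mat 1))\<^sup>2 + (norm (?g *\<^sub>R v))\<^sup>2 = ?g\<^sup>2 * s - 2 * ?g * ?t + real CARD('n)"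
    by (simp add: s_def distrib_left)
  also have "\<dots> = real CARD('n) - ?t\<^sup>2 / s"
    using s by (simp add: power2_eq_square field_simps)
  also have "\<dots> \<le> 1 - \<delta>"
  proof -
    have "s * (real CARD('n) - 1 + \<delta>) \<le> ?t\<^sup>2"
      using cond t pos by (simp add: divide_le_eq le_divide_eq mult.commute field_simps)
    then have "real CARD('n) - 1 + \<delta> \<le> ?t\<^sup>2 / s" using s by (simp add: le_divide_eq mult.commute)
    then show ?thesis by simp
  qed
  finally show ?thesis .
qed

lemma borel_measurable_comp:
  fixes f :: "'a \<Rightarrow> real ^ 'n"
  assumes "f \<in> borel_measurable M" shows "(\<lambda>x. f x $ i) \<in> borel_measurable M"
  using borel_measurable_inner[OF assms borel_measurable_const[of "axis i 1"]] by (simp add: inner_axis)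

lemma borel_measurable_comp2:
  fixes f :: "'a \<Rightarrow> real ^ 'n ^ 'm"
  assumes "f \<in> borel_measurable M" shows "(\<lambda>x. f x $ i $ j) \<in> borel_measurable M"
  using borel_measurable_inner[OF assms borel_measurable_const[of "axis i (axis j 1)"]] by (simp add: inner_axis)

lemma L2_per_comp:
  fixes F :: "real ^ 'n \<Rightarrow> real ^ 'm"
  assumes F: "F \<in> L2_per" shows "(\<lambda>x. F x $ i) \<in> L2_per"
proof -
  have m: "F \<in> borel_measurable lebesgue" and p: "Y_periodic F"
    and int: "\<And>K. compact K \<Longrightarrow> set_integrable lebesgue K (\<lambda>x. (norm (F x))\<^sup>2)"
    using F by (auto simp: L2_per_def L2_loc_def)
  note mi = borel_measurable_comp[OF m, of i]
  have "set_integrable lebesgue K (\<lambda>x. (norm (F x $ i))\<^sup>2)" if K: "compact K" for K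
  proof (rule set_integrable_bound[OF int[OF K]])
    have [measurable]: "K \<in> sets lebesgue" using K by (simp add: compact_imp_closed)
    show "set_borel_measurable lebesgue K (\<lambda>x. (norm (F x $ i))\<^sup>2)"
      unfolding set_borel_measurable_def using mi by measurable
    show "AE x\<in>K in lebesgue. norm ((norm (F x $ i))\<^sup>2) \<le> norm ((norm (F x))\<^sup>2)"
      using component_le_norm_cart[of "F _" i] by (intro AE_I2) (simp add: power2_le_iff_abs_le abs_le_square_iff[symmetric])
  qed
  then show ?thesis
    using mi Y_periodic_comp[OF p, of "\<lambda>y. y $ i"] by (simp add: L2_per_def L2_loc_def)
qed

text \<open>Machin's formula pi / 4 = 4 arctan (1/5) - arctan (1/239) with arctan x \<le> x. The
  bound is sharp enough, since 5/64 times its square is 4/5.\<close>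

lemma pi_le: "pi \<le> 16 / 5"
  using pi_machin arctan_le_self[of "1 / 5"] zero_le_arctan_iff[of "1 / 239"] by linarith

text \<open>The lower bound for \<delta> says 1 - \<delta> < pi^2 / (n + pi^2), the reciprocal of 1
  + n / pi^2, and the Poincare constant is at most n / pi^2.\<close>

lemma cordes_small:
  assumes \<delta>: "real CARD('n :: finite) / (real CARD('n) + pi\<^sup>2) < \<delta>" "\<delta> \<le> 1"
  shows "(1 - \<delta>) * (1 + poincare_const TYPE('n)) < 1"
proof -
  let ?n = "real CARD('n)"
  have n: "0 < ?n" by simp
  have pi2: "0 < pi\<^sup>2" "pi\<^sup>2 \<le> (16 / 5)\<^sup>2" using pi_le by (auto intro: power_mono)
  have "5 / 64 * ?n * pi\<^sup>2 \<le> 5 / 64 * ?n * (16 / 5)\<^sup>2" using pi2 n by (intro mult_left_mono) auto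
  also have "\<dots> \<le> ?n" using n by (simp add: power2_eq_square)
  finally have K: "poincare_const TYPE('n) * pi\<^sup>2 \<le> ?n" by (simp add: poincare_const_def)
  have "1 - \<delta> < 1 - ?n / (?n + pi\<^sup>2)" using \<delta> by simp
  also have "\<dots> = pi\<^sup>2 / (?n + pi\<^sup>2)"
  proof -
    have "?n + pi\<^sup>2 \<noteq> 0" using add_pos_pos[OF n pi2(1)] by simp
    then show ?thesis by (simp add: diff_divide_eq_iff)
  qed
  finally have d: "1 - \<delta> < pi\<^sup>2 / (?n + pi\<^sup>2)" .
  have "(1 - \<delta>) * (1 + poincare_const TYPE('n)) < pi\<^sup>2 / (?n + pi\<^sup>2) * (1 + poincare_const TYPE('n))"
  proof (rule mult_strict_right_mono[OF d])
    show "0 < 1 + poincare_const TYPE('n)" unfolding poincare_const_def by (intro add_pos_nonneg) auto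
  qed
  also have "\<dots> \<le> 1"
  proof -
    have "pi\<^sup>2 * (1 + poincare_const TYPE('n)) \<le> ?n + pi\<^sup>2" using K by (simp add: algebra_simps)
    then show ?thesis using add_pos_pos[OF n pi2(1)] by (simp add: divide_le_eq)
  qed
  finally show ?thesis .
qed

lemma settingB_cordes:
  fixes A :: "real ^ 'n \<Rightarrow> real ^ 'n ^ 'n" and b :: "real ^ 'n \<Rightarrow> real ^ 'n"
  assumes B: "settingB lam Lam \<delta> A b"
  shows "cordes (\<lambda>x. renorm A b x *\<^sub>R A x) (\<lambda>x. renorm A b x *\<^sub>R b x) \<delta>"
proof
  let ?n = "real CARD('n)"
  have mA: "A \<in> borel_measurable lebesgue" and mb: "b \<in> borel_measurable lebesgue"
    using B by (auto simp: settingB_def Linf_per_def)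
  have nA: "(\<lambda>x. norm (A x)) \<in> borel_measurable lebesgue" and nb: "(\<lambda>x. norm (b x)) \<in> borel_measurable lebesgue"
    using mA mb by measurable
  have mr: "renorm A b \<in> borel_measurable lebesgue"
    unfolding renorm_def[abs_def] trace_def
    by (intro borel_measurable_divide borel_measurable_sum borel_measurable_comp2 borel_measurable_add
        borel_measurable_power nA nb mA)
  show "(\<lambda>x. (renorm A b x *\<^sub>R A x) $ i $ j) \<in> borel_measurable lebesgue" for i j
    using borel_measurable_times[OF mr borel_measurable_comp2[OF mA]] by simp
  show "(\<lambda>x. (renorm A b x *\<^sub>R b x) $ i) \<in> borel_measurable lebesgue" for i
    using borel_measurable_times[OF mr borel_measurable_comp[OF mb]] by simp
  have \<delta>: "?n / (?n + pi\<^sup>2) < \<delta>" and d1: "\<delta> \<le> 1" and lam: "0 < lam" using B by (auto simp: settingB_def)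
  show "\<delta> \<le> 1" by (rule d1)
  show "(1 - \<delta>) * (1 + poincare_const TYPE('n)) < 1" by (rule cordes_small[OF \<delta> d1])
  \<comment> \<open>In dimension one the denominator n - 1 + \<delta> is \<delta> itself, so its
    positivity has to come from the lower bound for \<delta>.\<close>
  have "0 \<le> ?n / (?n + pi\<^sup>2)" by (intro divide_nonneg_nonneg add_nonneg_nonneg) auto
  then have "0 < \<delta>" using \<delta> by linarith
  moreover have n1: "1 \<le> ?n" using zero_less_card_finite[where ?'a = 'n] by linarith
  ultimately have pos: "0 < ?n - 1 + \<delta>" by linarith
  have ell: "AE x in lebesgue. \<forall>\<xi>. lam * (norm \<xi>)\<^sup>2 \<le> \<xi> \<bullet> (A x *v \<xi>) \<and> \<xi> \<bullet> (A x *v \<xi>) \<le> Lam * (norm \<xi>)\<^sup>2"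
    and cond: "AE x in lebesgue. ((norm (A x))\<^sup>2 + (norm (b x))\<^sup>2) / (trace (A x))\<^sup>2 \<le> 1 / (?n - 1 + \<delta>)"
    using B by (auto simp: settingB_def)
  show "AE x in lebesgue. (norm (renorm A b x *\<^sub>R A x - mat 1))\<^sup>2 + (norm (renorm A b x *\<^sub>R b x))\<^sup>2 \<le> 1 - \<delta>"
    using ell cond
  proof eventually_elim
    case (elim x)
    \<comment> \<open>Ellipticity tested on unit vectors bounds the diagonal below. The trace is
      then positive, which keeps the quotient in the Cordes condition genuine.\<close>
    have "lam \<le> A x $ i $ i" for i
    proof -
      have "lam * (norm (axis i 1 :: real ^ 'n))\<^sup>2 \<le> axis i 1 \<bullet> (A x *v axis i 1)" using elim(1) by blast
      then show ?thesis by (simp add: matrix_vector_mult_basis inner_axis' column_def)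
    qed
    then have "(\<Sum>i\<in>(UNIV :: 'n set). lam) \<le> trace (A x)" unfolding trace_def by (intro sum_mono)
    then have "?n * lam \<le> trace (A x)" by simp
    moreover have "0 < ?n * lam" using n1 lam by (intro mult_pos_pos) linarith+
    ultimately have "0 < trace (A x)" by linarith
    from cordes_pointwise[OF this elim(2) pos] show ?case by (simp only: renorm_def)
  qed
qed

theorem theorem3p3:
  fixes lam Lam \<delta> :: real
  shows "\<exists>C>0. \<forall>(A :: real ^ 'n \<Rightarrow> real ^ 'n ^ 'n) (b :: real ^ 'n \<Rightarrow> real ^ 'n)
                (F :: real ^ 'n \<Rightarrow> real ^ 'n) At bt.
     settingB lam Lam \<delta> A b \<and> F \<in> L2_per \<and>
     At = (\<lambda>x. renorm A b x *\<^sub>R A x) \<and> bt = (\<lambda>x. renorm A b x *\<^sub>R b x) \<longrightarrow>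
     ex1_ae (solves_in H1_per0_vec At bt F) \<and>
     (\<forall>\<rho>0 u0. solves_in H1_per0_vec At bt F \<rho>0 \<and> u0 = (\<lambda>x. - Div \<rho>0 x) \<longrightarrow>
        very_weak_solution At bt F u0 \<and>
        (\<forall>u. very_weak_solution At bt F u \<longrightarrow> (AE x in lebesgue. u x = u0 x)) \<and>
        (\<forall>P. closed_subspace_H1_per0 P \<longrightarrow>
           ex1_ae (solves_in P At bt F) \<and>
           (\<forall>\<rho>h uh. solves_in P At bt F \<rho>h \<and> uh = (\<lambda>x. - Div \<rho>h x) \<longrightarrow>
              uh \<in> L2_per \<and>
              L2norm (\<lambda>x. u0 x - uh x)
                \<le> C * (INF w\<in>P. L2norm (Jac (\<lambda>x. \<rho>0 x - w x))))))"
proof -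
  define k where "k = sqrt ((1 - \<delta>) * (1 + poincare_const TYPE('n)))"
  \<comment> \<open>Without coefficients in the setting for this \<open>\<delta>\<close> the claim is empty and \<open>k < 1\<close> may fail.\<close>
  define C where "C = (if 0 \<le> k \<and> k < 1 then (1 + k) / (1 - k) else 1)"
  have "0 < C" by (simp add: C_def)
  have main: "ex1_ae (solves_in H1_per0_vec At bt F) \<and>
     (\<forall>\<rho>0 u0. solves_in H1_per0_vec At bt F \<rho>0 \<and> u0 = (\<lambda>x. - Div \<rho>0 x) \<longrightarrow>
        very_weak_solution At bt F u0 \<and>
        (\<forall>u. very_weak_solution At bt F u \<longrightarrow> (AE x in lebesgue. u x = u0 x)) \<and>
        (\<forall>P. closed_subspace_H1_per0 P \<longrightarrow>
           ex1_ae (solves_in P At bt F) \<and>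
           (\<forall>\<rho>h uh. solves_in P At bt F \<rho>h \<and> uh = (\<lambda>x. - Div \<rho>h x) \<longrightarrow>
              uh \<in> L2_per \<and>
              L2norm (\<lambda>x. u0 x - uh x)
                \<le> C * (INF w\<in>P. L2norm (Jac (\<lambda>x. \<rho>0 x - w x))))))"
    if B: "settingB lam Lam \<delta> A b" and F: "F \<in> L2_per"
      and At: "At = (\<lambda>x. renorm A b x *\<^sub>R A x)" and bt: "bt = (\<lambda>x. renorm A b x *\<^sub>R b x)"
    for A :: "real ^ 'n \<Rightarrow> real ^ 'n ^ 'n" and b F :: "real ^ 'n \<Rightarrow> real ^ 'n" and At bt
  proof -
    interpret cordes At bt \<delta> unfolding At bt by (rule settingB_cordes[OF B])
    have C: "C = (1 + \<kappa>) / (1 - \<kappa>)" using kappa by (simp add: C_def k_def \<kappa>_def)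
    note Fc = L2_per_comp[OF F]
    have sub: "P \<subseteq> H1_per0_vec" if "closed_subspace_H1_per0 P" for P :: "(real ^ 'n \<Rightarrow> real ^ 'n) set"
      using that by (simp add: closed_subspace_H1_per0_def)
    show ?thesis
    proof (intro conjI allI impI; (elim conjE)?)
      show "ex1_ae (solves_in H1_per0_vec At bt F)"
        by (rule solution_ex1_ae[OF semi_hilbert_H1_per0_vec order_refl Fc])
      fix \<rho>0 u0
      assume r: "solves_in H1_per0_vec At bt F \<rho>0" and u0: "u0 = (\<lambda>x. - Div \<rho>0 x)"
      show vw: "very_weak_solution At bt F u0" unfolding u0 by (rule very_weak_solution_Div[OF r])
      show "AE x in lebesgue. u x = u0 x" if "very_weak_solution At bt F u" for u
        by (rule very_weak_solution_unique[OF that vw])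
      fix P :: "(real ^ 'n \<Rightarrow> real ^ 'n) set" assume P: "closed_subspace_H1_per0 P"
      note PH = semi_hilbert_closed_subspace[OF P] sub[OF P]
      show "ex1_ae (solves_in P At bt F)" by (rule solution_ex1_ae[OF PH Fc])
      fix \<rho>h uh
      assume h: "solves_in P At bt F \<rho>h" and uh: "uh = (\<lambda>x. - Div \<rho>h x)"
      have "\<rho>h \<in> H1_per0_vec" using h PH(2) by (auto simp: solves_in_def)
      then show "uh \<in> L2_per" using L2_per_cmult[OF Div_L2_per, of \<rho>h "- 1"] by (simp add: uh)
      show "L2norm (\<lambda>x. u0 x - uh x) \<le> C * (INF w\<in>P. L2norm (Jac (\<lambda>x. \<rho>0 x - w x)))"
        unfolding u0 uh C by (rule error_estimate[OF PH r h])
    qed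
  qed
  show ?thesis
    by (rule exI[where x = C], rule conjI[OF \<open>0 < C\<close>], intro allI impI, elim conjE) (rule main)
qed

end
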